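(* Let $k$ be a field of characteristic zero, let $(W,\omega)$ be a finite-dimensional symplectic vector space over $k$, let $\mathfrak h=W\oplus\mathfrak z$ be the corresponding Heisenberg Lie algebra with one-dimensional center $\mathfrak z=k z$, let $\mathfrak l\subset W$ be a Lagrangian (maximal isotropic) subspace and $\mathfrak p=\mathfrak l\oplus\mathfrak z$. Let $\mathcal M(\mathfrak z)^\times$ be the category of $\mathfrak z$-modules on which $z$ acts invertibly, and let $\mathcal M_{\mathfrak l}(\mathfrak h)^\times$ be the category of $\mathfrak h$-modules on which $\mathfrak l$ acts locally nilpotently and $z$ acts invertibly. Define functors $$F:\mathcal M_{\mathfrak l}(\mathfrak h)^\times\to\mathcal M(\mathfrak z)^\times,\quad F(M):=M^{\mathfrak l},\qquad G:\mathcal M(\mathfrak z)^\times\to\mathcal M_{\mathfrak l}(\mathfrak h)^\times,\quad G(N):=\mathcal U(\mathfrak h)\otimes_{\mathcal U(\mathfrak p)}E(N).$$ Then $F$ and $G$ are quasi-inverse to each other; in particular the categories $\mathcal M_{\mathfrak l}(\mathfrak h)^\times$ and $\mathcal M(\mathfrak z)^\times$ are equivalent.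
   Context: The Heisenberg Lie algebra $\mathfrak h=W\oplus k z$ has bracket $[w,w']=\omega(w,w')z$ for $w,w'\in W$, with $z$ central. $\mathcal U(\cdot)$ denotes the universal enveloping algebra. $M^{\mathfrak l}=\{m\in M: \mathfrak l m=0\}$ is the space of $\mathfrak l$-invariants, a $\mathfrak z$-module. $E(N)$ is the extension of the $\mathfrak z$-module $N$ to a $\mathfrak p$-module on which $\mathfrak l$ acts by zero. A Lie algebra $\mathfrak l$ acts locally nilpotently on $M$ if for every $m\in M$ there is $i$ such that every product of $i$ elements of $\mathfrak l$ kills $m$. Categories of modules have all module homomorphisms as morphisms. *)

theory Defs
  imports
    "HOL-Algebra.Algebraic_Closure_Type"
    "HOL-Algebra.QuotRing"
    "HOL-Algebra.Free_Abelian_Groups"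
    "HOL-Library.Poly_Mapping"
    "HOL-Library.FuncSet"
begin

section \<open>Categories\<close>

record ('o, 'a) category =
  Obj :: "'o set"
  Hom :: "'o \<Rightarrow> 'o \<Rightarrow> 'a set"
  Ident :: "'o \<Rightarrow> 'a"
  Comp :: "'o \<Rightarrow> 'o \<Rightarrow> 'o \<Rightarrow> 'a \<Rightarrow> 'a \<Rightarrow> 'a"

text \<open>Hom sets of different pairs of objects may overlap, so composition is indexed by objects:
  \<open>Comp C A B E g f\<close> is the composite of \<open>f : A \<rightarrow> B\<close> and \<open>g : B \<rightarrow> E\<close>.\<close>

definition is_category :: "('o, 'a) category \<Rightarrow> bool" where
  "is_category C \<longleftrightarrow>
    (\<forall>A\<in>Obj C. Ident C A \<in> Hom C A A) \<and>
    (\<forall>A\<in>Obj C. \<forall>B\<in>Obj C. \<forall>E\<in>Obj C. \<forall>f\<in>Hom C A B. \<forall>g\<in>Hom C B E. Comp C A B E g f \<in> Hom C A E) \<and>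
    (\<forall>A\<in>Obj C. \<forall>B\<in>Obj C. \<forall>f\<in>Hom C A B.
       Comp C A A B f (Ident C A) = f \<and> Comp C A B B (Ident C B) f = f) \<and>
    (\<forall>A\<in>Obj C. \<forall>B\<in>Obj C. \<forall>E\<in>Obj C. \<forall>V\<in>Obj C. \<forall>f\<in>Hom C A B. \<forall>g\<in>Hom C B E. \<forall>h\<in>Hom C E V.
       Comp C A E V h (Comp C A B E g f) = Comp C A B V (Comp C B E V h g) f)"

record ('o, 'a, 'p, 'b) functor_data =
  on_obj :: "'o \<Rightarrow> 'p"
  on_hom :: "'o \<Rightarrow> 'o \<Rightarrow> 'a \<Rightarrow> 'b"

definition is_functor ::
  "('o, 'a) category \<Rightarrow> ('p, 'b) category \<Rightarrow> ('o, 'a, 'p, 'b) functor_data \<Rightarrow> bool" where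
  "is_functor C D F \<longleftrightarrow> is_category C \<and> is_category D \<and>
    (\<forall>A\<in>Obj C. on_obj F A \<in> Obj D) \<and>
    (\<forall>A\<in>Obj C. \<forall>B\<in>Obj C. \<forall>f\<in>Hom C A B. on_hom F A B f \<in> Hom D (on_obj F A) (on_obj F B)) \<and>
    (\<forall>A\<in>Obj C. on_hom F A A (Ident C A) = Ident D (on_obj F A)) \<and>
    (\<forall>A\<in>Obj C. \<forall>B\<in>Obj C. \<forall>E\<in>Obj C. \<forall>f\<in>Hom C A B. \<forall>g\<in>Hom C B E.
       on_hom F A E (Comp C A B E g f) =
       Comp D (on_obj F A) (on_obj F B) (on_obj F E) (on_hom F B E g) (on_hom F A B f))"

definition id_functor :: "('o, 'a, 'o, 'a) functor_data" where
  "id_functor = \<lparr>on_obj = (\<lambda>A. A), on_hom = (\<lambda>A B f. f)\<rparr>"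

definition comp_functor ::
  "('p, 'b, 'q, 'c) functor_data \<Rightarrow> ('o, 'a, 'p, 'b) functor_data \<Rightarrow> ('o, 'a, 'q, 'c) functor_data" where
  "comp_functor G F = \<lparr>on_obj = (\<lambda>A. on_obj G (on_obj F A)),
     on_hom = (\<lambda>A B f. on_hom G (on_obj F A) (on_obj F B) (on_hom F A B f))\<rparr>"

definition is_isomorphism :: "('o, 'a) category \<Rightarrow> 'o \<Rightarrow> 'o \<Rightarrow> 'a \<Rightarrow> bool" where
  "is_isomorphism C A B f \<longleftrightarrow> f \<in> Hom C A B \<and>
    (\<exists>g\<in>Hom C B A. Comp C A B A g f = Ident C A \<and> Comp C B A B f g = Ident C B)"

definition naturally_isomorphic ::
  "('o, 'a) category \<Rightarrow> ('p, 'b) category \<Rightarrow>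
   ('o, 'a, 'p, 'b) functor_data \<Rightarrow> ('o, 'a, 'p, 'b) functor_data \<Rightarrow> bool" where
  "naturally_isomorphic C D F G \<longleftrightarrow>
    (\<exists>\<eta>. (\<forall>A\<in>Obj C. is_isomorphism D (on_obj F A) (on_obj G A) (\<eta> A)) \<and>
      (\<forall>A\<in>Obj C. \<forall>B\<in>Obj C. \<forall>f\<in>Hom C A B.
        Comp D (on_obj F A) (on_obj F B) (on_obj G B) (\<eta> B) (on_hom F A B f) =
        Comp D (on_obj F A) (on_obj G A) (on_obj G B) (on_hom G A B f) (\<eta> A)))"

definition quasi_inverse ::
  "('o, 'a) category \<Rightarrow> ('p, 'b) category \<Rightarrow>
   ('o, 'a, 'p, 'b) functor_data \<Rightarrow> ('p, 'b, 'o, 'a) functor_data \<Rightarrow> bool" where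
  "quasi_inverse C D F G \<longleftrightarrow> is_functor C D F \<and> is_functor D C G \<and>
    naturally_isomorphic C C (comp_functor G F) id_functor \<and>
    naturally_isomorphic D D (comp_functor F G) id_functor"

definition equivalent_categories :: "('o, 'a) category \<Rightarrow> ('p, 'b) category \<Rightarrow> bool" where
  "equivalent_categories C D \<longleftrightarrow> (\<exists>F G. quasi_inverse C D F G)"


section \<open>Lie algebras and their modules\<close>

text \<open>Lie algebras and modules have a carrier set and extend the library's module record; of its
  fields, \<open>mult\<close> and \<open>one\<close> are never used. The base field is the type \<open>'k\<close>.
  The fields of a record are only relevant on the carriers; in particular a subalgebra is
  obtained by an update of the carrier, and a module over a Lie algebra is, as the same record, its
  own restriction to a subalgebra.\<close>

record ('k, 'g) lie_alg = "('k, 'g) module" +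
  bracket :: "'g \<Rightarrow> 'g \<Rightarrow> 'g"

locale lie_algebra = module "ring_of_type_algebra :: 'k::field ring" L
  for L :: "('k::field, 'g) lie_alg" +
  assumes bracket_closed: "\<lbrakk>x \<in> carrier L; y \<in> carrier L\<rbrakk> \<Longrightarrow> bracket L x y \<in> carrier L"
    and bracket_add_left: "\<lbrakk>x \<in> carrier L; y \<in> carrier L; v \<in> carrier L\<rbrakk> \<Longrightarrow>
      bracket L (x \<oplus>\<^bsub>L\<^esub> y) v = bracket L x v \<oplus>\<^bsub>L\<^esub> bracket L y v"
    and bracket_add_right: "\<lbrakk>x \<in> carrier L; y \<in> carrier L; v \<in> carrier L\<rbrakk> \<Longrightarrow>
      bracket L v (x \<oplus>\<^bsub>L\<^esub> y) = bracket L v x \<oplus>\<^bsub>L\<^esub> bracket L v y"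
    and bracket_smult_left: "\<lbrakk>x \<in> carrier L; y \<in> carrier L\<rbrakk> \<Longrightarrow>
      bracket L (c \<odot>\<^bsub>L\<^esub> x) y = c \<odot>\<^bsub>L\<^esub> bracket L x y"
    and bracket_smult_right: "\<lbrakk>x \<in> carrier L; y \<in> carrier L\<rbrakk> \<Longrightarrow>
      bracket L x (c \<odot>\<^bsub>L\<^esub> y) = c \<odot>\<^bsub>L\<^esub> bracket L x y"
    and bracket_self: "x \<in> carrier L \<Longrightarrow> bracket L x x = \<zero>\<^bsub>L\<^esub>"
    and jacobi: "\<lbrakk>x \<in> carrier L; y \<in> carrier L; v \<in> carrier L\<rbrakk> \<Longrightarrow>
      bracket L x (bracket L y v) \<oplus>\<^bsub>L\<^esub> bracket L y (bracket L v x) \<oplus>\<^bsub>L\<^esub> bracket L v (bracket L x y)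
        = \<zero>\<^bsub>L\<^esub>"

record ('k, 'g, 'm) lie_mod = "('k, 'm) module" +
  act :: "'g \<Rightarrow> 'm \<Rightarrow> 'm"

locale lie_module = L: lie_algebra L + M: module "ring_of_type_algebra :: 'k::field ring" M
  for L :: "('k::field, 'g) lie_alg" and M :: "('k, 'g, 'm) lie_mod" +
  assumes act_closed: "\<lbrakk>x \<in> carrier L; m \<in> carrier M\<rbrakk> \<Longrightarrow> act M x m \<in> carrier M"
    and act_add_left: "\<lbrakk>x \<in> carrier L; y \<in> carrier L; m \<in> carrier M\<rbrakk> \<Longrightarrow>
      act M (x \<oplus>\<^bsub>L\<^esub> y) m = act M x m \<oplus>\<^bsub>M\<^esub> act M y m"
    and act_smult_left: "\<lbrakk>x \<in> carrier L; m \<in> carrier M\<rbrakk> \<Longrightarrow>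
      act M (c \<odot>\<^bsub>L\<^esub> x) m = c \<odot>\<^bsub>M\<^esub> act M x m"
    and act_add_right: "\<lbrakk>x \<in> carrier L; m \<in> carrier M; n \<in> carrier M\<rbrakk> \<Longrightarrow>
      act M x (m \<oplus>\<^bsub>M\<^esub> n) = act M x m \<oplus>\<^bsub>M\<^esub> act M x n"
    and act_smult_right: "\<lbrakk>x \<in> carrier L; m \<in> carrier M\<rbrakk> \<Longrightarrow>
      act M x (c \<odot>\<^bsub>M\<^esub> m) = c \<odot>\<^bsub>M\<^esub> act M x m"
    and act_bracket: "\<lbrakk>x \<in> carrier L; y \<in> carrier L; m \<in> carrier M\<rbrakk> \<Longrightarrow>
      act M (bracket L x y) m = act M x (act M y m) \<ominus>\<^bsub>M\<^esub> act M y (act M x m)"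

definition lie_mod_hom ::
  "('k, 'g) lie_alg \<Rightarrow> ('k, 'g, 'm) lie_mod \<Rightarrow> ('k, 'g, 'n) lie_mod \<Rightarrow> ('m \<Rightarrow> 'n) set" where
  "lie_mod_hom L M N = {f \<in> carrier M \<rightarrow>\<^sub>E carrier N.
     (\<forall>m\<in>carrier M. \<forall>n\<in>carrier M. f (m \<oplus>\<^bsub>M\<^esub> n) = f m \<oplus>\<^bsub>N\<^esub> f n) \<and>
     (\<forall>c. \<forall>m\<in>carrier M. f (c \<odot>\<^bsub>M\<^esub> m) = c \<odot>\<^bsub>N\<^esub> f m) \<and>
     (\<forall>x\<in>carrier L. \<forall>m\<in>carrier M. f (act M x m) = act N x (f m))}"

text \<open>The full subcategory, on the objects satisfying \<open>P\<close>, of the category of \<open>L\<close>-modules whose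
  carrier is a subset of the type \<open>'m\<close> (which plays the role of the universe).\<close>

definition lie_mod_category ::
  "('k::field, 'g) lie_alg \<Rightarrow> (('k, 'g, 'm) lie_mod \<Rightarrow> bool) \<Rightarrow>
   (('k, 'g, 'm) lie_mod, 'm \<Rightarrow> 'm) category" where
  "lie_mod_category L P = \<lparr>
     Obj = {M. lie_module L M \<and> P M},
     Hom = lie_mod_hom L,
     Ident = (\<lambda>M. \<lambda>m\<in>carrier M. m),
     Comp = (\<lambda>M N K g f. compose (carrier M) g f)\<rparr>"

definition locally_nilpotent :: "'g set \<Rightarrow> ('k, 'g, 'm) lie_mod \<Rightarrow> bool" where
  "locally_nilpotent S M \<longleftrightarrow> (\<forall>m\<in>carrier M. \<exists>i. \<forall>xs. length xs = i \<and> set xs \<subseteq> S \<longrightarrow>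
     foldr (act M) xs m = \<zero>\<^bsub>M\<^esub>)"

definition acts_invertibly :: "'g \<Rightarrow> ('k, 'g, 'm) lie_mod \<Rightarrow> bool" where
  "acts_invertibly x M \<longleftrightarrow> bij_betw (act M x) (carrier M) (carrier M)"

definition invariants :: "'g set \<Rightarrow> ('k, 'g, 'm) lie_mod \<Rightarrow> 'm set" where
  "invariants S M = {m \<in> carrier M. \<forall>x\<in>S. act M x m = \<zero>\<^bsub>M\<^esub>}"


section \<open>The universal enveloping algebra\<close>

text \<open>The monoid algebra over \<open>'k\<close> of this free monoid is the free associative algebra; its ring
  structure is the library's convolution product on finitely supported functions.\<close>

datatype 'g free_monoid = Word (letters: "'g list")

instantiation free_monoid :: (type) monoid_add
begin

definition zero_free_monoid :: "'a free_monoid" where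
  "0 = Word []"

definition plus_free_monoid :: "'a free_monoid \<Rightarrow> 'a free_monoid \<Rightarrow> 'a free_monoid" where
  "u + v = Word (letters u @ letters v)"

instance
  by standard (simp_all add: zero_free_monoid_def plus_free_monoid_def)

end

type_synonym ('k, 'g) free_alg = "'g free_monoid \<Rightarrow>\<^sub>0 'k"

definition free_algebra :: "'g set \<Rightarrow> ('k::field, 'g) free_alg ring" where
  "free_algebra S = ring_of_type_algebra
     \<lparr>carrier := {p. \<forall>w\<in>Poly_Mapping.keys p. set (letters w) \<subseteq> S}\<rparr>"

definition gen :: "'g \<Rightarrow> ('k::field, 'g) free_alg" where
  "gen x = Poly_Mapping.single (Word [x]) 1"

definition scalar :: "'k::field \<Rightarrow> ('k, 'g) free_alg" where
  "scalar c = Poly_Mapping.single 0 c"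

text \<open>Modulo the first two families of relations, the free algebra on the set \<open>carrier L\<close> is the
  tensor algebra of the vector space \<open>L\<close>.\<close>

definition env_relations :: "('k::field, 'g) lie_alg \<Rightarrow> ('k, 'g) free_alg set" where
  "env_relations L =
     {gen (x \<oplus>\<^bsub>L\<^esub> y) - gen x - gen y | x y. x \<in> carrier L \<and> y \<in> carrier L} \<union>
     {gen (c \<odot>\<^bsub>L\<^esub> x) - scalar c * gen x | c x. x \<in> carrier L} \<union>
     {gen x * gen y - gen y * gen x - gen (bracket L x y) | x y. x \<in> carrier L \<and> y \<in> carrier L}"

definition env_ideal :: "('k::field, 'g) lie_alg \<Rightarrow> ('k, 'g) free_alg set" where
  "env_ideal L = Idl\<^bsub>free_algebra (carrier L)\<^esub> (env_relations L)"

definition enveloping_algebra :: "('k::field, 'g) lie_alg \<Rightarrow> ('k, 'g) free_alg set ring" where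
  "enveloping_algebra L = free_algebra (carrier L) Quot env_ideal L"

definition env_class :: "('k::field, 'g) lie_alg \<Rightarrow> ('k, 'g) free_alg \<Rightarrow> ('k, 'g) free_alg set" where
  "env_class L p = env_ideal L +>\<^bsub>free_algebra (carrier L)\<^esub> p"

text \<open>The map \<open>\<U>(P) \<rightarrow> \<U>(L)\<close> for a subalgebra \<open>P\<close> of \<open>L\<close>; the result
  does not depend on the representative.\<close>

definition env_inclusion ::
  "('k::field, 'g) lie_alg \<Rightarrow> ('k, 'g) free_alg set \<Rightarrow> ('k, 'g) free_alg set" where
  "env_inclusion L u = env_class L (SOME p. p \<in> u)"

text \<open>The action of the enveloping algebra on a module; again independent of the representative.\<close>

definition free_act :: "('k::field, 'g, 'm) lie_mod \<Rightarrow> ('k, 'g) free_alg \<Rightarrow> 'm \<Rightarrow> 'm" where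
  "free_act M p m =
     (\<Oplus>\<^bsub>M\<^esub>w\<in>Poly_Mapping.keys p. Poly_Mapping.lookup p w \<odot>\<^bsub>M\<^esub> foldr (act M) (letters w) m)"

definition env_act :: "('k::field, 'g, 'm) lie_mod \<Rightarrow> ('k, 'g) free_alg set \<Rightarrow> 'm \<Rightarrow> 'm" where
  "env_act M u m = free_act M (SOME p. p \<in> u) m"


section \<open>Tensor products and induced modules\<close>

text \<open>Tensor product of a right module \<open>A\<close> and a left module \<open>B\<close> over a (noncommutative) ring with
  underlying set \<open>R\<close>, with actions \<open>ra\<close> and \<open>la\<close>: the abelian group
  generated by the symbols \<open>(a, b)\<close> modulo biadditivity and balancing.\<close>

definition tensor_relations ::
  "'r set \<Rightarrow> ('a, 'c) ring_scheme \<Rightarrow> ('a \<Rightarrow> 'r \<Rightarrow> 'a) \<Rightarrow> ('b, 'd) ring_scheme \<Rightarrow> ('r \<Rightarrow> 'b \<Rightarrow> 'b) \<Rightarrow>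
   ('a \<times> 'b \<Rightarrow>\<^sub>0 int) set" where
  "tensor_relations R A ra B la =
     {frag_of (a \<oplus>\<^bsub>A\<^esub> a', b) - frag_of (a, b) - frag_of (a', b) | a a' b.
        a \<in> carrier A \<and> a' \<in> carrier A \<and> b \<in> carrier B} \<union>
     {frag_of (a, b \<oplus>\<^bsub>B\<^esub> b') - frag_of (a, b) - frag_of (a, b') | a b b'.
        a \<in> carrier A \<and> b \<in> carrier B \<and> b' \<in> carrier B} \<union>
     {frag_of (ra a r, b) - frag_of (a, la r b) | a r b.
        a \<in> carrier A \<and> r \<in> R \<and> b \<in> carrier B}"

definition tensor_subgroup ::
  "'r set \<Rightarrow> ('a, 'c) ring_scheme \<Rightarrow> ('a \<Rightarrow> 'r \<Rightarrow> 'a) \<Rightarrow> ('b, 'd) ring_scheme \<Rightarrow> ('r \<Rightarrow> 'b \<Rightarrow> 'b) \<Rightarrow>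
   ('a \<times> 'b \<Rightarrow>\<^sub>0 int) set" where
  "tensor_subgroup R A ra B la =
     generate (free_Abelian_group (carrier A \<times> carrier B)) (tensor_relations R A ra B la)"

definition tensor_product ::
  "'r set \<Rightarrow> ('a, 'c) ring_scheme \<Rightarrow> ('a \<Rightarrow> 'r \<Rightarrow> 'a) \<Rightarrow> ('b, 'd) ring_scheme \<Rightarrow> ('r \<Rightarrow> 'b \<Rightarrow> 'b) \<Rightarrow>
   ('a \<times> 'b \<Rightarrow>\<^sub>0 int) set monoid" where
  "tensor_product R A ra B la =
     free_Abelian_group (carrier A \<times> carrier B) Mod tensor_subgroup R A ra B la"

text \<open>The map \<open>\<phi> \<otimes> \<psi>\<close>, where \<open>H\<close> is the subgroup of the target tensor product.\<close>

definition tensor_map ::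
  "('c \<times> 'd \<Rightarrow>\<^sub>0 int) set \<Rightarrow> ('a \<Rightarrow> 'c) \<Rightarrow> ('b \<Rightarrow> 'd) \<Rightarrow>
   ('a \<times> 'b \<Rightarrow>\<^sub>0 int) set \<Rightarrow> ('c \<times> 'd \<Rightarrow>\<^sub>0 int) set" where
  "tensor_map H \<phi> \<psi> t =
     H #>\<^bsub>free_Abelian_group UNIV\<^esub> frag_extend (\<lambda>(a, b). frag_of (\<phi> a, \<psi> b)) (SOME s. s \<in> t)"

type_synonym ('k, 'g, 'n) ind = "(('k, 'g) free_alg set \<times> 'n \<Rightarrow>\<^sub>0 int) set"

definition induced_subgroup ::
  "('k::field, 'g) lie_alg \<Rightarrow> ('k, 'g) lie_alg \<Rightarrow> ('k, 'g, 'n) lie_mod \<Rightarrow> ('k, 'g, 'n) ind" where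
  "induced_subgroup L P N = tensor_subgroup (carrier (enveloping_algebra P))
     (enveloping_algebra L) (\<lambda>a r. a \<otimes>\<^bsub>enveloping_algebra L\<^esub> env_inclusion L r) N (env_act N)"

definition induced_group ::
  "('k::field, 'g) lie_alg \<Rightarrow> ('k, 'g) lie_alg \<Rightarrow> ('k, 'g, 'n) lie_mod \<Rightarrow> ('k, 'g, 'n) ind monoid" where
  "induced_group L P N = tensor_product (carrier (enveloping_algebra P))
     (enveloping_algebra L) (\<lambda>a r. a \<otimes>\<^bsub>enveloping_algebra L\<^esub> env_inclusion L r) N (env_act N)"

definition induced_left_mult ::
  "('k::field, 'g) lie_alg \<Rightarrow> ('k, 'g) lie_alg \<Rightarrow> ('k, 'g, 'n) lie_mod \<Rightarrow>
   ('k, 'g) free_alg set \<Rightarrow> ('k, 'g, 'n) ind \<Rightarrow> ('k, 'g, 'n) ind" where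
  "induced_left_mult L P N u =
     tensor_map (induced_subgroup L P N) (\<lambda>a. u \<otimes>\<^bsub>enveloping_algebra L\<^esub> a) (\<lambda>n. n)"

definition induced_module ::
  "('k::field, 'g) lie_alg \<Rightarrow> ('k, 'g) lie_alg \<Rightarrow> ('k, 'g, 'n) lie_mod \<Rightarrow>
   ('k, 'g, ('k, 'g, 'n) ind) lie_mod" where
  "induced_module L P N = \<lparr>
     carrier = carrier (induced_group L P N), monoid.mult = undefined, one = undefined,
     ring.zero = \<one>\<^bsub>induced_group L P N\<^esub>, add = (\<lambda>s t. s \<otimes>\<^bsub>induced_group L P N\<^esub> t),
     module.smult = (\<lambda>c. induced_left_mult L P N (env_class L (scalar c))),
     act = (\<lambda>x. induced_left_mult L P N (env_class L (gen x)))\<rparr>"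

text \<open>The induced module of a module with carrier in \<open>'n\<close> has its carrier in another type. To
  stay inside one universe \<open>'u\<close>, it is replaced by an isomorphic copy along a chosen injection of
  its carrier into \<open>'u\<close>. Such an injection exists when \<open>N\<close> has its carrier in \<open>'u\<close> and \<open>L\<close> is
  finite-dimensional over an infinite field: the induced module is zero if \<open>N\<close> is, and otherwise
  has at most as many elements as \<open>N\<close>.\<close>

definition chosen_embedding :: "('k, 'g, 'm) lie_mod \<Rightarrow> 'm \<Rightarrow> 'u" where
  "chosen_embedding M = (SOME e. inj_on e (carrier M))"

definition transport :: "('m \<Rightarrow> 'u) \<Rightarrow> ('k, 'g, 'm) lie_mod \<Rightarrow> ('k, 'g, 'u) lie_mod" where
  "transport e M = (let r = inv_into (carrier M) e in \<lparr>
     carrier = e ` carrier M, monoid.mult = undefined, one = undefined,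
     ring.zero = e \<zero>\<^bsub>M\<^esub>, add = (\<lambda>s t. e (r s \<oplus>\<^bsub>M\<^esub> r t)),
     module.smult = (\<lambda>c t. e (c \<odot>\<^bsub>M\<^esub> r t)), act = (\<lambda>x t. e (act M x (r t)))\<rparr>)"


section \<open>Symplectic spaces and Heisenberg Lie algebras\<close>

locale symplectic_space = vector_space scale
  for scale :: "'k::field \<Rightarrow> 'w::ab_group_add \<Rightarrow> 'w" +
  fixes \<omega> :: "'w \<Rightarrow> 'w \<Rightarrow> 'k"
  assumes finite_dimensional: "\<exists>B. finite B \<and> span B = UNIV"
    and linear_left: "Vector_Spaces.linear scale (*) (\<lambda>v. \<omega> v w)"
    and linear_right: "Vector_Spaces.linear scale (*) (\<lambda>w. \<omega> v w)"
    and alternating: "\<omega> v v = 0"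
    and nondegenerate: "(\<forall>w. \<omega> v w = 0) \<Longrightarrow> v = 0"

definition isotropic ::
  "('k::field \<Rightarrow> 'w::ab_group_add \<Rightarrow> 'w) \<Rightarrow> ('w \<Rightarrow> 'w \<Rightarrow> 'k) \<Rightarrow> 'w set \<Rightarrow> bool" where
  "isotropic scale \<omega> S \<longleftrightarrow> module.subspace scale S \<and> (\<forall>v\<in>S. \<forall>w\<in>S. \<omega> v w = 0)"

definition lagrangian ::
  "('k::field \<Rightarrow> 'w::ab_group_add \<Rightarrow> 'w) \<Rightarrow> ('w \<Rightarrow> 'w \<Rightarrow> 'k) \<Rightarrow> 'w set \<Rightarrow> bool" where
  "lagrangian scale \<omega> S \<longleftrightarrow> isotropic scale \<omega> S \<and>
     (\<forall>S'. isotropic scale \<omega> S' \<and> S \<subseteq> S' \<longrightarrow> S' = S)"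

text \<open>The pair \<open>(w, c)\<close> stands for \<open>w + c z\<close>.\<close>

definition heisenberg ::
  "('k::field \<Rightarrow> 'w::ab_group_add \<Rightarrow> 'w) \<Rightarrow> ('w \<Rightarrow> 'w \<Rightarrow> 'k) \<Rightarrow> ('k, 'w \<times> 'k) lie_alg" where
  "heisenberg scale \<omega> = \<lparr>
     carrier = UNIV, monoid.mult = undefined, one = undefined,
     ring.zero = (0, 0), add = (\<lambda>(v, a) (w, b). (v + w, a + b)),
     module.smult = (\<lambda>c (w, a). (scale c w, c * a)),
     bracket = (\<lambda>(v, a) (w, b). (0, \<omega> v w))\<rparr>"

definition z_elem :: "'w::zero \<times> 'k::one" where
  "z_elem = (0, 1)"

definition heis_center ::
  "('k::field \<Rightarrow> 'w::ab_group_add \<Rightarrow> 'w) \<Rightarrow> ('w \<Rightarrow> 'w \<Rightarrow> 'k) \<Rightarrow> ('k, 'w \<times> 'k) lie_alg" where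
  "heis_center scale \<omega> = (heisenberg scale \<omega>)\<lparr>carrier := {0} \<times> UNIV\<rparr>"

definition heis_polarization ::
  "('k::field \<Rightarrow> 'w::ab_group_add \<Rightarrow> 'w) \<Rightarrow> ('w \<Rightarrow> 'w \<Rightarrow> 'k) \<Rightarrow> 'w set \<Rightarrow> ('k, 'w \<times> 'k) lie_alg" where
  "heis_polarization scale \<omega> l = (heisenberg scale \<omega>)\<lparr>carrier := l \<times> UNIV\<rparr>"

lemma lie_algebra_heisenberg_subspace:
  assumes "symplectic_space scale \<omega>" and "module.subspace scale S"
  shows "lie_algebra ((heisenberg scale \<omega>)\<lparr>carrier := S \<times> UNIV\<rparr>)"
proof -
  interpret symplectic_space scale \<omega> by fact
  note S = subspace_0[OF assms(2)] subspace_add[OF assms(2)] subspace_scale[OF assms(2)]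
    subspace_neg[OF assms(2)]
  have [simp]: "\<omega> (v + w) u = \<omega> v u + \<omega> w u" "\<omega> (scale c v) u = c * \<omega> v u"
    "\<omega> u (v + w) = \<omega> u v + \<omega> u w" "\<omega> u (scale c v) = c * \<omega> u v" for u v w c
    using linear_left linear_right
    by (auto simp: Vector_Spaces.linear_def module_hom_def module_hom_axioms_def)
  have [simp]: "\<omega> v 0 = 0" "\<omega> 0 v = 0" for v
    by (metis scale_zero_left mult_zero_left \<open>\<And>u v c. \<omega> u (scale c v) = c * \<omega> u v\<close>,
        metis scale_zero_left mult_zero_left \<open>\<And>u v c. \<omega> (scale c v) u = c * \<omega> v u\<close>)
  have ag: "abelian_group ((heisenberg scale \<omega>)\<lparr>carrier := S \<times> UNIV\<rparr>)"
  proof (rule abelian_groupI)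
    fix x assume "x \<in> carrier ((heisenberg scale \<omega>)\<lparr>carrier := S \<times> UNIV\<rparr>)"
    then show "\<exists>y\<in>carrier ((heisenberg scale \<omega>)\<lparr>carrier := S \<times> UNIV\<rparr>).
        y \<oplus>\<^bsub>(heisenberg scale \<omega>)\<lparr>carrier := S \<times> UNIV\<rparr>\<^esub> x
          = \<zero>\<^bsub>(heisenberg scale \<omega>)\<lparr>carrier := S \<times> UNIV\<rparr>\<^esub>"
      by (intro bexI[of _ "(- fst x, - snd x)"]) (auto simp: heisenberg_def S)
  qed (auto simp: heisenberg_def S algebra_simps split: prod.splits)
  show ?thesis
    unfolding lie_algebra_def lie_algebra_axioms_def Module.module_def module_axioms_def
    using ag cring_from_type_algebra
    by (auto simp: heisenberg_def S ring_of_type_algebra_def alternating algebra_simps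
        split: prod.splits intro: cring_from_type_algebra)
qed

lemma lie_algebra_heis:
  assumes "symplectic_space scale \<omega>"
  shows "lie_algebra (heisenberg scale \<omega>)"
    and "lie_algebra (heis_center scale \<omega>)"
    and "isotropic scale \<omega> l \<Longrightarrow> lie_algebra (heis_polarization scale \<omega> l)"
proof -
  interpret symplectic_space scale \<omega> by fact
  have "(heisenberg scale \<omega>)\<lparr>carrier := UNIV \<times> UNIV\<rparr> = heisenberg scale \<omega>"
    by (simp add: heisenberg_def)
  then show "lie_algebra (heisenberg scale \<omega>)"
    using lie_algebra_heisenberg_subspace[OF assms subspace_UNIV] by simp
  show "lie_algebra (heis_center scale \<omega>)"
    unfolding heis_center_def
    by (rule lie_algebra_heisenberg_subspace[OF assms subspace_single_0])
  show "lie_algebra (heis_polarization scale \<omega> l)" if "isotropic scale \<omega> l"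
    using that lie_algebra_heisenberg_subspace[OF assms]
    by (simp add: heis_polarization_def isotropic_def)
qed

definition heis_category ::
  "('k::field \<Rightarrow> 'w::ab_group_add \<Rightarrow> 'w) \<Rightarrow> ('w \<Rightarrow> 'w \<Rightarrow> 'k) \<Rightarrow> 'w set \<Rightarrow>
   (('k, 'w \<times> 'k, 'u) lie_mod, 'u \<Rightarrow> 'u) category" where
  "heis_category scale \<omega> l = lie_mod_category (heisenberg scale \<omega>)
     (\<lambda>M. locally_nilpotent (l \<times> {0}) M \<and> acts_invertibly z_elem M)"

definition center_category ::
  "('k::field \<Rightarrow> 'w::ab_group_add \<Rightarrow> 'w) \<Rightarrow> ('w \<Rightarrow> 'w \<Rightarrow> 'k) \<Rightarrow>
   (('k, 'w \<times> 'k, 'u) lie_mod, 'u \<Rightarrow> 'u) category" where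
  "center_category scale \<omega> = lie_mod_category (heis_center scale \<omega>) (acts_invertibly z_elem)"


section \<open>The functors\<close>

definition invariants_functor ::
  "'w::zero set \<Rightarrow> (('k::zero, 'w \<times> 'k, 'u) lie_mod, 'u \<Rightarrow> 'u,
     ('k, 'w \<times> 'k, 'u) lie_mod, 'u \<Rightarrow> 'u) functor_data" where
  "invariants_functor l = \<lparr>
     on_obj = (\<lambda>M. M\<lparr>carrier := invariants (l \<times> {0}) M\<rparr>),
     on_hom = (\<lambda>M M' f. restrict f (invariants (l \<times> {0}) M))\<rparr>"

definition extension :: "('k, 'w::zero \<times> 'k, 'n) lie_mod \<Rightarrow> ('k, 'w \<times> 'k, 'n) lie_mod" where
  "extension N = N\<lparr>act := (\<lambda>(w, c) n. act N (0, c) n)\<rparr>"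

definition heis_induced ::
  "('k::field \<Rightarrow> 'w::ab_group_add \<Rightarrow> 'w) \<Rightarrow> ('w \<Rightarrow> 'w \<Rightarrow> 'k) \<Rightarrow> 'w set \<Rightarrow>
   ('k, 'w \<times> 'k, 'n) lie_mod \<Rightarrow> ('k, 'w \<times> 'k, ('k, 'w \<times> 'k, 'n) ind) lie_mod" where
  "heis_induced scale \<omega> l N =
     induced_module (heisenberg scale \<omega>) (heis_polarization scale \<omega> l) (extension N)"

definition heis_induced_map ::
  "('k::field \<Rightarrow> 'w::ab_group_add \<Rightarrow> 'w) \<Rightarrow> ('w \<Rightarrow> 'w \<Rightarrow> 'k) \<Rightarrow> 'w set \<Rightarrow>
   ('k, 'w \<times> 'k, 'n) lie_mod \<Rightarrow> ('n \<Rightarrow> 'n) \<Rightarrow> ('k, 'w \<times> 'k, 'n) ind \<Rightarrow> ('k, 'w \<times> 'k, 'n) ind" where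
  "heis_induced_map scale \<omega> l N' f = tensor_map
     (induced_subgroup (heisenberg scale \<omega>) (heis_polarization scale \<omega> l) (extension N')) (\<lambda>a. a) f"

definition induction_functor ::
  "('k::field \<Rightarrow> 'w::ab_group_add \<Rightarrow> 'w) \<Rightarrow> ('w \<Rightarrow> 'w \<Rightarrow> 'k) \<Rightarrow> 'w set \<Rightarrow>
   (('k, 'w \<times> 'k, 'u) lie_mod, 'u \<Rightarrow> 'u, ('k, 'w \<times> 'k, 'u) lie_mod, 'u \<Rightarrow> 'u) functor_data" where
  "induction_functor scale \<omega> l =
     (let I = heis_induced scale \<omega> l; e = (\<lambda>N. chosen_embedding (I N)) in \<lparr>
       on_obj = (\<lambda>N. transport (e N) (I N)),
       on_hom = (\<lambda>N N' f. \<lambda>t\<in>e N ` carrier (I N).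
         e N' (heis_induced_map scale \<omega> l N' f (inv_into (carrier (I N)) (e N) t)))\<rparr>)"

end

theory Submission
  imports Defs
begin

text \<open>
  Write \<open>W = l \<oplus> l'\<close> with a symplectic basis \<open>p\<^sub>i \<in> l\<close>, \<open>q\<^sub>i \<in> l'\<close>. On a module with \<open>z\<close> invertible and
  \<open>l\<close> locally nilpotent, \<open>p\<^sub>i\<^sup>n q\<^sub>i\<^sup>n v = n! z\<^sup>n v\<close> whenever \<open>p\<^sub>i v = 0\<close>. Subtracting
  \<open>(n! z\<^sup>n)\<^sup>-\<^sup>1 q\<^sub>i\<^sup>n p\<^sub>i\<^sup>n m\<close> from \<open>m\<close> lowers the order of nilpotency of \<open>p\<^sub>i\<close>, so the \<open>l\<close>-invariants generate
  the module; applying \<open>p\<^sub>i\<^sup>n\<close> to a sum of \<open>q\<^sub>i\<^sup>j v\<^sub>j\<close> shows that a module generated by a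
  \<open>z\<close>-stable space of invariants has no further invariants. Hence the invariants of \<open>G(N)\<close> are
  \<open>1 \<otimes> N\<close>, which is a copy of \<open>N\<close> because \<open>G(N)\<close> maps to a Fock space over \<open>N\<close>. The counit
  \<open>G(F(M)) \<rightarrow> M\<close> is surjective since invariants generate, and injective since a nonzero kernel would
  contain a nonzero invariant.
\<close>

section \<open>Weyl pairs\<close>

text \<open>A basis of the enveloping algebra (Poincare-Birkhoff-Witt) would exhibit
  \<open>G(N)\<close> as polynomials in the \<open>q\<close> directions with coefficients in
  \<open>N\<close>; the proof bypasses it. Two facts about the induced module carry the argument: it
  is generated by \<open>1 \<otimes> N\<close>, and it has the universal property of induction.
  Generation yields uniqueness of homomorphisms, local nilpotency and the upper bound for the
  invariants. The universal property yields the inverse of \<open>z\<close>, the counit and, through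
  the single test module of Fock type, injectivity of \<open>N \<rightarrow> G(N)\<close>. Dividing
  by \<open>n! z^n\<close> is where characteristic zero and invertibility of \<open>z\<close> enter.
  The several pairs are treated one at a time, by inductions over subsets of the basis, so that only
  computations with one pair remain. A separate obstacle is size: both categories live over one
  carrier type, while a tensor product has values in a larger type. A cardinality argument shows
  that the induced module fits back into the given type.\<close>

lemma ring_of_type_algebra_simps [simp]:
  "carrier (ring_of_type_algebra :: 'k::ring_1 ring) = UNIV"
  "a \<otimes>\<^bsub>(ring_of_type_algebra :: 'k::ring_1 ring)\<^esub> b = a * b"
  "\<one>\<^bsub>(ring_of_type_algebra :: 'k::ring_1 ring)\<^esub> = 1"
  "\<zero>\<^bsub>(ring_of_type_algebra :: 'k::ring_1 ring)\<^esub> = 0"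
  "a \<oplus>\<^bsub>(ring_of_type_algebra :: 'k::ring_1 ring)\<^esub> b = a + b"
  by (simp_all add: ring_of_type_algebra_def)

locale lin_space = Module.module "ring_of_type_algebra :: 'k::field ring" M
  for M :: "('k::field, 'm, 'x) module_scheme" (structure)
begin

abbreviation scal :: "'k \<Rightarrow> 'm \<Rightarrow> 'm" (infixr \<open>\<cdot>\<close> 75) where "c \<cdot> m \<equiv> module.smult M c m"

lemma scal_closed [simp]: "m \<in> carrier M \<Longrightarrow> c \<cdot> m \<in> carrier M"
  and scal_add_left: "m \<in> carrier M \<Longrightarrow> (c + d) \<cdot> m = c \<cdot> m \<oplus> d \<cdot> m"
  and scal_add_right: "m \<in> carrier M \<Longrightarrow> n \<in> carrier M \<Longrightarrow> c \<cdot> (m \<oplus> n) = c \<cdot> m \<oplus> c \<cdot> n"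
  and scal_mult: "m \<in> carrier M \<Longrightarrow> (c * d) \<cdot> m = c \<cdot> d \<cdot> m"
  and scal_one [simp]: "m \<in> carrier M \<Longrightarrow> 1 \<cdot> m = m"
  using smult_closed smult_l_distr smult_r_distr smult_assoc1 smult_one by auto

lemma scal_zero_left [simp]: "m \<in> carrier M \<Longrightarrow> 0 \<cdot> m = \<zero>"
  using smult_l_null by simp

lemma scal_zero_right [simp]: "c \<cdot> \<zero> = \<zero>"
  using smult_r_null[of c] by simp

lemma scal_minus_one: "m \<in> carrier M \<Longrightarrow> (- 1) \<cdot> m = \<ominus> m"
  using scal_add_left[of m "- 1" 1] M.minus_equality[of "(- 1) \<cdot> m" m] by simp

lemma scal_eq_zero_iff: "m \<in> carrier M \<Longrightarrow> c \<cdot> m = \<zero> \<longleftrightarrow> c = 0 \<or> m = \<zero>"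
  using scal_mult[of m "inverse c" c] by (cases "c = 0") auto

definition lin_subset :: "'m set \<Rightarrow> bool" where
  "lin_subset A \<longleftrightarrow> A \<subseteq> carrier M \<and> \<zero> \<in> A \<and> (\<forall>m\<in>A. \<forall>n\<in>A. m \<oplus> n \<in> A) \<and> (\<forall>c. \<forall>m\<in>A. c \<cdot> m \<in> A)"

lemma lin_subsetI:
  assumes "A \<subseteq> carrier M" "\<zero> \<in> A" "\<And>m n. m \<in> A \<Longrightarrow> n \<in> A \<Longrightarrow> m \<oplus> n \<in> A"
    "\<And>c m. m \<in> A \<Longrightarrow> c \<cdot> m \<in> A"
  shows "lin_subset A"
  using assms by (auto simp: lin_subset_def)

lemma lin_subsetD:
  assumes "lin_subset A"
  shows "A \<subseteq> carrier M" "\<And>m. m \<in> A \<Longrightarrow> m \<in> carrier M" "\<zero> \<in> A" "\<And>m n. m \<in> A \<Longrightarrow> n \<in> A \<Longrightarrow> m \<oplus> n \<in> A"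
    "\<And>c m. m \<in> A \<Longrightarrow> c \<cdot> m \<in> A" "\<And>m. m \<in> A \<Longrightarrow> \<ominus> m \<in> A"
  using assms by (auto simp: lin_subset_def simp flip: scal_minus_one)

definition endo :: "('m \<Rightarrow> 'm) \<Rightarrow> bool" where
  "endo T \<longleftrightarrow> (\<forall>m\<in>carrier M. T m \<in> carrier M) \<and>
     (\<forall>m\<in>carrier M. \<forall>n\<in>carrier M. T (m \<oplus> n) = T m \<oplus> T n) \<and> (\<forall>c. \<forall>m\<in>carrier M. T (c \<cdot> m) = c \<cdot> T m)"

lemma endoD:
  assumes "endo T"
  shows "m \<in> carrier M \<Longrightarrow> T m \<in> carrier M"
    "m \<in> carrier M \<Longrightarrow> n \<in> carrier M \<Longrightarrow> T (m \<oplus> n) = T m \<oplus> T n"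
    "m \<in> carrier M \<Longrightarrow> T (c \<cdot> m) = c \<cdot> T m"
    "T \<zero> = \<zero>"
    "m \<in> carrier M \<Longrightarrow> T (\<ominus> m) = \<ominus> T m"
proof -
  show *: "m \<in> carrier M \<Longrightarrow> T (c \<cdot> m) = c \<cdot> T m" "m \<in> carrier M \<Longrightarrow> T m \<in> carrier M"
    "m \<in> carrier M \<Longrightarrow> n \<in> carrier M \<Longrightarrow> T (m \<oplus> n) = T m \<oplus> T n" for c m n
    using assms by (auto simp: endo_def)
  show "T \<zero> = \<zero>" using *(1)[of \<zero> 0] *(2) by simp
  show "m \<in> carrier M \<Longrightarrow> T (\<ominus> m) = \<ominus> T m" using * by (simp flip: scal_minus_one)
qed

lemma endo_funpow: "endo T \<Longrightarrow> endo (T ^^ n)"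
  by (induction n) (auto simp: endo_def)

end

text \<open>The relation \<open>[P, Q] = Z\<close> of a Weyl algebra, with \<open>Z\<close> central
  and invertible, written without subtraction. On powers of \<open>Q\<close> applied to a vector
  killed by \<open>P\<close>, the operator \<open>P\<close> acts as \<open>Z\<close> times the
  derivative in \<open>Q\<close>.\<close>

locale weyl_pair = lin_space M
  for M :: "('k::field_char_0, 'm, 'x) module_scheme" (structure) +
  fixes P Q Z :: "'m \<Rightarrow> 'm"
  assumes endo_P: "endo P" and endo_Q: "endo Q" and endo_Z: "endo Z"
    and PQ: "m \<in> carrier M \<Longrightarrow> P (Q m) = Q (P m) \<oplus> Z m"
    and PZ: "m \<in> carrier M \<Longrightarrow> P (Z m) = Z (P m)"
    and QZ: "m \<in> carrier M \<Longrightarrow> Q (Z m) = Z (Q m)"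
    and bij_Z: "bij_betw Z (carrier M) (carrier M)"
begin

lemmas P_simps = endoD[OF endo_P] and Q_simps = endoD[OF endo_Q] and Z_simps = endoD[OF endo_Z]
  and P_pow_simps = endoD[OF endo_funpow[OF endo_P]] and Q_pow_simps = endoD[OF endo_funpow[OF endo_Q]]
  and Z_pow_simps = endoD[OF endo_funpow[OF endo_Z]]

lemma Q_pow_Z: "m \<in> carrier M \<Longrightarrow> (Q ^^ n) (Z m) = Z ((Q ^^ n) m)"
  by (induction n) (auto simp: QZ Q_pow_simps)

lemma P_Z_pow: "m \<in> carrier M \<Longrightarrow> P ((Z ^^ n) m) = (Z ^^ n) (P m)"
  by (induction n) (auto simp: PZ Z_pow_simps)

lemma bij_Z_pow: "bij_betw (Z ^^ n) (carrier M) (carrier M)"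
proof (induction n)
  case (Suc n)
  then show ?case using bij_betw_trans[OF Suc bij_Z] by (simp add: comp_def)
qed (auto simp: bij_betw_def)

lemma Z_pow_eq_zero_iff: "m \<in> carrier M \<Longrightarrow> (Z ^^ n) m = \<zero> \<longleftrightarrow> m = \<zero>"
  using bij_Z_pow[of n] Z_pow_simps(4)[of n] unfolding bij_betw_def inj_on_def by (metis M.zero_closed)

text \<open>Moving \<open>P\<close> through the \<open>n + 1\<close> factors \<open>Q\<close> leaves
  one \<open>Z\<close> per factor, and the term in which \<open>P\<close> reaches \<open>m\<close>
  vanishes.\<close>

lemma P_Q_pow: "m \<in> carrier M \<Longrightarrow> P m = \<zero> \<Longrightarrow> P ((Q ^^ Suc n) m) = of_nat (Suc n) \<cdot> Z ((Q ^^ n) m)"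
proof (induction n)
  case (Suc n)
  have "P ((Q ^^ Suc (Suc n)) m) = Q (P ((Q ^^ Suc n) m)) \<oplus> Z ((Q ^^ Suc n) m)"
    using PQ[of "(Q ^^ Suc n) m"] Suc.prems Q_pow_simps(1)[of m "Suc n"] by simp
  also have "\<dots> = of_nat (Suc n) \<cdot> Z ((Q ^^ Suc n) m) \<oplus> 1 \<cdot> Z ((Q ^^ Suc n) m)"
    using Suc by (simp add: Q_simps Z_simps QZ Q_pow_simps)
  also have "\<dots> = of_nat (Suc (Suc n)) \<cdot> Z ((Q ^^ Suc n) m)"
    using Suc.prems by (subst scal_add_left[symmetric]) (auto
      simp: Z_simps Q_simps Q_pow_simps algebra_simps)
  finally show ?case .
qed (auto simp: PQ Q_simps Z_simps)

text \<open>The derivative rule iterated. The induction ranges over all \<open>m\<close>, because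
  one step turns the vector into a multiple of \<open>Q^n (Z m)\<close>, and \<open>Z m\<close> is
  again killed by \<open>P\<close>.\<close>

lemma P_pow_Q_pow: "m \<in> carrier M \<Longrightarrow> P m = \<zero> \<Longrightarrow> (P ^^ n) ((Q ^^ n) m) = fact n \<cdot> (Z ^^ n) m"
proof (induction n arbitrary: m)
  case (Suc n)
  have "(P ^^ Suc n) ((Q ^^ Suc n) m) = (P ^^ n) (of_nat (Suc n) \<cdot> (Q ^^ n) (Z m))"
    using Suc.prems by (simp only: funpow_Suc_right comp_def P_Q_pow[unfolded funpow_Suc_right comp_def] Q_pow_Z)
  also have "\<dots> = of_nat (Suc n) \<cdot> fact n \<cdot> (Z ^^ n) (Z m)"
    using Suc.IH[of "Z m"] Suc.prems by (simp add: P_pow_simps Q_pow_simps Z_simps PZ del: of_nat_Suc)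
  also have "\<dots> = fact (Suc n) \<cdot> (Z ^^ Suc n) m"
    using Suc.prems by (simp add: funpow_swap1 Z_pow_simps Z_simps scal_mult)
  finally show ?case .
qed simp

text \<open>The induction step replaces \<open>m\<close> by \<open>m - (n! Z\<^sup>n)\<^sup>-\<^sup>1 Q\<^sup>n P\<^sup>n m\<close>, which is killed by \<open>P\<^sup>n\<close>.\<close>

lemma generated_by_kernel:
  assumes Y: "lin_subset Y" "\<And>m. m \<in> Y \<Longrightarrow> Q m \<in> Y"
    and C: "lin_subset C" "\<And>m. m \<in> C \<Longrightarrow> P m \<in> C" "\<And>m. m \<in> C \<Longrightarrow> Q m \<in> C"
      "\<And>m. m \<in> carrier M \<Longrightarrow> Z m \<in> C \<Longrightarrow> m \<in> C"
    and ker: "\<And>m. m \<in> C \<Longrightarrow> P m = \<zero> \<Longrightarrow> m \<in> Y"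
    and m: "m \<in> C" "(P ^^ n) m = \<zero>"
  shows "m \<in> Y"
  using m
proof (induction n arbitrary: m)
  case 0
  then show ?case using Y(1) by (auto simp: lin_subset_def)
next
  case (Suc n)
  have Cc: "m \<in> carrier M" if "m \<in> C" for m using C(1) that by (auto simp: lin_subset_def)
  have m: "m \<in> carrier M" using Suc Cc by auto
  have PnC: "(P ^^ n) m \<in> C" using Suc.prems(1) C(2) by (induction n) auto
  \<comment> \<open>\<open>v\<close> is \<open>P^n m\<close> divided by \<open>Z^n\<close>. It stays
    in \<open>C\<close> because \<open>C\<close> admits division by \<open>Z\<close>, and
    \<open>P\<close> kills it because \<open>P^(n+1) m = 0\<close>; so \<open>ker\<close> places it
    in \<open>Y\<close>.\<close>
  obtain v where v: "v \<in> carrier M" "(Z ^^ n) v = (P ^^ n) m"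
    using bij_Z_pow[of n] PnC Cc unfolding bij_betw_def by (metis image_iff)
  have "(Z ^^ n) v \<in> C \<Longrightarrow> v \<in> C" using v(1) C(4)
  proof (induction n arbitrary: v)
    case (Suc n)
    from Suc.prems(1) have "(Z ^^ n) (Z v) \<in> C" by (simp only: funpow_Suc_right comp_apply)
    then have "Z v \<in> C" using Suc.IH Suc.prems(2) Z_simps(1) C(4) by blast
    then show ?case using C(4) Suc.prems(2) by blast
  qed simp
  then have vC: "v \<in> C" using v PnC by simp
  have "(Z ^^ n) (P v) = \<zero>" using v P_Z_pow[of v n] Suc.prems(2) by simp
  then have Pv: "P v = \<zero>" using Z_pow_eq_zero_iff[of "P v" n] v P_simps by auto
  define u where "u = inverse (fact n) \<cdot> (Q ^^ n) v"
  have "v \<in> Y" using ker vC Pv by auto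
  then have "(Q ^^ n) v \<in> Y" using Y(2) by (induction n) auto
  then have uX: "u \<in> Y" unfolding u_def using lin_subsetD(5)[OF Y(1)] by auto
  have "(Q ^^ n) v \<in> C" using vC C(3) by (induction n) auto
  then have uC: "u \<in> C" unfolding u_def using lin_subsetD(5)[OF C(1)] by auto
  have "(P ^^ n) u = inverse (fact n) \<cdot> fact n \<cdot> (P ^^ n) m"
    unfolding u_def using v Pv P_pow_Q_pow[of v n] by (simp add: P_pow_simps Q_pow_simps)
  also have "\<dots> = (P ^^ n) m"
    using m by (simp add: P_pow_simps flip: scal_mult)
  finally have "(P ^^ n) (m \<oplus> \<ominus> u) = \<zero>"
    using m uC Cc by (simp add: P_pow_simps M.r_neg)
  moreover have "m \<oplus> \<ominus> u \<in> C" using Suc.prems uC C(1) by (simp add: lin_subsetD)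
  ultimately have "m \<oplus> \<ominus> u \<in> Y" using Suc.IH by auto
  then have "(m \<oplus> \<ominus> u) \<oplus> u \<in> Y" using uX Y(1) by (simp add: lin_subsetD)
  then show ?case using m uC Cc by (simp add: M.a_assoc M.l_neg)
qed

text \<open>\<open>layers A n\<close> is \<open>A + Q A + \<dots> + Q\<^sup>n\<^sup>-\<^sup>1 A\<close>.\<close>

primrec layers :: "'m set \<Rightarrow> nat \<Rightarrow> 'm set" where
  "layers A 0 = {\<zero>}"
| "layers A (Suc n) = {d \<oplus> (Q ^^ n) a | d a. d \<in> layers A n \<and> a \<in> A}"

lemma layers_closed: "A \<subseteq> carrier M \<Longrightarrow> d \<in> layers A n \<Longrightarrow> d \<in> carrier M"
  by (induction n arbitrary: d) (auto simp: Q_pow_simps subset_iff)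

context
  fixes A assumes A: "lin_subset A"
begin

lemma carrier_A: "a \<in> A \<Longrightarrow> a \<in> carrier M" and carrier_layers: "d \<in> layers A n \<Longrightarrow> d \<in> carrier M"
  using lin_subsetD[OF A] layers_closed by auto

lemma layers_zero: "\<zero> \<in> layers A n"
  by (induction n) (force intro!: exI[of _ \<zero>] simp: Q_pow_simps lin_subsetD[OF A])+

lemma layers_Suc: "d \<in> layers A n \<Longrightarrow> d \<in> layers A (Suc n)"
  unfolding layers.simps mem_Collect_eq
  by (rule exI[of _ d], rule exI[of _ \<zero>]) (use carrier_layers[of d n]
    in \<open>simp add: Q_pow_simps lin_subsetD[OF A]\<close>)

lemma layers_mono: "d \<in> layers A n \<Longrightarrow> n \<le> m \<Longrightarrow> d \<in> layers A m"
  by (induction m) (auto simp: le_Suc_eq intro: layers_Suc simp del: layers.simps(2))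

lemma layers_add: "d \<in> layers A n \<Longrightarrow> d' \<in> layers A n \<Longrightarrow> d \<oplus> d' \<in> layers A n"
proof (induction n arbitrary: d d')
  case (Suc n)
  then obtain e a e' a' where *: "d = e \<oplus> (Q ^^ n) a" "e \<in> layers A n" "a \<in> A"
    "d' = e' \<oplus> (Q ^^ n) a'" "e' \<in> layers A n" "a' \<in> A" by auto
  then have "d \<oplus> d' = (e \<oplus> e') \<oplus> (Q ^^ n) (a \<oplus> a')"
    using carrier_A carrier_layers[of _ n] by (simp add: Q_pow_simps M.a_ac)
  then show ?case using Suc.IH[of e e'] * lin_subsetD(4)[OF A] by auto
qed auto

text \<open>The common reason for stability of the layers under scalars, under \<open>Z\<close> and
  under the operators of the other pairs: all of these commute with \<open>Q\<close> and preserve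
  \<open>A\<close>.\<close>

lemma layers_endo:
  assumes T: "endo T" "\<And>a. a \<in> A \<Longrightarrow> T a \<in> A" "\<And>m. m \<in> carrier M \<Longrightarrow> T (Q m) = Q (T m)"
  shows "d \<in> layers A n \<Longrightarrow> T d \<in> layers A n"
proof (induction n arbitrary: d)
  case (Suc n)
  have *: "T ((Q ^^ n) m) = (Q ^^ n) (T m)" if "m \<in> carrier M" for m n
    using that by (induction n) (auto simp: T Q_pow_simps)
  from Suc show ?case using carrier_A carrier_layers[of _ n] T
    by (fastforce simp: endoD Q_pow_simps *)
qed (use T in \<open>auto simp: endoD\<close>)

lemma layers_scal: "d \<in> layers A n \<Longrightarrow> c \<cdot> d \<in> layers A n"
  by (rule layers_endo[where T = "\<lambda>m. c \<cdot> m"])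
     (auto simp: endo_def scal_add_right lin_subsetD[OF A] Q_simps mult.commute simp flip: scal_mult)

lemma layers_Q: "d \<in> layers A n \<Longrightarrow> Q d \<in> layers A (Suc n)"
proof (induction n arbitrary: d)
  case (Suc n)
  then obtain e a where *: "d = e \<oplus> (Q ^^ n) a" "e \<in> layers A n" "a \<in> A" by auto
  then have "Q d = Q e \<oplus> (Q ^^ Suc n) a"
    using carrier_A carrier_layers[of _ n] by (simp add: Q_simps Q_pow_simps)
  then show ?case using Suc.IH[of e] * by (simp only: layers.simps(2)[of A "Suc n"]) auto
qed (use layers_zero[of 1] in \<open>auto simp: Q_simps\<close>)

text \<open>\<open>P\<close> turns \<open>Q^(k+1) a\<close> into a multiple of
  \<open>Q^k (Z a)\<close>, one layer further down, and kills the bottom layer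
  \<open>A\<close>.\<close>

lemma layers_P:
  assumes "\<And>a. a \<in> A \<Longrightarrow> P a = \<zero>" "\<And>a. a \<in> A \<Longrightarrow> Z a \<in> A"
  shows "d \<in> layers A n \<Longrightarrow> P d \<in> layers A n"
proof (induction n arbitrary: d)
  case (Suc n)
  then obtain e a where *: "d = e \<oplus> (Q ^^ n) a" "e \<in> layers A n" "a \<in> A" by auto
  then have Pd: "P d = P e \<oplus> P ((Q ^^ n) a)"
    using carrier_A carrier_layers[of _ n] by (simp add: P_simps Q_pow_simps)
  have "P ((Q ^^ n) a) \<in> layers A n"
  proof (cases n)
    case 0 then show ?thesis using * assms layers_zero by auto
  next
    case (Suc k)
    have "P ((Q ^^ n) a) = of_nat n \<cdot> Z ((Q ^^ k) a)"
      using * assms(1) P_Q_pow carrier_A Suc by blast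
    also have "\<dots> = \<zero> \<oplus> (Q ^^ k) (of_nat n \<cdot> Z a)"
      using * carrier_A by (simp add: Q_pow_simps Q_pow_Z Z_simps)
    finally show ?thesis
      using * assms lin_subsetD(5)[OF A] layers_zero[of k] unfolding Suc layers.simps by blast
  qed
  then show ?case using layers_Suc[OF layers_add[OF Suc.IH[OF *(2)]]] unfolding Pd by blast
qed (auto simp: P_simps)

text \<open>Only powers of \<open>Q\<close> below \<open>n\<close> occur in
  \<open>layers A n\<close>, and each \<open>P\<close> lowers the power by one before it finally
  kills \<open>A\<close>.\<close>

lemma P_pow_layers:
  assumes "\<And>a. a \<in> A \<Longrightarrow> P a = \<zero>" 
  shows "d \<in> layers A n \<Longrightarrow> (P ^^ n) d = \<zero>"
proof (induction n arbitrary: d)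
  case (Suc n)
  then obtain e a where *: "d = e \<oplus> (Q ^^ n) a" "e \<in> layers A n" "a \<in> A" by auto
  have "(P ^^ Suc n) d = P ((P ^^ n) e \<oplus> (P ^^ n) ((Q ^^ n) a))"
    using * carrier_A carrier_layers[of _ n] by (simp add: P_pow_simps Q_pow_simps)
  also have "\<dots> = P (fact n \<cdot> (Z ^^ n) a)"
    using * Suc.IH assms P_pow_Q_pow carrier_A by (simp add: Z_pow_simps)
  also have "\<dots> = \<zero>" using * assms carrier_A by (simp add: P_simps P_Z_pow Z_pow_simps)
  finally show ?case .
qed auto

text \<open>\<open>P^n\<close> isolates the top coefficient: the lower layers die and
  \<open>Q^n a\<close> becomes \<open>n! Z^n a\<close>. For \<open>n > 0\<close> the result is zero
  because \<open>P d = 0\<close>, so \<open>a = 0\<close> and the degree drops.\<close>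

lemma layers_kernel:
  assumes kill: "\<And>a. a \<in> A \<Longrightarrow> P a = \<zero>"
  shows "d \<in> layers A n \<Longrightarrow> P d = \<zero> \<Longrightarrow> d \<in> A"
proof (induction n arbitrary: d)
  case (Suc n)
  then obtain e a where *: "d = e \<oplus> (Q ^^ n) a" "e \<in> layers A n" "a \<in> A" by auto
  show ?case
  proof (cases "n = 0")
    case True then show ?thesis using * carrier_A by auto
  next
    case False
    then obtain k where "n = Suc k" by (cases n) auto
    then have "(P ^^ n) d = \<zero>" using Suc.prems(2) P_pow_simps(4)[of k]
      by (simp add: funpow_Suc_right del: funpow.simps)
    moreover have "(P ^^ n) d = fact n \<cdot> (Z ^^ n) a"
      using * carrier_A carrier_layers[of _ n]
        by (simp add: P_pow_simps Q_pow_simps P_pow_layers[OF kill] P_pow_Q_pow kill Z_pow_simps)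
    ultimately have "fact n \<cdot> (Z ^^ n) a = \<zero>" by simp
    then have "a = \<zero>"
      using carrier_A[of a] * by (simp add: scal_eq_zero_iff Z_pow_simps Z_pow_eq_zero_iff)
    then show ?thesis using * Suc.IH[of e] Suc.prems carrier_layers[of e n] by (simp add: Q_pow_simps)
  qed
qed (use lin_subsetD[OF A] in auto)

end

end

section \<open>Finitely many commuting Weyl pairs with a common center\<close>

locale heis_ops = lin_space M
  for M :: "('k::field_char_0, 'm, 'x) module_scheme" (structure) +
  fixes I :: "'i set" and P Q :: "'i \<Rightarrow> 'm \<Rightarrow> 'm" and Z :: "'m \<Rightarrow> 'm"
  assumes finite_I: "finite I"
    and endo_P: "i \<in> I \<Longrightarrow> endo (P i)" and endo_Q: "i \<in> I \<Longrightarrow> endo (Q i)" and endo_Z: "endo Z"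
    and PQ: "i \<in> I \<Longrightarrow> j \<in> I \<Longrightarrow> m \<in> carrier M \<Longrightarrow>
      P i (Q j m) = (if i = j then Q j (P i m) \<oplus> Z m else Q j (P i m))"
    and PP: "i \<in> I \<Longrightarrow> j \<in> I \<Longrightarrow> m \<in> carrier M \<Longrightarrow> P i (P j m) = P j (P i m)"
    and QQ: "i \<in> I \<Longrightarrow> j \<in> I \<Longrightarrow> m \<in> carrier M \<Longrightarrow> Q i (Q j m) = Q j (Q i m)"
    and PZ: "i \<in> I \<Longrightarrow> m \<in> carrier M \<Longrightarrow> P i (Z m) = Z (P i m)"
    and QZ: "i \<in> I \<Longrightarrow> m \<in> carrier M \<Longrightarrow> Q i (Z m) = Z (Q i m)"
    and bij_Z: "bij_betw Z (carrier M) (carrier M)"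
begin

lemma weyl_pair: "i \<in> I \<Longrightarrow> weyl_pair M (P i) (Q i) Z"
  by unfold_locales (auto simp: endo_P endo_Q endo_Z PQ PZ QZ bij_Z)

definition vacuum :: "'i set \<Rightarrow> 'm set" where
  "vacuum S = {m \<in> carrier M. \<forall>i\<in>S. P i m = \<zero>}"

lemma Z_eq_zero_iff: "m \<in> carrier M \<Longrightarrow> Z m = \<zero> \<longleftrightarrow> m = \<zero>"
  using bij_Z endoD(4)[OF endo_Z] unfolding bij_betw_def inj_on_def by (metis M.zero_closed)

lemma lin_subset_vacuum: "S \<subseteq> I \<Longrightarrow> lin_subset (vacuum S)"
  by (rule lin_subsetI) (auto simp: vacuum_def endoD endo_P subset_iff)

text \<open>The kernel condition is relaxed one index at a time: the induction on \<open>T\<close>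
  treats vectors killed by all \<open>P i\<close> with \<open>i\<close> outside \<open>T\<close>,
  and for \<open>T = I\<close> nothing is required of the vector any more.\<close>

theorem generated_by_vacuum:
  assumes Y: "lin_subset Y" "\<And>i m. i \<in> I \<Longrightarrow> m \<in> Y \<Longrightarrow> Q i m \<in> Y" "vacuum I \<subseteq> Y"
    and nil: "\<And>i m. i \<in> I \<Longrightarrow> m \<in> carrier M \<Longrightarrow> \<exists>n. (P i ^^ n) m = \<zero>"
  shows "carrier M \<subseteq> Y"
proof -
  have "T \<subseteq> I \<Longrightarrow> vacuum (I - T) \<subseteq> Y" if "finite T" for T
    using that
  proof (induction T rule: finite_induct)
    case (insert i T)
    then have i: "i \<in> I" by auto
    \<comment> \<open>The common kernel of the remaining \<open>P j\<close>. The operators of the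
      pair \<open>i\<close> commute with these, so they preserve \<open>C\<close> and the one-pair
      lemma applies inside it.\<close>
    define C where "C = vacuum (I - insert i T)"
    interpret W: weyl_pair M "P i" "Q i" Z by (rule weyl_pair[OF i])
    show ?case
    proof (rule subsetI)
      fix m assume "m \<in> vacuum (I - insert i T)"
      then have m: "m \<in> C" "m \<in> carrier M" by (auto simp: C_def vacuum_def)
      obtain n where "(P i ^^ n) m = \<zero>" using nil[OF i m(2)] by auto
      with m(1) show "m \<in> Y"
      proof (rule W.generated_by_kernel[OF Y(1) Y(2)[OF i], rotated -2])
        show "lin_subset C" unfolding C_def by (rule lin_subset_vacuum) auto
        show "P i m \<in> C" if "m \<in> C" for m
          using that i by (auto simp: C_def vacuum_def PP[of _ i] endoD endo_P)
        show "Q i m \<in> C" if "m \<in> C" for m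
          using that i by (auto simp: C_def vacuum_def PQ[of _ i] endoD endo_Q)
        show "m \<in> C" if "m \<in> carrier M" "Z m \<in> C" for m
          using that i Z_eq_zero_iff by (auto simp: C_def vacuum_def PZ endoD endo_P)
        show "m \<in> Y" if "m \<in> C" "P i m = \<zero>" for m
        proof -
          have "m \<in> vacuum (I - T)" using that by (auto simp: C_def vacuum_def)
          then show ?thesis using insert by auto
        qed
      qed
    qed
  qed (use Y in auto)
  from this[OF finite_I] show ?thesis by (auto simp: vacuum_def)
qed

text \<open>The module is rebuilt from \<open>N\<close> by adjoining one \<open>Q i\<close> after
  the other. No new vacuum vectors appear on the way, and the last space is stable under all
  operators, hence everything.\<close>

theorem vacuum_of_generated:
  assumes N: "lin_subset N" "N \<subseteq> vacuum I" "\<And>m. m \<in> N \<Longrightarrow> Z m \<in> N"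
    and gen: "\<And>Y. \<lbrakk>lin_subset Y; N \<subseteq> Y; \<And>m. m \<in> Y \<Longrightarrow> Z m \<in> Y; \<And>i m. i \<in> I \<Longrightarrow> m \<in> Y \<Longrightarrow> P i m \<in> Y;
       \<And>i m. i \<in> I \<Longrightarrow> m \<in> Y \<Longrightarrow> Q i m \<in> Y\<rbrakk> \<Longrightarrow> carrier M \<subseteq> Y"
  shows "vacuum I = N"
proof -
  \<comment> \<open>The last clause is the goal. The clause that the \<open>P i\<close> with
    \<open>i\<close> outside \<open>S\<close> kill \<open>A\<close> prepares the next step:
    \<open>layers_kernel\<close> needs a space in the kernel of the \<open>P\<close> that belongs to
    the \<open>Q\<close> about to be adjoined.\<close>
  define good where "good S A \<longleftrightarrow> lin_subset A \<and> N \<subseteq> A \<and> (\<forall>m\<in>A. Z m \<in> A) \<and> (\<forall>i\<in>I. \<forall>m\<in>A. P i m \<in> A) \<and>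
     (\<forall>i\<in>S. \<forall>m\<in>A. Q i m \<in> A) \<and> (\<forall>i\<in>I-S. \<forall>m\<in>A. P i m = \<zero>) \<and> A \<inter> vacuum I \<subseteq> N" for S A
  have "S \<subseteq> I \<Longrightarrow> \<exists>A. good S A" if "finite S" for S
    using that
  proof (induction S rule: finite_induct)
    case empty
    then show ?case using N by (intro exI[of _ N]) (auto
      simp: good_def vacuum_def subset_iff lin_subsetD[OF N(1)])
  next
    case (insert i S)
    then have i: "i \<in> I" by auto
    from insert obtain A where "good S A" by auto
    then have A: "lin_subset A" "N \<subseteq> A" "\<And>m. m \<in> A \<Longrightarrow> Z m \<in> A"
      "\<And>i m. i\<in>I \<Longrightarrow> m\<in>A \<Longrightarrow> P i m \<in> A" "\<And>i m. i\<in>S \<Longrightarrow> m\<in>A \<Longrightarrow> Q i m \<in> A"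
      "\<And>i m. i\<in>I-S \<Longrightarrow> m\<in>A \<Longrightarrow> P i m = \<zero>" "A \<inter> vacuum I \<subseteq> N"
      unfolding good_def by blast+
    interpret W: weyl_pair M "P i" "Q i" Z by (rule weyl_pair[OF i])
    have kill: "a \<in> A \<Longrightarrow> P i a = \<zero>" for a using A(6) i insert by auto
    have carrier_A: "a \<in> A \<Longrightarrow> a \<in> carrier M" for a using lin_subsetD[OF A(1)] by auto
    \<comment> \<open>The smallest subspace that contains \<open>A\<close> and is stable under
      \<open>Q i\<close>. The layers increase, so finitely many elements always lie in a common
      one.\<close>
    define B where "B = (\<Union>n. W.layers A n)"
    have Bc: "b \<in> B \<Longrightarrow> b \<in> carrier M" for b
      unfolding B_def using W.layers_closed[of A] carrier_A by auto
    have "lin_subset B"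
    proof (rule lin_subsetI)
      show "\<zero> \<in> B" unfolding B_def using W.layers_zero[OF A(1)] by auto
      show "m \<oplus> n \<in> B" if mn: "m \<in> B" "n \<in> B" for m n
      proof -
        obtain a b where "m \<in> W.layers A a" "n \<in> W.layers A b" using mn by (auto simp: B_def)
        then show ?thesis unfolding B_def
          using W.layers_add[OF A(1), of m "max a b" n] W.layers_mono[OF A(1), of _ _ "max a b"] by auto
      qed
    qed (use Bc in \<open>auto simp: B_def intro: W.layers_scal[OF A(1)]\<close>)
    moreover have "A \<subseteq> B"
    proof
      fix a assume "a \<in> A"
      then have "a \<in> W.layers A 1" using carrier_A by force
      then show "a \<in> B" unfolding B_def by blast
    qed
    moreover have "Z m \<in> B" if "m \<in> B" for m
      using that W.layers_endo[OF A(1), of Z] A(3) endo_Z by (auto simp: B_def QZ[OF i])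
    moreover have "Q j m \<in> B" if "j \<in> insert i S" "m \<in> B" for j m
    proof (cases "j = i")
      case True then show ?thesis using that W.layers_Q[OF A(1)] unfolding B_def by blast
    next
      case False
      then have j: "j \<in> S" "j \<in> I" using that insert.prems by auto
      have "Q j d \<in> W.layers A n" if "d \<in> W.layers A n" for d n
        by (rule W.layers_endo[OF A(1) _ _ _ that]) (use j i in \<open>auto simp: endo_Q A(5) QQ[of j i]\<close>)
      then show ?thesis using that(2) by (auto simp: B_def)
    qed
    moreover have "P j m \<in> B" if "j \<in> I" "m \<in> B" for j m
    proof (cases "j = i")
      case True then show ?thesis using that W.layers_P[OF A(1) kill A(3)] unfolding B_def by blast
    next
      case False
      have "P j d \<in> W.layers A n" if "d \<in> W.layers A n" for d n
        by (rule W.layers_endo[OF A(1) _ _ _ that]) (use \<open>j \<in> I\<close> False i in \<open>auto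
          simp: endo_P A(4) PQ[of j i]\<close>)
      then show ?thesis using that(2) by (auto simp: B_def)
    qed
    moreover have "P j m = \<zero>" if j: "j \<in> I - insert i S" and m: "m \<in> B" for j m
    proof -
      obtain n where "m \<in> W.layers A n" using m by (auto simp: B_def)
      then show ?thesis
      proof (induction n arbitrary: m)
        case (Suc n)
        then obtain e a where *: "m = e \<oplus> (Q i ^^ n) a" "e \<in> W.layers A n" "a \<in> A" by auto
        have Pq: "P j ((Q i ^^ n) v) = (Q i ^^ n) (P j v)" if "v \<in> carrier M" for v
          using that j i by (induction n) (auto simp: PQ[of j i] W.Q_pow_simps)
        show ?case using * Suc.IH[of e] A(6)[of j a] j carrier_A[of a] W.layers_closed[of A e n]
          lin_subsetD(1)[OF A(1)] Pq
            endo_P[of j] by (auto simp: endoD W.Q_pow_simps)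
      qed (use endo_P[of j] j in \<open>auto simp: endoD\<close>)
    qed
    moreover have "B \<inter> vacuum I \<subseteq> N"
    proof -
      \<comment> \<open>A vacuum vector is in particular killed by \<open>P i\<close>, so it has no
        component of positive degree in \<open>Q i\<close>.\<close>
      have "B \<inter> vacuum I \<subseteq> A \<inter> vacuum I"
        using W.layers_kernel[OF A(1) kill] i by (auto simp: B_def vacuum_def)
      then show ?thesis using A(7) by auto
    qed
    ultimately have "good (insert i S) B" unfolding good_def using A(2) by blast
    then show ?case ..
  qed
  from this[OF finite_I] obtain A where "good I A" by auto
  then have A: "lin_subset A" "N \<subseteq> A" "\<And>m. m \<in> A \<Longrightarrow> Z m \<in> A"
      "\<And>i m. i\<in>I \<Longrightarrow> m\<in>A \<Longrightarrow> P i m \<in> A" "\<And>i m. i\<in>I \<Longrightarrow> m\<in>A \<Longrightarrow> Q i m \<in> A" "A \<inter> vacuum I \<subseteq> N"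
    unfolding good_def by blast+
  from gen[OF A(1-5)] have "carrier M \<subseteq> A" by auto
  then have "vacuum I \<subseteq> N" using A(6) by (auto simp: vacuum_def)
  with N show ?thesis by auto
qed

end

section \<open>Symplectic bases\<close>

context symplectic_space
begin

lemma form_simps [simp]:
  "\<omega> (v + w) u = \<omega> v u + \<omega> w u" "\<omega> u (v + w) = \<omega> u v + \<omega> u w"
  "\<omega> (scale c v) u = c * \<omega> v u" "\<omega> u (scale c v) = c * \<omega> u v"
  "\<omega> 0 u = 0" "\<omega> u 0 = 0" "\<omega> (v - w) u = \<omega> v u - \<omega> w u" "\<omega> u (v - w) = \<omega> u v - \<omega> u w"
  "\<omega> (sum f A) u = (\<Sum>a\<in>A. \<omega> (f a) u)" "\<omega> u (sum f A) = (\<Sum>a\<in>A. \<omega> u (f a))"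
proof -
  interpret L: Vector_Spaces.linear scale "(*)" "\<lambda>v. \<omega> v u" by (rule linear_left)
  interpret R: Vector_Spaces.linear scale "(*)" "\<omega> u" by (rule linear_right)
  show "\<omega> (v + w) u = \<omega> v u + \<omega> w u" "\<omega> u (v + w) = \<omega> u v + \<omega> u w"
    "\<omega> (scale c v) u = c * \<omega> v u" "\<omega> u (scale c v) = c * \<omega> u v"
    "\<omega> 0 u = 0" "\<omega> u 0 = 0" "\<omega> (v - w) u = \<omega> v u - \<omega> w u" "\<omega> u (v - w) = \<omega> u v - \<omega> u w"
    "\<omega> (sum f A) u = (\<Sum>a\<in>A. \<omega> (f a) u)" "\<omega> u (sum f A) = (\<Sum>a\<in>A. \<omega> u (f a))"
    by (simp_all add: L.add R.add L.scale R.scale L.zero R.zero L.diff R.diff L.sum R.sum)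
qed

lemma form_swap: "\<omega> v w = - \<omega> w v"
  using alternating[of "v + w"] alternating[of v] alternating[of w]
    by (simp add: eq_neg_iff_add_eq_0 add.commute)

text \<open>A vector orthogonal to \<open>B\<close> but not to \<open>x\<close> must exist:
  otherwise \<open>x\<close> pairs with every vector as a fixed combination \<open>y\<close> of
  \<open>B\<close> does, and nondegeneracy would put \<open>x\<close> into the span of
  \<open>B\<close>.\<close>

lemma dual_family:
  assumes "finite B" "independent B"
  shows "\<exists>q. \<forall>b\<in>B. \<forall>b'\<in>B. \<omega> b (q b') = (if b = b' then 1 else 0)"
  using assms
proof (induction B rule: finite_induct)
  case (insert x B)
  then obtain q where q: "\<And>b b'. b \<in> B \<Longrightarrow> b' \<in> B \<Longrightarrow> \<omega> b (q b') = (if b = b' then 1 else 0)"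
    using independent_mono[of "insert x B" B] by (auto simp: subset_insertI)
  have "\<exists>u. (\<forall>b\<in>B. \<omega> b u = 0) \<and> \<omega> x u \<noteq> 0"
  proof (rule ccontr)
    assume no: "\<not> ?thesis"
    define y where "y = (\<Sum>b\<in>B. scale (\<omega> x (q b)) b)"
    have "\<omega> (x - y) w = 0" for w
    proof -
      \<comment> \<open>Removing the components along the \<open>q b\<close> makes \<open>w\<close>
        orthogonal to \<open>B\<close>, hence to \<open>x\<close> by assumption; expanding
        \<open>\<omega> x u = 0\<close> gives \<open>\<omega> x w = \<omega> y w\<close>.\<close>
      define u where "u = w - (\<Sum>b\<in>B. scale (\<omega> b w) (q b))"
      have "\<omega> b u = 0" if "b \<in> B" for b
      proof -
        have "(\<Sum>b'\<in>B. \<omega> b' w * \<omega> b (q b')) = (\<Sum>b'\<in>B. if b = b' then \<omega> b' w else 0)"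
          by (rule sum.cong) (auto simp: q that)
        then show ?thesis using that insert.hyps by (simp add: u_def)
      qed
      then have "\<omega> x u = 0" using no by auto
      then show ?thesis by (simp add: u_def y_def mult.commute)
    qed
    then have "x = y" using nondegenerate[of "x - y"] by simp
    moreover have "y \<in> span B" unfolding y_def by (intro span_sum span_scale span_base)
    ultimately show False
      using insert.prems insert.hyps by (simp add: independent_insert)
  qed
  then obtain u where u: "\<And>b. b \<in> B \<Longrightarrow> \<omega> b u = 0" "\<omega> x u \<noteq> 0" by auto
  define u' where "u' = scale (inverse (\<omega> x u)) u"
  have u': "\<And>b. b \<in> B \<Longrightarrow> \<omega> b u' = 0" "\<omega> x u' = 1" using u by (auto simp: u'_def)
  \<comment> \<open>The old dual vectors are corrected by multiples of \<open>u'\<close> until they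
    are orthogonal to \<open>x\<close>. Their pairings with the old \<open>B\<close> survive, since
    \<open>u'\<close> is orthogonal to it.\<close>
  show ?case
    using insert.hyps(2) u' q
    by (intro exI[of _ "\<lambda>b. if b = x then u' else q b - scale (\<omega> x (q b)) u'"]) auto
qed auto

end

text \<open>Maximality of \<open>l\<close> enters through the expansion: what is left of a vector
  after removal of its components is orthogonal to \<open>l\<close>, so adjoining it keeps the space
  isotropic. It therefore lies in \<open>l = span B\<close>, and its zero pairings with the
  \<open>q b\<close> make it vanish.\<close>

lemma darboux_basis:
  fixes scale :: "'k::field_char_0 \<Rightarrow> 'w::ab_group_add \<Rightarrow> 'w"
  assumes "symplectic_space scale \<omega>" "lagrangian scale \<omega> l"
  obtains B q where "finite B" "B \<subseteq> l"
    "\<And>b b'. b \<in> B \<Longrightarrow> b' \<in> B \<Longrightarrow> \<omega> b (q b') = (if b = b' then 1 else 0)"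
    "\<And>b b'. b \<in> B \<Longrightarrow> b' \<in> B \<Longrightarrow> \<omega> (q b) (q b') = 0"
    "\<And>w. w = (\<Sum>b\<in>B. scale (\<omega> w (q b)) b + scale (\<omega> b w) (q b))"
proof -
  interpret symplectic_space scale \<omega> by fact
  have l: "subspace l" "\<And>v w. v \<in> l \<Longrightarrow> w \<in> l \<Longrightarrow> \<omega> v w = 0"
    "\<And>S. isotropic scale \<omega> S \<Longrightarrow> l \<subseteq> S \<Longrightarrow> S = l"
    using assms(2) by (auto simp: lagrangian_def isotropic_def)
  obtain B where B: "B \<subseteq> l" "independent B" "l \<subseteq> span B" using maximal_independent_subset by blast
  obtain E where E: "finite E" "span E = UNIV" using finite_dimensional by blast
  have fin: "finite B" using independent_span_bound[OF E(1) B(2)] E(2) by auto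
  obtain r where r: "\<And>b b'. b \<in> B \<Longrightarrow> b' \<in> B \<Longrightarrow> \<omega> b (r b') = (if b = b' then 1 else 0)"
    using dual_family[OF fin B(2)] by blast
  \<comment> \<open>The correction by elements of \<open>l\<close> keeps the pairings with \<open>B\<close> and makes the \<open>q b\<close> isotropic.\<close>
  define q where "q b = r b - scale (1 / 2) (\<Sum>c\<in>B. scale (\<omega> (r b) (r c)) c)" for b
  have form_B_B: "\<omega> b c = 0" if "b \<in> B" "c \<in> B" for b c using that B(1) l(2) by auto
  have q: "\<omega> b (q b') = (if b = b' then 1 else 0)" if "b \<in> B" "b' \<in> B" for b b'
    using that by (simp add: q_def r form_B_B)
  have delta: "(\<Sum>c\<in>B. a c * g c) = a b" if "b \<in> B"
    "\<And>c. c \<in> B \<Longrightarrow> g c = (if c = b then 1 else 0)" for a g :: "'w \<Rightarrow> 'k" and b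
  proof -
    have "(\<Sum>c\<in>B. a c * g c) = (\<Sum>c\<in>B. if c = b then a c else 0)" by (rule sum.cong) (auto simp: that(2))
    then show ?thesis using fin that(1) by simp
  qed
  have d1: "(\<Sum>c\<in>B. a c * \<omega> c (r b)) = a b" if "b \<in> B" for a b
    by (rule delta[OF that]) (simp add: r that)
  have d2: "(\<Sum>c\<in>B. a c * \<omega> (r b) c) = - a b" if "b \<in> B" for a b
    using d1[OF that, of a] by (subst form_swap) (simp add: sum_negf)
  have qq: "\<omega> (q b) (q b') = 0" if "b \<in> B" "b' \<in> B" for b b'
  proof -
    \<comment> \<open>The corrections of the two arguments each cancel one half of
      \<open>\<omega> (r b) (r b')\<close>, whence the coefficient \<open>1 / 2\<close> in
      \<open>q\<close>.\<close>
    have "\<omega> (q b) (q b') = \<omega> (r b) (r b') + \<omega> (r b') (r b) / 2 - \<omega> (r b) (r b') / 2"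
      using that by (simp add: q_def d1 d2 form_B_B)
    then show ?thesis using form_swap[of "r b" "r b'"] by (simp add: field_simps)
  qed
  have "w = (\<Sum>b\<in>B. scale (\<omega> w (q b)) b + scale (\<omega> b w) (q b))" for w
  proof -
    define u where "u = w - (\<Sum>b\<in>B. scale (\<omega> w (q b)) b + scale (\<omega> b w) (q b))"
    have s1: "(\<Sum>c\<in>B. a c * \<omega> b (q c)) = a b" if "b \<in> B" for a b
      by (rule delta[OF that]) (auto simp: q that)
    have s2: "(\<Sum>c\<in>B. a c * \<omega> c (q b)) = a b" if "b \<in> B" for a b
      by (rule delta[OF that]) (simp add: q that)
    have bu: "\<omega> b u = 0" if "b \<in> B" for b
      using that by (simp add: u_def sum.distrib s1 form_B_B)
    have uq: "\<omega> u (q b) = 0" if "b \<in> B" for b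
      using that by (simp add: u_def sum.distrib s2 qq)
    have lu: "\<omega> v u = 0" if "v \<in> l" for v
    proof -
      have "subspace {v. \<omega> v u = 0}" by (rule subspaceI) auto
      then have "span B \<subseteq> {v. \<omega> v u = 0}" by (intro span_minimal) (auto simp: bu)
      then show ?thesis using that B(3) by auto
    qed
    have ext: "span (insert u l) = {x. \<exists>c. x - scale c u \<in> l}"
      using span_insert[of u l] l(1) by (simp add: span_eq_iff[THEN iffD2])
    have "\<omega> x y = 0" if "x \<in> span (insert u l)" "y \<in> span (insert u l)" for x y
    proof -
      obtain c d where "x - scale c u \<in> l" "y - scale d u \<in> l" using \<open>x \<in> _\<close> \<open>y \<in> _\<close> by (auto simp: ext)
      then show ?thesis using l(2)[of "x - scale c u"
        "y - scale d u"] lu[of "x - scale c u"] lu[of "y - scale d u"]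
        form_swap[of u y] by (simp add: alternating)
    qed
    then have "isotropic scale \<omega> (span (insert u l))" by (simp add: isotropic_def)
    moreover have "l \<subseteq> span (insert u l)" "u \<in> span (insert u l)" by (auto intro: span_base)
    ultimately have "u \<in> span B" using l(3)[of "span (insert u l)"] B(3) by auto
    then obtain a where a: "u = (\<Sum>b\<in>B. scale (a b) b)" using span_finite[OF fin] by auto
    have "a b = 0" if "b \<in> B" for b
      using uq[OF that] s2[OF that, of a] by (subst (asm) a) simp
    then have "u = 0" using a by simp
    then show ?thesis by (simp add: u_def)
  qed
  then show thesis using that[OF fin B(1), of q] q qq by blast
qed

section \<open>The enveloping algebra\<close>

lemma free_algebra_iff: "p \<in> carrier (free_algebra S) \<longleftrightarrow> (\<forall>w\<in>Poly_Mapping.keys p. set (letters w) \<subseteq> S)"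
  by (simp add: free_algebra_def ring_of_type_algebra_def)

lemma free_algebra_simps [simp]:
  "p \<otimes>\<^bsub>free_algebra S\<^esub> q = p * q" "p \<oplus>\<^bsub>free_algebra S\<^esub> q = p + q"
  "\<zero>\<^bsub>free_algebra S\<^esub> = 0" "\<one>\<^bsub>free_algebra S\<^esub> = 1"
  by (simp_all add: free_algebra_def ring_of_type_algebra_def)

lemma free_algebra_mult: "p \<in> carrier (free_algebra S) \<Longrightarrow> q \<in> carrier (free_algebra S) \<Longrightarrow>
  p * q \<in> carrier (free_algebra S)"
  using keys_mult[of p q] by (fastforce simp: free_algebra_iff plus_free_monoid_def)

lemma free_algebra_add: "p \<in> carrier (free_algebra S) \<Longrightarrow> q \<in> carrier (free_algebra S) \<Longrightarrow>
  p + q \<in> carrier (free_algebra S)"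
  using Poly_Mapping.keys_add[of p q] by (auto simp: free_algebra_iff)

lemma free_algebra_uminus: "p \<in> carrier (free_algebra S) \<Longrightarrow> - p \<in> carrier (free_algebra S)"
  by (auto simp: free_algebra_iff in_keys_iff)

lemma free_algebra_diff: "p \<in> carrier (free_algebra S) \<Longrightarrow> q \<in> carrier (free_algebra S) \<Longrightarrow>
  p - q \<in> carrier (free_algebra S)"
  using free_algebra_add[of p S "- q"] free_algebra_uminus[of q S] by (simp del: free_algebra_simps)

lemma free_algebra_single: "set (letters w) \<subseteq> S \<Longrightarrow> Poly_Mapping.single w c \<in> carrier (free_algebra S)"
  by (auto simp: free_algebra_iff)

lemma free_algebra_gen: "x \<in> S \<Longrightarrow> gen x \<in> carrier (free_algebra S)"
  by (auto simp: free_algebra_iff gen_def)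

lemma free_algebra_scalar: "scalar c \<in> carrier (free_algebra S)"
  by (auto simp: free_algebra_iff scalar_def zero_free_monoid_def)

lemma free_algebra_zero: "0 \<in> carrier (free_algebra S)"
  by (simp add: free_algebra_iff)

lemma free_algebra_one: "1 \<in> carrier (free_algebra S)"
  by (auto simp: free_algebra_iff zero_free_monoid_def simp flip: single_one)

lemmas free_algebra_closed = free_algebra_mult free_algebra_add free_algebra_uminus free_algebra_diff
  free_algebra_single free_algebra_gen free_algebra_scalar free_algebra_zero free_algebra_one

lemma free_algebra_mono: "S \<subseteq> T \<Longrightarrow> p \<in> carrier (free_algebra S) \<Longrightarrow> p \<in> carrier (free_algebra T)"
  by (auto simp: free_algebra_iff)

lemma ring_free_algebra: "ring (free_algebra S :: ('k::field, 'g) free_alg ring)"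
proof (rule ringI)
  show "abelian_group (free_algebra S :: ('k::field, 'g) free_alg ring)"
  proof (rule abelian_groupI)
    fix x :: "('k, 'g) free_alg" assume "x \<in> carrier (free_algebra S)"
    then show "\<exists>y\<in>carrier (free_algebra S). y \<oplus>\<^bsub>free_algebra S\<^esub> x = \<zero>\<^bsub>free_algebra S\<^esub>"
      using free_algebra_uminus[of x S] by (intro bexI[of _ "- x"]) simp_all
  qed (use free_algebra_closed in \<open>auto simp: algebra_simps\<close>)
  show "Group.monoid (free_algebra S :: ('k::field, 'g) free_alg ring)"
    by (rule monoidI) (use free_algebra_closed in \<open>auto simp: algebra_simps\<close>)
qed (auto simp: algebra_simps)

lemma free_algebra_a_inv: "p \<in> carrier (free_algebra S) \<Longrightarrow> \<ominus>\<^bsub>free_algebra S\<^esub> p = - p"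
  by (rule abelian_group.minus_equality[OF ring.is_abelian_group[OF ring_free_algebra]])
    (simp_all add: free_algebra_uminus)

lemma ideal_free_algebraI:
  assumes "J \<subseteq> carrier (free_algebra S)" "0 \<in> J" "\<And>p q. p \<in> J \<Longrightarrow> q \<in> J \<Longrightarrow> p + q \<in> J" "\<And>p. p \<in> J \<Longrightarrow> - p \<in> J"
    and "\<And>p q. p \<in> carrier (free_algebra S) \<Longrightarrow> q \<in> J \<Longrightarrow> p * q \<in> J"
    and "\<And>p q. p \<in> carrier (free_algebra S) \<Longrightarrow> q \<in> J \<Longrightarrow> q * p \<in> J"
  shows "ideal J (free_algebra S)"
proof (rule idealI[OF ring_free_algebra])
  show "subgroup J (add_monoid (free_algebra S))"
  proof (rule group.subgroupI[OF abelian_group.a_group[OF ring.is_abelian_group[OF ring_free_algebra]]])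
    fix p assume p: "p \<in> J"
    then have "inv\<^bsub>add_monoid (free_algebra S)\<^esub> p = - p"
      using free_algebra_a_inv[of p S] assms(1) by (auto simp: a_inv_def)
    then show "inv\<^bsub>add_monoid (free_algebra S)\<^esub> p \<in> J" using assms(4)[OF p] by simp
  qed (use assms in auto)
qed (use assms in \<open>simp_all\<close>)

lemma free_alg_induct [consumes 1, case_names zero single add]:
  assumes p: "p \<in> carrier (free_algebra S)" and "Q 0"
    and "\<And>w c. set (letters w) \<subseteq> S \<Longrightarrow> Q (Poly_Mapping.single w c)"
    and "\<And>p q. p \<in> carrier (free_algebra S) \<Longrightarrow> q \<in> carrier (free_algebra S) \<Longrightarrow> Q p \<Longrightarrow> Q q \<Longrightarrow> Q (p + q)"
  shows "Q p"
proof -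
  have "p = (\<Sum>w\<in>Poly_Mapping.keys p. Poly_Mapping.single w (Poly_Mapping.lookup p w))"
    by (rule poly_mapping_eqI) (auto simp: lookup_sum lookup_single when_def in_keys_iff sum.delta)
  moreover have "Q (\<Sum>w\<in>A. Poly_Mapping.single w (Poly_Mapping.lookup p w)) \<and>
     (\<Sum>w\<in>A. Poly_Mapping.single w (Poly_Mapping.lookup p w)) \<in> carrier (free_algebra S)"
    if "finite A" "A \<subseteq> Poly_Mapping.keys p" for A
    using that
  proof (induction A rule: finite_induct)
    case (insert w A)
    then have "set (letters w) \<subseteq> S" using p by (auto simp: free_algebra_iff)
    from assms(3)[OF this] free_algebra_single[OF this] insert show ?case
      by (auto intro!: assms(4) free_algebra_add)
  qed (use assms(2) free_algebra_zero in auto)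
  ultimately show ?thesis by (metis finite_keys subset_refl)
qed

abbreviation (in lie_algebra) "FA \<equiv> carrier (free_algebra (carrier L) :: ('k, 'g) free_alg ring)"

section \<open>Action of the free algebra on a module\<close>

sublocale lie_module \<subseteq> lin_space M by unfold_locales

context lie_module
begin

lemma endo_act: "x \<in> carrier L \<Longrightarrow> endo (act M x)"
  by (auto simp: endo_def act_closed act_add_right act_smult_right)

abbreviation word_act :: "'g list \<Rightarrow> 'm \<Rightarrow> 'm" where "word_act xs m \<equiv> foldr (act M) xs m"

lemma endo_word_act: "set xs \<subseteq> carrier L \<Longrightarrow> endo (word_act xs)"
  by (induction xs) (auto simp: endo_def act_closed act_add_right act_smult_right)

text \<open>The supports of \<open>p\<close>, \<open>q\<close> and \<open>p + q\<close> differ, so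
  additivity needs a common index set; the extra terms have coefficient zero.\<close>

lemma free_act_over:
  assumes "finite A" "Poly_Mapping.keys p \<subseteq> A" "\<And>w. w \<in> A \<Longrightarrow> set (letters w) \<subseteq> carrier L" "m \<in> carrier M"
  shows "free_act M p m = (\<Oplus>\<^bsub>M\<^esub>w\<in>A. Poly_Mapping.lookup p w \<odot>\<^bsub>M\<^esub> word_act (letters w) m)"
  unfolding free_act_def
  by (rule M.add.finprod_mono_neutral_cong_left)
     (use assms in \<open>auto simp: in_keys_iff endoD[OF endo_word_act]\<close>)

lemma free_act_closed:
  "p \<in> L.FA \<Longrightarrow> m \<in> carrier M \<Longrightarrow> free_act M p m \<in> carrier M"
  unfolding free_act_def by (rule M.finsum_closed) (auto simp: free_algebra_iff endoD[OF endo_word_act])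

lemma free_act_zero [simp]: "free_act M 0 m = \<zero>\<^bsub>M\<^esub>"
  by (simp add: free_act_def)

lemma free_act_single:
  assumes "set (letters w) \<subseteq> carrier L" "m \<in> carrier M"
  shows "free_act M (Poly_Mapping.single w c) m = c \<odot>\<^bsub>M\<^esub> word_act (letters w) m"
  using assms by (subst free_act_over[of "{w}"]) (auto simp: endoD[OF endo_word_act] Pi_def)

lemma free_act_add:
  assumes "p \<in> L.FA" "q \<in> L.FA" "m \<in> carrier M"
  shows "free_act M (p + q) m = free_act M p m \<oplus>\<^bsub>M\<^esub> free_act M q m"
proof -
  let ?A = "Poly_Mapping.keys p \<union> Poly_Mapping.keys q"
  have A: "set (letters w) \<subseteq> carrier L" if "w \<in> ?A" for w
    using assms that by (auto simp: free_algebra_iff)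
  have "free_act M (p + q) m = (\<Oplus>\<^bsub>M\<^esub>w\<in>?A. Poly_Mapping.lookup (p + q) w \<odot>\<^bsub>M\<^esub> word_act (letters w) m)"
    using A assms(3) Poly_Mapping.keys_add[of p q] by (intro free_act_over) auto
  also have "\<dots> = (\<Oplus>\<^bsub>M\<^esub>w\<in>?A. Poly_Mapping.lookup p w \<odot>\<^bsub>M\<^esub> word_act (letters w) m
      \<oplus>\<^bsub>M\<^esub> Poly_Mapping.lookup q w \<odot>\<^bsub>M\<^esub> word_act (letters w) m)"
    using A assms(3) by (intro M.finsum_cong') (auto
      simp: lookup_add scal_add_left endoD[OF endo_word_act])
  also have "\<dots> = free_act M p m \<oplus>\<^bsub>M\<^esub> free_act M q m"
    using A assms(3) free_act_over[of ?A p m] free_act_over[of ?A q m]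
    by (subst M.finsum_addf) (simp_all add: endoD[OF endo_word_act] Pi_def del: Un_iff)
  finally show ?thesis .
qed

lemma free_act_uminus:
  assumes "p \<in> L.FA" "m \<in> carrier M"
  shows "free_act M (- p) m = \<ominus>\<^bsub>M\<^esub> free_act M p m"
  using free_act_add[of "- p" p m] assms free_algebra_uminus[OF assms(1)] free_act_closed
  by (intro M.minus_equality[symmetric]) auto

lemma free_act_diff:
  assumes "p \<in> L.FA" "q \<in> L.FA" "m \<in> carrier M"
  shows "free_act M (p - q) m = free_act M p m \<ominus>\<^bsub>M\<^esub> free_act M q m"
  using free_act_add[of p "- q" m] assms free_algebra_uminus[OF assms(2)] free_act_uminus
  by (simp add: a_minus_def)

lemma endo_free_act:
  assumes "p \<in> L.FA"
  shows "endo (free_act M p)"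
  using assms
proof (induction p rule: free_alg_induct)
  case zero
  then show ?case by (auto simp: endo_def)
next
  case (single w c)
  show ?case unfolding endo_def
    using endoD[OF endo_word_act[OF single]]
    by (auto simp: free_act_single[OF single] scal_add_right mult.commute simp flip: scal_mult)
next
  case (add p q)
  then show ?case unfolding endo_def
    by (auto simp: free_act_add scal_add_right M.a_ac endo_def)
qed

text \<open>Both sides are additive in \<open>p\<close> and in \<open>q\<close>, which reduces the
  claim to scaled words; there the product is concatenation, and concatenated words act by
  composition.\<close>

lemma free_act_mult:
  assumes p: "p \<in> L.FA" and q: "q \<in> L.FA"
    and m: "m \<in> carrier M"
  shows "free_act M (p * q) m = free_act M p (free_act M q m)"
  using p
proof (induction p rule: free_alg_induct)
  case (single v c)
  note v = single
  show ?case using q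
  proof (induction q rule: free_alg_induct)
    case (single w d)
    then show ?case using v m endoD[OF endo_word_act[OF v]] endoD[OF endo_word_act[OF single]]
      by (auto simp: mult_single free_act_single plus_free_monoid_def scal_mult)
  next
    case (add q q')
    note V = free_algebra_single[OF v, of c]
    show ?case
      using add V m endoD[OF endo_free_act[OF V]]
      by (simp add: distrib_left free_act_add free_act_closed free_algebra_closed)
  qed (use endoD[OF endo_free_act[OF free_algebra_single[OF v]]] in auto)
next
  case (add p p')
  then show ?case using m q
    by (simp add: distrib_right free_act_add free_act_closed free_algebra_closed)
qed (use m in auto)

lemma free_act_gen: "x \<in> carrier L \<Longrightarrow> m \<in> carrier M \<Longrightarrow> free_act M (gen x) m = act M x m"
  by (simp add: gen_def free_act_single act_closed)

lemma free_act_scalar: "m \<in> carrier M \<Longrightarrow> free_act M (scalar c) m = c \<odot>\<^bsub>M\<^esub> m"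
  by (simp add: scalar_def free_act_single zero_free_monoid_def)

lemma free_act_one: "m \<in> carrier M \<Longrightarrow> free_act M 1 m = m"
  using free_act_scalar[of m 1] by (simp add: scalar_def)

end

context lie_algebra
begin

lemma env_relations_closed: "env_relations L \<subseteq> FA"
  unfolding env_relations_def
  by (auto intro!: free_algebra_closed bracket_closed)

lemma ideal_env_ideal: "ideal (env_ideal L) (free_algebra (carrier L))"
  unfolding env_ideal_def by (rule ring.genideal_ideal[OF ring_free_algebra env_relations_closed])

lemma env_relations_in_ideal: "env_relations L \<subseteq> env_ideal L"
  unfolding env_ideal_def by (rule ring.genideal_self[OF ring_free_algebra env_relations_closed])

lemma env_ideal_closed: "i \<in> env_ideal L \<Longrightarrow> i \<in> FA"
  using ideal.Icarr[OF ideal_env_ideal] by blast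

lemma env_ideal_zero: "0 \<in> env_ideal L"
  using additive_subgroup.zero_closed[OF ideal.axioms(1)[OF ideal_env_ideal]] by simp

lemma env_ideal_add: "i \<in> env_ideal L \<Longrightarrow> j \<in> env_ideal L \<Longrightarrow> i + j \<in> env_ideal L"
  using additive_subgroup.a_closed[OF ideal.axioms(1)[OF ideal_env_ideal], of i j] by simp

lemma env_ideal_uminus: "i \<in> env_ideal L \<Longrightarrow> - i \<in> env_ideal L"
  using additive_subgroup.a_inv_closed[OF ideal.axioms(1)[OF ideal_env_ideal], of i] 
    free_algebra_a_inv[OF env_ideal_closed, of i]
    ring.is_abelian_group[OF ring_free_algebra] by (simp add: abelian_group.a_group)

lemma env_class_alt: "env_class L p = {i + p | i. i \<in> env_ideal L}"
  by (auto simp: env_class_def a_r_coset_def r_coset_def)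

lemma env_class_eq_iff: "env_class L p = env_class L q \<longleftrightarrow> p - q \<in> env_ideal L"
proof
  assume "env_class L p = env_class L q"
  then have "p \<in> env_class L q" using env_ideal_zero by (force simp: env_class_alt)
  then show "p - q \<in> env_ideal L" by (auto simp: env_class_alt)
next
  assume *: "p - q \<in> env_ideal L"
  show "env_class L p = env_class L q"
    unfolding env_class_alt
  proof (intro equalityI subsetI; clarify)
    fix i assume "i \<in> env_ideal L"
    then show "\<exists>j. i + p = j + q \<and> j \<in> env_ideal L"
      using env_ideal_add[OF _ *, of i] by (intro exI[of _ "i + (p - q)"]) simp
  next
    fix i assume "i \<in> env_ideal L"
    then show "\<exists>j. i + q = j + p \<and> j \<in> env_ideal L"
      using env_ideal_add[OF _ env_ideal_uminus[OF *], of i] by (intro exI[of _ "i + (q - p)"]) simp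
  qed
qed

lemma env_class_self: "p \<in> env_class L p"
  using env_ideal_zero by (force simp: env_class_alt)

text \<open>Controls the arbitrary representative in \<open>env_inclusion\<close> and
  \<open>env_act\<close>: it differs from any known one by an element of the ideal.\<close>

lemma env_class_SOME: "p \<in> FA \<Longrightarrow> \<exists>i\<in>env_ideal L. (SOME q. q \<in> env_class L p) = i + p"
  using someI[of "\<lambda>q. q \<in> env_class L p", OF env_class_self] by (auto simp: env_class_alt)

lemma ring_enveloping_algebra: "ring (enveloping_algebra L)"
  unfolding enveloping_algebra_def by (rule ideal.quotient_is_ring[OF ideal_env_ideal])

lemma env_class_hom: "env_class L \<in> ring_hom (free_algebra (carrier L)) (enveloping_algebra L)"
  using ideal.rcos_ring_hom[OF ideal_env_ideal]
    unfolding enveloping_algebra_def env_class_def[abs_def] .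

lemma env_class_closed: "p \<in> FA \<Longrightarrow> env_class L p \<in> carrier (enveloping_algebra L)"
  and env_class_mult: "p \<in> FA \<Longrightarrow> q \<in> FA \<Longrightarrow> env_class L (p * q)
    = env_class L p \<otimes>\<^bsub>enveloping_algebra L\<^esub> env_class L q"
  and env_class_add: "p \<in> FA \<Longrightarrow> q \<in> FA \<Longrightarrow> env_class L (p + q)
    = env_class L p \<oplus>\<^bsub>enveloping_algebra L\<^esub> env_class L q"
  using ring_hom_closed[OF env_class_hom] ring_hom_mult[OF env_class_hom] ring_hom_add[OF env_class_hom]
  by simp_all

lemma env_class_surj: "u \<in> carrier (enveloping_algebra L) \<Longrightarrow> \<exists>p\<in>FA. u = env_class L p"
  by (auto simp: enveloping_algebra_def FactRing_def A_RCOSETS_def RCOSETS_def env_class_def a_r_coset_def)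

lemma env_class_relations:
  assumes "x \<in> carrier L" "y \<in> carrier L"
  shows "env_class L (gen (x \<oplus>\<^bsub>L\<^esub> y)) = env_class L (gen x + gen y)"
    "env_class L (gen (c \<odot>\<^bsub>L\<^esub> x)) = env_class L (scalar c * gen x)"
    "env_class L (gen (bracket L x y)) = env_class L (gen x * gen y - gen y * gen x)"
proof -
  have "gen (x \<oplus>\<^bsub>L\<^esub> y) - gen x - gen y \<in> env_ideal L"
    "gen (c \<odot>\<^bsub>L\<^esub> x) - scalar c * gen x \<in> env_ideal L"
    "gen x * gen y - gen y * gen x - gen (bracket L x y) \<in> env_ideal L"
    using env_relations_in_ideal assms unfolding env_relations_def by blast+
  from this this(3)[THEN env_ideal_uminus] show "env_class L (gen (x \<oplus>\<^bsub>L\<^esub> y))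
    = env_class L (gen x + gen y)"
    "env_class L (gen (c \<odot>\<^bsub>L\<^esub> x)) = env_class L (scalar c * gen x)"
    "env_class L (gen (bracket L x y)) = env_class L (gen x * gen y - gen y * gen x)"
    by (simp_all add: env_class_eq_iff diff_diff_eq algebra_simps)
qed

end

context lie_module
begin

text \<open>The elements that annihilate all of \<open>M\<close> form a two-sided ideal of the free
  algebra, and the axioms of a Lie module say exactly that it contains the three families of
  relations.\<close>

lemma free_act_ideal:
  assumes i: "i \<in> env_ideal L" and m: "m \<in> carrier M"
  shows "free_act M i m = \<zero>\<^bsub>M\<^esub>"
proof -
  let ?J = "{p \<in> L.FA. \<forall>m\<in>carrier M. free_act M p m = \<zero>\<^bsub>M\<^esub>}"
  have "ideal ?J (free_algebra (carrier L))"
  proof (rule ideal_free_algebraI)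
    show "?J \<subseteq> L.FA" by blast
  qed (auto simp: free_act_add free_act_uminus free_act_mult free_act_closed endoD[OF endo_free_act]
    free_algebra_closed)
  moreover have "env_relations L \<subseteq> ?J"
  proof
    fix r assume "r \<in> env_relations L"
    then consider (add) x y where "r = gen (x \<oplus>\<^bsub>L\<^esub> y) - gen x - gen y" "x \<in> carrier L" "y \<in> carrier L"
      | (scal) c x where "r = gen (c \<odot>\<^bsub>L\<^esub> x) - scalar c * gen x" "x \<in> carrier L"
      | (brack) x y where "r = gen x * gen y - gen y * gen x - gen (bracket L x y)" "x \<in> carrier L"
        "y \<in> carrier L"
      unfolding env_relations_def by blast
    then show "r \<in> ?J"
    proof cases
      case add
      have "(act M x m \<oplus>\<^bsub>M\<^esub> act M y m) \<ominus>\<^bsub>M\<^esub> act M x m \<ominus>\<^bsub>M\<^esub> act M y m = \<zero>\<^bsub>M\<^esub>" if "m \<in> carrier M" for m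
        using add that M.r_neg[of "act M x m \<oplus>\<^bsub>M\<^esub> act M y m"]
        by (simp add: M.minus_eq M.minus_add M.a_assoc act_closed)
      then show ?thesis using add
        by (auto simp: free_act_diff free_act_gen act_add_left free_algebra_closed)
    qed (auto simp: free_act_diff free_act_gen free_act_mult free_act_scalar act_smult_left act_bracket
       L.bracket_closed act_closed free_algebra_closed M.minus_eq M.r_neg)
  qed
  ultimately have "env_ideal L \<subseteq> ?J"
    unfolding env_ideal_def by (rule ring.genideal_minimal[OF ring_free_algebra])
  then show ?thesis using i m by auto
qed

lemma env_act_class:
  assumes p: "p \<in> L.FA" and m: "m \<in> carrier M"
  shows "env_act M (env_class L p) m = free_act M p m"
proof -
  obtain i where i: "i \<in> env_ideal L" "(SOME q. q \<in> env_class L p) = i + p"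
    using L.env_class_SOME[OF p] by auto
  then show ?thesis unfolding env_act_def
    using free_act_add[OF L.env_ideal_closed[OF i(1)] p m] free_act_ideal[OF i(1) m]
      free_act_closed[OF p m]
    by simp
qed

end

context lie_algebra
begin

text \<open>This makes \<open>env_inclusion\<close> well defined. The ideal of \<open>L\<close>, cut
  down to the free algebra on \<open>C\<close>, is an ideal there and contains the defining
  relations of the subalgebra.\<close>

lemma env_ideal_mono:
  assumes C: "C \<subseteq> carrier L" "lie_algebra (L\<lparr>carrier := C\<rparr>)"
  shows "env_ideal (L\<lparr>carrier := C\<rparr>) \<subseteq> env_ideal L"
proof -
  interpret P: lie_algebra "L\<lparr>carrier := C\<rparr>" by fact
  let ?J = "env_ideal L \<inter> carrier (free_algebra C)"
  interpret I: ideal "env_ideal L" "free_algebra (carrier L)" by (rule ideal_env_ideal)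
  have "ideal ?J (free_algebra C)"
  proof (rule ideal_free_algebraI)
    fix a x :: "('k, 'g) free_alg" assume a: "x \<in> carrier (free_algebra C)" "a \<in> ?J"
    then have x: "x \<in> FA" using free_algebra_mono[OF C(1)] by blast
    show "x * a \<in> ?J" "a * x \<in> ?J"
      using a I.I_l_closed[OF _ x, of a] I.I_r_closed[OF _ x, of a] free_algebra_mult[of a C x]
        free_algebra_mult[of x C a]
      by auto
  qed (use env_ideal_zero in \<open>auto simp: env_ideal_add env_ideal_uminus free_algebra_closed\<close>)
  moreover have "env_relations (L\<lparr>carrier := C\<rparr>) \<subseteq> ?J"
  proof -
    have "env_relations (L\<lparr>carrier := C\<rparr>) \<subseteq> env_relations L"
      unfolding env_relations_def using C(1) by auto
    then show ?thesis using env_relations_in_ideal P.env_relations_closed by auto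
  qed
  ultimately have "Idl\<^bsub>free_algebra C\<^esub> (env_relations (L\<lparr>carrier := C\<rparr>)) \<subseteq> ?J"
    by (rule ring.genideal_minimal[OF ring_free_algebra])
  then have "env_ideal (L\<lparr>carrier := C\<rparr>) \<subseteq> ?J" unfolding env_ideal_def[of "L\<lparr>carrier := C\<rparr>"] by simp
  then show ?thesis by auto
qed

lemma env_inclusion_class:
  assumes C: "C \<subseteq> carrier L" "lie_algebra (L\<lparr>carrier := C\<rparr>)" and p: "p \<in> carrier (free_algebra C)"
  shows "env_inclusion L (env_class (L\<lparr>carrier := C\<rparr>) p) = env_class L p"
proof -
  interpret P: lie_algebra "L\<lparr>carrier := C\<rparr>" by fact
  obtain i where "i \<in> env_ideal (L\<lparr>carrier := C\<rparr>)" "(SOME q. q \<in> env_class (L\<lparr>carrier := C\<rparr>) p) = i + p"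
    using P.env_class_SOME[of p] p by auto
  then show ?thesis unfolding env_inclusion_def using env_ideal_mono[OF C]
    by (auto simp: env_class_eq_iff)
qed

end

section \<open>Balanced tensor products\<close>

lemma (in abelian_group) minus_eq_zero_iff:
  assumes "x \<in> carrier G" "y \<in> carrier G"
  shows "x \<ominus> y = \<zero> \<longleftrightarrow> x = y"
proof
  assume "x \<ominus> y = \<zero>"
  then have "(x \<ominus> y) \<oplus> y = y" using assms by simp
  then show "x = y" using assms by (simp add: minus_eq a_assoc l_neg)
qed (use assms in \<open>simp add: minus_eq r_neg\<close>)

lemma keys_diff_closed: "Poly_Mapping.keys s \<subseteq> S \<Longrightarrow> Poly_Mapping.keys s' \<subseteq> S \<Longrightarrow>
  Poly_Mapping.keys (s - s' :: _ \<Rightarrow>\<^sub>0 int) \<subseteq> S"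
  using Poly_Mapping.keys_diff[of s s'] by auto

locale balanced = A: abelian_group A + B: abelian_group B
  for R :: "'r set" and A :: "('a, 'c) ring_scheme" and ra :: "'a \<Rightarrow> 'r \<Rightarrow> 'a"
    and B :: "('b, 'd) ring_scheme" and la :: "'r \<Rightarrow> 'b \<Rightarrow> 'b" +
  assumes ra_closed: "a \<in> carrier A \<Longrightarrow> r \<in> R \<Longrightarrow> ra a r \<in> carrier A"
    and la_closed: "b \<in> carrier B \<Longrightarrow> r \<in> R \<Longrightarrow> la r b \<in> carrier B"
begin

abbreviation "supp s \<equiv> Poly_Mapping.keys s \<subseteq> carrier A \<times> carrier B"
abbreviation "frags \<equiv> free_Abelian_group (carrier A \<times> carrier B)"
abbreviation "relsub \<equiv> tensor_subgroup R A ra B la"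
abbreviation "TP \<equiv> tensor_product R A ra B la"

definition tcls :: "('a \<times> 'b \<Rightarrow>\<^sub>0 int) \<Rightarrow> ('a \<times> 'b \<Rightarrow>\<^sub>0 int) set" where
  "tcls s = {h + s | h. h \<in> relsub}"

definition pure :: "'a \<Rightarrow> 'b \<Rightarrow> ('a \<times> 'b \<Rightarrow>\<^sub>0 int) set" where
  "pure a b = tcls (frag_of (a, b))"

text \<open>Cosets are the same in every ambient free Abelian group. This reconciles
  \<open>tensor_map\<close>, which uses the one on \<open>UNIV\<close>, with
  \<open>tensor_product\<close>, which uses the one on pairs from the carriers.\<close>

lemma r_coset_relsub: "relsub #>\<^bsub>free_Abelian_group S\<^esub> s = tcls s"
  by (auto simp: r_coset_def tcls_def)

sublocale frags: comm_group frags by (rule abelian_free_Abelian_group)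

lemma tensor_relations_closed: "tensor_relations R A ra B la \<subseteq> carrier frags"
proof
  fix s assume "s \<in> tensor_relations R A ra B la"
  then show "s \<in> carrier frags" unfolding tensor_relations_def
    by (elim UnE CollectE exE conjE) (simp_all add: keys_diff_closed ra_closed la_closed)
qed

lemma relsub: "subgroup relsub frags"
  unfolding tensor_subgroup_def by (rule frags.generate_is_subgroup[OF tensor_relations_closed])

lemma normal_relsub: "normal relsub frags"
  using relsub by (simp add: frags.normal_iff_subgroup)

lemma relsub_closed: "h \<in> relsub \<Longrightarrow> supp h"
  using subgroup.mem_carrier[OF relsub] by simp

lemma relsub_simps: "0 \<in> relsub" "h \<in> relsub \<Longrightarrow> h' \<in> relsub \<Longrightarrow> h + h' \<in> relsub"
    "h \<in> relsub \<Longrightarrow> - h \<in> relsub" "h \<in> relsub \<Longrightarrow> h' \<in> relsub \<Longrightarrow> h - h' \<in> relsub"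
proof -
  show *: "h \<in> relsub \<Longrightarrow> - h \<in> relsub" "h \<in> relsub \<Longrightarrow> h' \<in> relsub \<Longrightarrow> h + h' \<in> relsub" for h h'
    using subgroup.m_inv_closed[OF relsub, of h] subgroup.m_closed[OF relsub, of h h']
      relsub_closed[of h] by auto
  show "0 \<in> relsub" using subgroup.one_closed[OF relsub] by simp
  show "h \<in> relsub \<Longrightarrow> h' \<in> relsub \<Longrightarrow> h - h' \<in> relsub" using *(1)[of h'] *(2)[of h "- h'"] by simp
qed

lemma tcls_eq_iff: "tcls s = tcls s' \<longleftrightarrow> s - s' \<in> relsub"
proof
  assume "tcls s = tcls s'"
  then have "s \<in> tcls s'" using relsub_simps(1) by (force simp: tcls_def)
  then show "s - s' \<in> relsub" by (auto simp: tcls_def)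
next
  assume *: "s - s' \<in> relsub"
  show "tcls s = tcls s'" unfolding tcls_def
  proof (intro equalityI subsetI; clarify)
    fix h assume h: "h \<in> relsub"
    show "\<exists>h'. h + s = h' + s' \<and> h' \<in> relsub"
      using relsub_simps(2)[OF h *] by (intro exI[of _ "h + (s - s')"]) simp
    show "\<exists>h'. h + s' = h' + s \<and> h' \<in> relsub"
      using relsub_simps(4)[OF h *] by (intro exI[of _ "h - (s - s')"]) simp
  qed
qed

lemma tcls_self: "s \<in> tcls s"
  using relsub_simps(1) by (force simp: tcls_def)

lemma carrier_TP: "carrier TP = tcls ` {s. supp s}"
  by (auto simp: tensor_product_def carrier_FactGroup r_coset_relsub)

lemma comm_group_TP: "comm_group TP"
  unfolding tensor_product_def by (rule frags.abelian_FactGroup[OF relsub])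

lemma one_TP: "\<one>\<^bsub>TP\<^esub> = tcls 0"
  by (auto simp: tensor_product_def tcls_def)

lemma mult_TP:
  assumes "supp s" "supp s'"
  shows "tcls s \<otimes>\<^bsub>TP\<^esub> tcls s' = tcls (s + s')"
  using normal.rcos_sum[OF normal_relsub, of s s'] assms
    by (simp add: tensor_product_def r_coset_relsub)

lemma keys_add_closed: "Poly_Mapping.keys s \<subseteq> S \<Longrightarrow> Poly_Mapping.keys s' \<subseteq> S \<Longrightarrow>
  Poly_Mapping.keys (s + s' :: _ \<Rightarrow>\<^sub>0 int) \<subseteq> S"
  using Poly_Mapping.keys_add[of s s'] by auto

lemma inv_TP:
  assumes "supp s"
  shows "inv\<^bsub>TP\<^esub> tcls s = tcls (- s)"
  using assms comm_group.axioms(2)[OF comm_group_TP] mult_TP[of "- s" s]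
  by (intro group.inv_equality) (auto simp: carrier_TP one_TP)

lemma pure_closed: "a \<in> carrier A \<Longrightarrow> b \<in> carrier B \<Longrightarrow> pure a b \<in> carrier TP"
  by (auto simp: carrier_TP pure_def)

lemma relsub_incl: "s \<in> tensor_relations R A ra B la \<Longrightarrow> s \<in> relsub"
  unfolding tensor_subgroup_def by (rule generate.incl)

lemma pure_add_left:
  assumes "a \<in> carrier A" "a' \<in> carrier A" "b \<in> carrier B"
  shows "pure (a \<oplus>\<^bsub>A\<^esub> a') b = pure a b \<otimes>\<^bsub>TP\<^esub> pure a' b"
proof -
  have "frag_of (a \<oplus>\<^bsub>A\<^esub> a', b) - frag_of (a, b) - frag_of (a', b) \<in> relsub"
    using assms by (intro relsub_incl) (auto simp: tensor_relations_def)
  then show ?thesis using assms by (simp add: pure_def mult_TP tcls_eq_iff diff_diff_eq)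
qed

lemma pure_add_right:
  assumes "a \<in> carrier A" "b \<in> carrier B" "b' \<in> carrier B"
  shows "pure a (b \<oplus>\<^bsub>B\<^esub> b') = pure a b \<otimes>\<^bsub>TP\<^esub> pure a b'"
proof -
  have "frag_of (a, b \<oplus>\<^bsub>B\<^esub> b') - frag_of (a, b) - frag_of (a, b') \<in> relsub"
    using assms by (intro relsub_incl) (auto simp: tensor_relations_def)
  then show ?thesis using assms by (simp add: pure_def mult_TP tcls_eq_iff diff_diff_eq)
qed

lemma pure_balanced:
  assumes "a \<in> carrier A" "r \<in> R" "b \<in> carrier B"
  shows "pure (ra a r) b = pure a (la r b)"
proof -
  have "frag_of (ra a r, b) - frag_of (a, la r b) \<in> relsub"
    using assms by (intro relsub_incl) (auto simp: tensor_relations_def)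
  then show ?thesis by (simp add: pure_def tcls_eq_iff)
qed

lemma TP_induct [consumes 1, case_names one pure div]:
  assumes t: "t \<in> carrier TP" and "Q \<one>\<^bsub>TP\<^esub>" and "\<And>a b. a \<in> carrier A \<Longrightarrow> b \<in> carrier B \<Longrightarrow> Q (pure a b)"
    and "\<And>t t'. t \<in> carrier TP \<Longrightarrow> t' \<in> carrier TP \<Longrightarrow> Q t \<Longrightarrow> Q t' \<Longrightarrow> Q (t \<otimes>\<^bsub>TP\<^esub> inv\<^bsub>TP\<^esub> t')"
  shows "Q t"
proof -
  obtain s where s: "t = tcls s" "supp s" using t by (auto simp: carrier_TP)
  have "Q (tcls s)"
  proof (rule free_Abelian_group_induct[OF s(2)])
    fix x y assume "supp x" "supp y"
      "Q (tcls x)" "Q (tcls y)"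
    then show "Q (tcls (x - y))" using assms(4)[of "tcls x" "tcls y"]
      by (auto simp: carrier_TP inv_TP mult_TP)
  qed (use assms(2,3) in \<open>auto simp: one_TP pure_def\<close>)
  then show ?thesis using s by simp
qed

text \<open>Serves twice: with \<open>J\<close> trivial for maps out of a tensor product, and with
  \<open>J\<close> the relation subgroup of another tensor product for maps between the two.\<close>

lemma hom_relsub:
  assumes h: "h \<in> hom frags Y" and Y: "Group.group Y"
    and rel: "\<And>s. s \<in> tensor_relations R A ra B la \<Longrightarrow> h s \<in> J" and J: "subgroup J Y"
  shows "s \<in> relsub \<Longrightarrow> h s \<in> J"
proof -
  interpret h: group_hom frags Y h
    using h Y by (simp add: group_hom_def group_hom_axioms_def)
  assume "s \<in> relsub"
  then show "h s \<in> J" unfolding tensor_subgroup_def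
  proof (induction rule: generate.induct)
    case (inv s)
    then show ?case using rel h.hom_inv[of s] tensor_relations_closed subgroup.m_inv_closed[OF J]
      by (auto simp del: inv_free_Abelian_group carrier_free_Abelian_group_iff)
  next
    case (eng s s')
    then have "s \<in> carrier frags" "s' \<in> carrier frags" using relsub_closed
      by (auto simp: tensor_subgroup_def)
    then show ?case using eng h.hom_mult[of s s'] subgroup.m_closed[OF J]
      by (auto simp del: mult_free_Abelian_group carrier_free_Abelian_group_iff)
  qed (use rel subgroup.one_closed[OF J] h.hom_one in \<open>auto\<close>)
qed

text \<open>Freeness extends \<open>f\<close> to formal sums. Biadditivity and balancing say that
  this extension kills the relations, so its value on a coset does not depend on the
  representative.\<close>

lemma TP_universal:
  assumes Y: "abelian_group Y"
    and f: "\<And>a b. a \<in> carrier A \<Longrightarrow> b \<in> carrier B \<Longrightarrow> f a b \<in> carrier Y"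
      "\<And>a a' b. a \<in> carrier A \<Longrightarrow> a' \<in> carrier A \<Longrightarrow> b \<in> carrier B \<Longrightarrow> f (a \<oplus>\<^bsub>A\<^esub> a') b = f a b \<oplus>\<^bsub>Y\<^esub> f a' b"
      "\<And>a b b'. a \<in> carrier A \<Longrightarrow> b \<in> carrier B \<Longrightarrow> b' \<in> carrier B \<Longrightarrow> f a (b \<oplus>\<^bsub>B\<^esub> b') = f a b \<oplus>\<^bsub>Y\<^esub> f a b'"
      "\<And>a r b. a \<in> carrier A \<Longrightarrow> r \<in> R \<Longrightarrow> b \<in> carrier B \<Longrightarrow> f (ra a r) b = f a (la r b)"
  shows "\<exists>\<phi>. (\<forall>t\<in>carrier TP. \<phi> t \<in> carrier Y) \<and>
     (\<forall>t\<in>carrier TP. \<forall>t'\<in>carrier TP. \<phi> (t \<otimes>\<^bsub>TP\<^esub> t') = \<phi> t \<oplus>\<^bsub>Y\<^esub> \<phi> t') \<and>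
     (\<forall>a\<in>carrier A. \<forall>b\<in>carrier B. \<phi> (pure a b) = f a b)"
proof -
  interpret Y: abelian_group Y by fact
  obtain h where h: "h \<in> hom frags (add_monoid Y)"
    "\<And>x. x \<in> carrier A \<times> carrier B \<Longrightarrow> h (frag_of x) = (case x of (a, b) \<Rightarrow> f a b)"
    using comm_group.free_Abelian_group_universal[OF Y.a_comm_group, of "\<lambda>(a, b). f a b"
      "carrier A \<times> carrier B"] f(1)
    by (auto simp: image_subset_iff)
  interpret h: group_hom frags "add_monoid Y" h
    using h Y.a_group by (simp add: group_hom_def group_hom_axioms_def)
  have h_diff: "h (s - s') = h s \<ominus>\<^bsub>Y\<^esub> h s'" if "supp s" "supp s'" for s s'
    using h.hom_mult[of s "- s'"] h.hom_inv[of s'] that by (simp add: a_minus_def a_inv_def)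
  have h_add: "h (s + s') = h s \<oplus>\<^bsub>Y\<^esub> h s'" if "supp s" "supp s'" for s s'
    using h.hom_mult[of s s'] that by simp
  have h_closed: "h s \<in> carrier Y" if "supp s" for s
    using h.hom_closed[of s] that by simp
  have cancel: "(x \<oplus>\<^bsub>Y\<^esub> y) \<ominus>\<^bsub>Y\<^esub> x \<ominus>\<^bsub>Y\<^esub> y = \<zero>\<^bsub>Y\<^esub>" if "x \<in> carrier Y" "y \<in> carrier Y" for x y
    using that Y.r_neg[of "x \<oplus>\<^bsub>Y\<^esub> y"] by (simp add: Y.minus_eq Y.minus_add Y.a_assoc)
  have kill: "h s = \<zero>\<^bsub>Y\<^esub>" if s: "s \<in> relsub" for s
  proof -
    have "h s \<in> {\<zero>\<^bsub>Y\<^esub>}" if "s \<in> tensor_relations R A ra B la" for s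
      using that unfolding tensor_relations_def
      by (auto simp: h_diff keys_diff_closed h(2) f ra_closed la_closed cancel Y.minus_eq_zero_iff)
    moreover have "subgroup {\<zero>\<^bsub>Y\<^esub>} (add_monoid Y)"
      using group.triv_subgroup[OF Y.a_group] by simp
    ultimately show ?thesis using hom_relsub[OF h(1) Y.a_group _ _ s, of "{\<zero>\<^bsub>Y\<^esub>}"] by auto
  qed
  \<comment> \<open>The representative is chosen with support in the carriers, because only there
    are the values of \<open>h\<close> under control.\<close>
  define \<phi> where "\<phi> t = h (SOME s. supp s \<and> t = tcls s)" for t
  have \<phi>: "\<phi> (tcls s) = h s" if s: "supp s" for s
  proof -
    let ?s = "SOME s'. supp s' \<and> tcls s = tcls s'"
    have *: "Poly_Mapping.keys ?s \<subseteq> carrier A \<times> carrier B \<and> tcls s = tcls ?s"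
      by (rule someI[where x = s]) (use s in auto)
    then have "h (?s - s) = \<zero>\<^bsub>Y\<^esub>" using kill[of "?s - s"] tcls_eq_iff[of ?s s] by simp
    then show ?thesis using * s by (simp add: \<phi>_def h_diff h_closed Y.minus_eq_zero_iff)
  qed
  show ?thesis
  proof (intro exI[of _ \<phi>] conjI ballI)
    fix t assume "t \<in> carrier TP" then show "\<phi> t \<in> carrier Y" by (auto simp: carrier_TP \<phi> h_closed)
  next
    fix t t' assume "t \<in> carrier TP" "t' \<in> carrier TP"
    then show "\<phi> (t \<otimes>\<^bsub>TP\<^esub> t') = \<phi> t \<oplus>\<^bsub>Y\<^esub> \<phi> t'"
      by (auto simp: carrier_TP mult_TP \<phi> h_add keys_add_closed)
  next
    fix a b assume "a \<in> carrier A" "b \<in> carrier B"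
    then show "\<phi> (pure a b) = f a b" by (simp add: pure_def \<phi> h)
  qed
qed

end

text \<open>Balancing is demanded of classes in the target, so no map from \<open>R\<close> to
  \<open>R'\<close> has to be named; it is exactly what sends the third family of relations into the
  relation subgroup.\<close>

locale balanced_map = S: balanced R A ra B la + T: balanced R' A' ra' B' la'
  for R :: "'r set" and A :: "('a, 'c) ring_scheme" and ra B la
    and R' :: "'r1 set" and A' :: "('a1, 'c1) ring_scheme" and ra' B' la' +
  fixes \<phi> \<psi>
  assumes \<phi>_closed: "a \<in> carrier A \<Longrightarrow> \<phi> a \<in> carrier A'" and \<psi>_closed: "b \<in> carrier B \<Longrightarrow> \<psi> b \<in> carrier B'"
    and \<phi>_add: "a \<in> carrier A \<Longrightarrow> a1 \<in> carrier A \<Longrightarrow> \<phi> (a \<oplus>\<^bsub>A\<^esub> a1) = \<phi> a \<oplus>\<^bsub>A'\<^esub> \<phi> a1"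
    and \<psi>_add: "b \<in> carrier B \<Longrightarrow> b1 \<in> carrier B \<Longrightarrow> \<psi> (b \<oplus>\<^bsub>B\<^esub> b1) = \<psi> b \<oplus>\<^bsub>B'\<^esub> \<psi> b1"
    and map_balanced: "a \<in> carrier A \<Longrightarrow> r \<in> R \<Longrightarrow> b \<in> carrier B \<Longrightarrow>
      T.pure (\<phi> (ra a r)) (\<psi> b) = T.pure (\<phi> a) (\<psi> (la r b))"
begin

abbreviation "ext \<equiv> frag_extend (\<lambda>(a, b). frag_of (\<phi> a, \<psi> b))"

lemma keys_ext: "Poly_Mapping.keys s \<subseteq> carrier A \<times> carrier B \<Longrightarrow>
  Poly_Mapping.keys (ext s) \<subseteq> carrier A' \<times> carrier B'"
  by (rule order_trans[OF keys_frag_extend]) (auto simp: \<phi>_closed \<psi>_closed)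

lemma ext_relsub: "s \<in> S.relsub \<Longrightarrow> ext s \<in> T.relsub"
proof (rule S.hom_relsub[where h = ext])
  show "ext \<in> hom S.frags T.frags"
    by (rule homI) (use keys_ext in \<open>auto simp: frag_extend_add\<close>)
  show "subgroup T.relsub T.frags" by (rule T.relsub)
  fix s assume "s \<in> tensor_relations R A ra B la"
  then show "ext s \<in> T.relsub"
    unfolding tensor_relations_def
  proof (elim UnE CollectE exE conjE)
    fix a a1 b assume s: "s = frag_of (a \<oplus>\<^bsub>A\<^esub> a1, b) - frag_of (a, b) - frag_of (a1, b)"
      and *: "a \<in> carrier A" "a1 \<in> carrier A" "b \<in> carrier B"
    have "ext s \<in> tensor_relations R' A' ra' B' la'"
      using * \<phi>_closed \<psi>_closed unfolding tensor_relations_def s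
      by (intro UnI1 CollectI exI[of _ "\<phi> a"] exI[of _ "\<phi> a1"] exI[of _ "\<psi> b"]) (auto
        simp: frag_extend_diff \<phi>_add)
    then show ?thesis by (rule T.relsub_incl)
  next
    fix a b b1 assume s: "s = frag_of (a, b \<oplus>\<^bsub>B\<^esub> b1) - frag_of (a, b) - frag_of (a, b1)"
      and *: "a \<in> carrier A" "b \<in> carrier B" "b1 \<in> carrier B"
    have "ext s \<in> tensor_relations R' A' ra' B' la'"
      using * \<phi>_closed \<psi>_closed unfolding tensor_relations_def s
      by (intro UnI1[OF UnI2] CollectI exI[of _ "\<phi> a"] exI[of _ "\<psi> b"] exI[of _ "\<psi> b1"]) (auto
        simp: frag_extend_diff \<psi>_add)
    then show ?thesis by (rule T.relsub_incl)
  next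
    fix a r b assume "s = frag_of (ra a r, b) - frag_of (a, la r b)" "a \<in> carrier A" "r \<in> R"
      "b \<in> carrier B"
    then show ?thesis using map_balanced[of a r b]
      by (simp add: frag_extend_diff T.pure_def T.tcls_eq_iff)
  qed
qed simp_all

text \<open>The extension maps relations to relations, so the representative picked inside
  \<open>tensor_map\<close> may be replaced by \<open>s\<close>.\<close>

lemma tensor_map_tcls: "tensor_map T.relsub \<phi> \<psi> (S.tcls s) = T.tcls (ext s)"
proof -
  have "(SOME s'. s' \<in> S.tcls s) \<in> S.tcls s" using S.tcls_self by (rule someI)
  then obtain h where "h \<in> S.relsub" "(SOME s'. s' \<in> S.tcls s) = h + s" by (auto simp: S.tcls_def)
  then show ?thesis unfolding tensor_map_def T.r_coset_relsub
    using ext_relsub[of h] by (simp add: T.tcls_eq_iff frag_extend_add)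
qed

lemma tensor_map_closed: "t \<in> carrier S.TP \<Longrightarrow> tensor_map T.relsub \<phi> \<psi> t \<in> carrier T.TP"
  using keys_ext by (auto simp: S.carrier_TP T.carrier_TP tensor_map_tcls)

lemma tensor_map_mult:
  "t \<in> carrier S.TP \<Longrightarrow> t' \<in> carrier S.TP \<Longrightarrow>
   tensor_map T.relsub \<phi> \<psi> (t \<otimes>\<^bsub>S.TP\<^esub> t')
     = tensor_map T.relsub \<phi> \<psi> t \<otimes>\<^bsub>T.TP\<^esub> tensor_map T.relsub \<phi> \<psi> t'"
  using keys_ext by (auto simp: S.carrier_TP tensor_map_tcls S.mult_TP T.mult_TP frag_extend_add)

lemma tensor_map_pure: "tensor_map T.relsub \<phi> \<psi> (S.pure a b) = T.pure (\<phi> a) (\<psi> b)"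
  by (simp add: S.pure_def T.pure_def tensor_map_tcls)

end

section \<open>Induced modules\<close>

text \<open>The conditions of \<open>lie_mod_hom\<close> without extensionality, so that plain
  composites, and the same function on a submodule, remain homomorphisms with no adjustment of
  values outside the carrier.\<close>

definition lin_hom :: "('k, 'g) lie_alg \<Rightarrow> ('k, 'g, 'm) lie_mod \<Rightarrow> ('k, 'g, 'n) lie_mod \<Rightarrow> ('m \<Rightarrow> 'n) \<Rightarrow> bool" where
  "lin_hom L M N f \<longleftrightarrow> (\<forall>m\<in>carrier M. f m \<in> carrier N) \<and>
     (\<forall>m\<in>carrier M. \<forall>n\<in>carrier M. f (m \<oplus>\<^bsub>M\<^esub> n) = f m \<oplus>\<^bsub>N\<^esub> f n) \<and>
     (\<forall>c. \<forall>m\<in>carrier M. f (c \<odot>\<^bsub>M\<^esub> m) = c \<odot>\<^bsub>N\<^esub> f m) \<and>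
     (\<forall>x\<in>carrier L. \<forall>m\<in>carrier M. f (act M x m) = act N x (f m))"

lemma lin_homD:
  assumes "lin_hom L M N f"
  shows "m \<in> carrier M \<Longrightarrow> f m \<in> carrier N"
    "m \<in> carrier M \<Longrightarrow> n \<in> carrier M \<Longrightarrow> f (m \<oplus>\<^bsub>M\<^esub> n) = f m \<oplus>\<^bsub>N\<^esub> f n"
    "m \<in> carrier M \<Longrightarrow> f (c \<odot>\<^bsub>M\<^esub> m) = c \<odot>\<^bsub>N\<^esub> f m"
    "x \<in> carrier L \<Longrightarrow> m \<in> carrier M \<Longrightarrow> f (act M x m) = act N x (f m)"
  using assms by (auto simp: lin_hom_def)

lemma lie_mod_hom_iff: "f \<in> lie_mod_hom L M N \<longleftrightarrow> f \<in> extensional (carrier M) \<and> lin_hom L M N f"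
  unfolding lie_mod_hom_def lin_hom_def PiE_def Pi_def by auto

lemma lin_hom_free_act:
  assumes "lie_module L M" "lie_module L N" and f: "lin_hom L M N f"
    and p: "p \<in> carrier (free_algebra (carrier L))" and m: "m \<in> carrier M"
  shows "f (free_act M p m) = free_act N p (f m)"
proof -
  interpret M: lie_module L M by fact
  interpret N: lie_module L N by fact
  note fD = lin_homD[OF f]
  have word: "f (M.word_act xs m) = N.word_act xs (f m)" if "set xs \<subseteq> carrier L" for xs
    using that
  proof (induction xs)
    case (Cons x xs)
    then show ?case using fD(4)[of x "M.word_act xs m"] M.endoD(1)[OF M.endo_word_act m, of xs] by simp
  qed simp
  show ?thesis using p
  proof (induction p rule: free_alg_induct)
    case (single w c)
    then show ?case
      using word fD m M.endoD(1)[OF M.endo_word_act m]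
        by (simp add: M.free_act_single N.free_act_single)
  next
    case (add p q)
    then show ?case using m fD by (simp add: M.free_act_add M.free_act_closed N.free_act_add)
  qed (use fD(3)[of "\<zero>\<^bsub>M\<^esub>" 0] fD(1)[of "\<zero>\<^bsub>M\<^esub>"] in simp)
qed

lemma additive_minus:
  assumes "abelian_group M" "abelian_group N" "\<And>m. m \<in> carrier M \<Longrightarrow> f m \<in> carrier N"
    "\<And>m n. m \<in> carrier M \<Longrightarrow> n \<in> carrier M \<Longrightarrow> f (m \<oplus>\<^bsub>M\<^esub> n) = f m \<oplus>\<^bsub>N\<^esub> f n"
  shows "f \<zero>\<^bsub>M\<^esub> = \<zero>\<^bsub>N\<^esub>" "m \<in> carrier M \<Longrightarrow> f (\<ominus>\<^bsub>M\<^esub> m) = \<ominus>\<^bsub>N\<^esub> f m"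
    "m \<in> carrier M \<Longrightarrow> n \<in> carrier M \<Longrightarrow> f (m \<ominus>\<^bsub>M\<^esub> n) = f m \<ominus>\<^bsub>N\<^esub> f n"
proof -
  interpret M: abelian_group M by fact
  interpret N: abelian_group N by fact
  interpret h: group_hom "add_monoid M" "add_monoid N" f
    using assms(3,4) M.a_group N.a_group by (auto simp: group_hom_def group_hom_axioms_def hom_def)
  show z: "f \<zero>\<^bsub>M\<^esub> = \<zero>\<^bsub>N\<^esub>" using h.hom_one by simp
  show i: "m \<in> carrier M \<Longrightarrow> f (\<ominus>\<^bsub>M\<^esub> m) = \<ominus>\<^bsub>N\<^esub> f m" for m using h.hom_inv[of m] by (simp add: a_inv_def)
  show "m \<in> carrier M \<Longrightarrow> n \<in> carrier M \<Longrightarrow> f (m \<ominus>\<^bsub>M\<^esub> n) = f m \<ominus>\<^bsub>N\<^esub> f n"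
    by (simp add: a_minus_def assms(4) i)
qed

lemma lin_space_cong:
  assumes "lin_space M" "carrier M' = carrier M" "\<zero>\<^bsub>M'\<^esub> = \<zero>\<^bsub>M\<^esub>" "add M' = add M"
    "module.smult M' = module.smult M"
  shows "lin_space M'"
proof -
  interpret lin_space M by fact
  have "abelian_group M'"
    by (rule abelian_groupI) (use assms M.l_neg M.a_inv_closed in \<open>auto simp: M.a_ac\<close>)
  then show ?thesis unfolding lin_space_def
    by (intro moduleI) (use assms smult_l_distr smult_r_distr smult_assoc1 in \<open>auto
      intro: cring_from_type_algebra\<close>)
qed

lemma (in lin_space) lin_space_restrict:
  assumes A: "lin_subset A"
  shows "lin_space (M\<lparr>carrier := A\<rparr>)"
proof -
  have "abelian_group (M\<lparr>carrier := A\<rparr>)"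
  proof (rule abelian_groupI)
    fix x assume "x \<in> carrier (M\<lparr>carrier := A\<rparr>)"
    then show "\<exists>y\<in>carrier (M\<lparr>carrier := A\<rparr>). y \<oplus>\<^bsub>M\<lparr>carrier := A\<rparr>\<^esub> x = \<zero>\<^bsub>M\<lparr>carrier := A\<rparr>\<^esub>"
      using lin_subsetD[OF A] by (intro bexI[of _ "\<ominus> x"]) (auto simp: M.l_neg)
  qed (use lin_subsetD[OF A] in \<open>auto simp: M.a_ac\<close>)
  then show ?thesis unfolding lin_space_def
    by (intro moduleI) (use lin_subsetD[OF A] smult_l_distr smult_r_distr smult_assoc1 in \<open>auto
      intro: cring_from_type_algebra\<close>)
qed

text \<open>Covers both restrictions that occur: to a subalgebra on the same space, and to the
  center on the space of invariants.\<close>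

lemma (in lie_module) lie_module_restrict:
  assumes C: "lie_algebra (L\<lparr>carrier := C\<rparr>)" "C \<subseteq> carrier L"
    and A: "lin_subset A" "\<And>x m. x \<in> C \<Longrightarrow> m \<in> A \<Longrightarrow> act M x m \<in> A"
  shows "lie_module (L\<lparr>carrier := C\<rparr>) (M\<lparr>carrier := A\<rparr>)"
proof -
  note AD = lin_subsetD[OF A(1)]
  have sp: "lin_space (M\<lparr>carrier := A\<rparr>)" by (rule lin_space_restrict[OF A(1)])
  \<comment> \<open>Negatives are computed inside each record, so the two subtractions have to be
    compared; the inclusion of \<open>A\<close> is additive and hence respects them.\<close>
  have minus: "m \<ominus>\<^bsub>M\<lparr>carrier := A\<rparr>\<^esub> n = m \<ominus>\<^bsub>M\<^esub> n" if "m \<in> A" "n \<in> A" for m n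
    using sp by (intro additive_minus(3)[OF _ M.abelian_group_axioms])
      (use that AD in \<open>auto simp: lin_space_def Module.module_def\<close>)
  have "lie_module_axioms (L\<lparr>carrier := C\<rparr>) (M\<lparr>carrier := A\<rparr>)"
    by (rule lie_module_axioms.intro)
       (simp_all add: A(2) AD(2) minus subsetD[OF C(2)]
         act_add_left act_smult_left act_add_right act_smult_right act_bracket)
  then show ?thesis using C(1) sp by (simp add: lie_module_def lin_space_def)
qed

locale induced = lie_algebra L + N: lie_module "L\<lparr>carrier := C\<rparr>" N
  for L :: "('k::field, 'g) lie_alg" and C and N :: "('k, 'g, 'n) lie_mod" +
  assumes C: "C \<subseteq> carrier L"
begin

abbreviation "P \<equiv> L\<lparr>carrier := C\<rparr>"
abbreviation "U \<equiv> enveloping_algebra L"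
abbreviation "Ind \<equiv> induced_module L P N"
abbreviation "FC \<equiv> carrier (free_algebra C :: ('k, 'g) free_alg ring)"

lemma FC: "p \<in> FC \<Longrightarrow> p \<in> FA"
  using free_algebra_mono[OF C] by blast

sublocale U: ring U by (rule ring_enveloping_algebra)

lemma env_inclusion: "p \<in> FC \<Longrightarrow> env_inclusion L (env_class P p) = env_class L p"
  using env_inclusion_class[OF C N.L.lie_algebra_axioms] .

lemma P_surj: "r \<in> carrier (enveloping_algebra P) \<Longrightarrow> \<exists>p\<in>FC. r = env_class P p"
  using N.L.env_class_surj[of r] by simp

lemma P_act: "p \<in> FC \<Longrightarrow> n \<in> carrier N \<Longrightarrow> env_act N (env_class P p) n = free_act N p n"
  using N.env_act_class[of p n] by simp

sublocale B: balanced "carrier (enveloping_algebra P)" U "\<lambda>a r. a \<otimes>\<^bsub>U\<^esub> env_inclusion L r" N "env_act N"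
proof unfold_locales
  fix a b r assume r: "r \<in> carrier (enveloping_algebra P)"
  then obtain p where p: "p \<in> FC" "r = env_class P p" using P_surj by blast
  show "a \<otimes>\<^bsub>U\<^esub> env_inclusion L r \<in> carrier U" if "a \<in> carrier U"
    using that p env_class_closed[OF FC[OF p(1)]] by (simp add: env_inclusion)
  show "env_act N r b \<in> carrier N" if "b \<in> carrier N"
    using that p N.free_act_closed[of p b] by (simp add: P_act)
qed

lemma Ind_simps:
  "carrier Ind = carrier B.TP" "\<zero>\<^bsub>Ind\<^esub> = \<one>\<^bsub>B.TP\<^esub>" "s \<oplus>\<^bsub>Ind\<^esub> t = s \<otimes>\<^bsub>B.TP\<^esub> t"
  by (simp_all add: induced_module_def induced_group_def)

lemma abelian_group_Ind: "abelian_group Ind"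
proof -
  interpret T: comm_group B.TP by (rule B.comm_group_TP)
  show ?thesis
    by (rule abelian_groupI) (auto simp: Ind_simps T.m_ac intro: T.l_inv_ex)
qed

sublocale G: abelian_group Ind by (rule abelian_group_Ind)

lemma Ind_minus: "t \<in> carrier Ind \<Longrightarrow> \<ominus>\<^bsub>Ind\<^esub> t = inv\<^bsub>B.TP\<^esub> t"
  using comm_group.axioms(2)[OF B.comm_group_TP]
  by (intro G.minus_equality) (auto simp: Ind_simps group.l_inv group.inv_closed)

text \<open>Enveloping algebra elements are represented in the free algebra, where induction on
  words and the action on modules are directly available.\<close>

definition pt :: "('k, 'g) free_alg \<Rightarrow> 'n \<Rightarrow> ('k, 'g, 'n) ind" where
  "pt p n = B.pure (env_class L p) n"

lemma pt_closed: "p \<in> FA \<Longrightarrow> n \<in> carrier N \<Longrightarrow> pt p n \<in> carrier Ind"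
  unfolding pt_def Ind_simps by (intro B.pure_closed env_class_closed)

lemma pt_add_left: "p \<in> FA \<Longrightarrow> q \<in> FA \<Longrightarrow> n \<in> carrier N \<Longrightarrow> pt (p + q) n = pt p n \<oplus>\<^bsub>Ind\<^esub> pt q n"
  unfolding pt_def Ind_simps by (simp add: env_class_add env_class_closed B.pure_add_left)

lemma pt_add_right: "p \<in> FA \<Longrightarrow> n \<in> carrier N \<Longrightarrow> n' \<in> carrier N \<Longrightarrow> pt p (n \<oplus>\<^bsub>N\<^esub> n') = pt p n \<oplus>\<^bsub>Ind\<^esub> pt p n'"
  unfolding pt_def Ind_simps by (simp add: env_class_closed B.pure_add_right)

lemma pt_balanced:
  assumes "p \<in> FA" "q \<in> FC" "n \<in> carrier N" shows "pt (p * q) n = pt p (free_act N q n)"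
  using assms B.pure_balanced[of "env_class L p" "env_class P q" n] N.L.env_class_closed[of q] FC
  by (simp add: pt_def env_class_closed env_class_mult env_inclusion P_act)

lemma Ind_induct [consumes 1, case_names zero pt diff]:
  assumes "t \<in> carrier Ind" and "Q \<zero>\<^bsub>Ind\<^esub>" and "\<And>p n. p \<in> FA \<Longrightarrow> n \<in> carrier N \<Longrightarrow> Q (pt p n)"
    and "\<And>t t'. t \<in> carrier Ind \<Longrightarrow> t' \<in> carrier Ind \<Longrightarrow> Q t \<Longrightarrow> Q t' \<Longrightarrow> Q (t \<ominus>\<^bsub>Ind\<^esub> t')"
  shows "Q t"
  using assms(1) unfolding Ind_simps
proof (induction t rule: B.TP_induct)
  case one then show ?case using assms(2) by (simp add: Ind_simps)
next
  case (pure a b)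
  then obtain p where "p \<in> FA" "a = env_class L p" using env_class_surj by blast
  then show ?case using assms(3)[of p b] pure by (simp add: pt_def)
next
  case (div t t')
  then show ?case using assms(4)[of t t'] Ind_minus[of t'] by (simp add: Ind_simps a_minus_def)
qed

text \<open>Asks for additivity only, because it serves to establish the module structure itself,
  before scalar multiplication is known to behave.\<close>

lemma additive_eqI:
  assumes t: "t \<in> carrier Ind" and Y: "abelian_group Y"
    and f: "\<And>t. t \<in> carrier Ind \<Longrightarrow> f t \<in> carrier Y"
      "\<And>s t. s \<in> carrier Ind \<Longrightarrow> t \<in> carrier Ind \<Longrightarrow> f (s \<oplus>\<^bsub>Ind\<^esub> t) = f s \<oplus>\<^bsub>Y\<^esub> f t"
    and g: "\<And>t. t \<in> carrier Ind \<Longrightarrow> g t \<in> carrier Y"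
      "\<And>s t. s \<in> carrier Ind \<Longrightarrow> t \<in> carrier Ind \<Longrightarrow> g (s \<oplus>\<^bsub>Ind\<^esub> t) = g s \<oplus>\<^bsub>Y\<^esub> g t"
    and "\<And>p n. p \<in> FA \<Longrightarrow> n \<in> carrier N \<Longrightarrow> f (pt p n) = g (pt p n)"
  shows "f t = g t"
  using t
proof (induction t rule: Ind_induct)
  case zero
  then show ?case using additive_minus(1)[OF abelian_group_Ind Y, of f]
    additive_minus(1)[OF abelian_group_Ind Y, of g] f g by simp
next
  case (diff t t')
  then show ?case
    using additive_minus(3)[OF abelian_group_Ind Y, of f]
      additive_minus(3)[OF abelian_group_Ind Y, of g] f g by simp
qed (use assms in auto)

definition lmul :: "('k, 'g) free_alg \<Rightarrow> ('k, 'g, 'n) ind \<Rightarrow> ('k, 'g, 'n) ind" where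
  "lmul p = induced_left_mult L P N (env_class L p)"

text \<open>Left multiplication on \<open>U\<close> commutes with the right action of the subalgebra
  by associativity, so it respects balancing and descends to the tensor product.\<close>

lemma lmul_props:
  assumes p: "p \<in> FA"
  shows "t \<in> carrier Ind \<Longrightarrow> lmul p t \<in> carrier Ind"
    "s \<in> carrier Ind \<Longrightarrow> t \<in> carrier Ind \<Longrightarrow> lmul p (s \<oplus>\<^bsub>Ind\<^esub> t) = lmul p s \<oplus>\<^bsub>Ind\<^esub> lmul p t"
    "q \<in> FA \<Longrightarrow> lmul p (pt q n) = pt (p * q) n"
proof -
  interpret LM: balanced_map "carrier (enveloping_algebra P)" U "\<lambda>a r. a \<otimes>\<^bsub>U\<^esub> env_inclusion L r"
    N "env_act N"
    "carrier (enveloping_algebra P)" U "\<lambda>a r. a \<otimes>\<^bsub>U\<^esub> env_inclusion L r" N "env_act N"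
    "\<lambda>a. env_class L p \<otimes>\<^bsub>U\<^esub> a" "\<lambda>n. n"
  proof unfold_locales
    fix a r b assume a: "a \<in> carrier U" and r: "r \<in> carrier (enveloping_algebra P)"
      and b: "b \<in> carrier N"
    have "env_inclusion L r \<in> carrier U" using P_surj[OF r] env_inclusion env_class_closed FC by auto
    then show "B.pure (env_class L p \<otimes>\<^bsub>U\<^esub> (a \<otimes>\<^bsub>U\<^esub> env_inclusion L r)) b
      = B.pure (env_class L p \<otimes>\<^bsub>U\<^esub> a) (env_act N r b)"
      using a r b env_class_closed[OF p] by (simp add: U.m_assoc[symmetric] B.pure_balanced)
  qed (use env_class_closed[OF p] in \<open>auto simp: U.r_distr\<close>)
  have eq: "lmul p = tensor_map B.relsub (\<lambda>a. env_class L p \<otimes>\<^bsub>U\<^esub> a) (\<lambda>n. n)"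
    by (simp add: lmul_def induced_left_mult_def induced_subgroup_def)
  show "t \<in> carrier Ind \<Longrightarrow> lmul p t \<in> carrier Ind"
    "s \<in> carrier Ind \<Longrightarrow> t \<in> carrier Ind \<Longrightarrow> lmul p (s \<oplus>\<^bsub>Ind\<^esub> t) = lmul p s \<oplus>\<^bsub>Ind\<^esub> lmul p t"
    using LM.tensor_map_closed LM.tensor_map_mult by (simp_all add: eq Ind_simps)
  show "q \<in> FA \<Longrightarrow> lmul p (pt q n) = pt (p * q) n"
    using LM.tensor_map_pure p by (simp add: eq pt_def env_class_mult)
qed

lemma lmul_mult:
  assumes "p \<in> FA" "q \<in> FA" "t \<in> carrier Ind"
  shows "lmul (p * q) t = lmul p (lmul q t)"
  by (rule additive_eqI[OF assms(3) abelian_group_Ind])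
     (use assms in \<open>auto simp: lmul_props free_algebra_closed mult.assoc\<close>)

lemma lmul_add:
  assumes "p \<in> FA" "q \<in> FA" "t \<in> carrier Ind"
  shows "lmul (p + q) t = lmul p t \<oplus>\<^bsub>Ind\<^esub> lmul q t"
  by (rule additive_eqI[OF assms(3) abelian_group_Ind])
     (use assms in \<open>auto simp: lmul_props free_algebra_closed distrib_right pt_add_left G.a_ac\<close>)

lemma lmul_one:
  assumes "t \<in> carrier Ind" shows "lmul 1 t = t"
  by (rule additive_eqI[OF assms abelian_group_Ind])
     (auto simp: lmul_props free_algebra_closed)

lemma lmul_diff:
  assumes "p \<in> FA" "q \<in> FA" "t \<in> carrier Ind"
  shows "lmul (p - q) t = lmul p t \<ominus>\<^bsub>Ind\<^esub> lmul q t"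
proof -
  have "lmul p t = lmul (p - q) t \<oplus>\<^bsub>Ind\<^esub> lmul q t"
    using lmul_add[of "p - q" q t] assms by (simp add: free_algebra_closed)
  then show ?thesis using assms
    by (simp add: a_minus_def G.a_assoc G.r_neg lmul_props free_algebra_closed)
qed

lemma act_Ind: "act Ind x t = lmul (gen x) t" and smult_Ind: "c \<odot>\<^bsub>Ind\<^esub> t = lmul (scalar c) t"
  by (simp_all add: induced_module_def lmul_def)

lemma scalar_simps:
  "scalar (c + d) = scalar c + scalar d" "scalar (c * d) = scalar c * scalar d" "scalar 1 = 1"
  "p * scalar c = scalar c * p" "scalar c * Poly_Mapping.single w d = Poly_Mapping.single w (c * d)"
proof -
  show "scalar (c + d) = scalar c + scalar d" "scalar (c * d) = scalar c * scalar d" "scalar 1 = 1"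
     "scalar c * Poly_Mapping.single w d = Poly_Mapping.single w (c * d)"
    by (simp_all add: scalar_def single_add mult_single)
  have "p \<in> carrier (free_algebra UNIV)" by (simp add: free_algebra_iff)
  then show "p * scalar c = scalar c * p"
    by (induction p rule: free_alg_induct) (auto
      simp: scalar_def mult_single distrib_left distrib_right mult.commute)
qed

lemma lmul_cong: "env_class L p = env_class L q \<Longrightarrow> lmul p = lmul q"
  by (simp add: lmul_def)

text \<open>Scalars and Lie algebra elements both act by left multiplication, so the axioms become
  identities in the enveloping algebra: its three families of relations give linearity and the
  bracket rule, and scalars are central.\<close>

lemma lie_module_Ind: "lie_module L Ind"
proof -
  have "module ring_of_type_algebra Ind"
  proof (rule moduleI)
    fix c d :: 'k and t assume t: "t \<in> carrier Ind"
    have sc: "scalar c \<in> FA" "scalar d \<in> FA" by (rule free_algebra_scalar)+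
    show "c \<odot>\<^bsub>Ind\<^esub> t \<in> carrier Ind" unfolding smult_Ind by (rule lmul_props(1)[OF sc(1) t])
    show "(c \<oplus>\<^bsub>ring_of_type_algebra\<^esub> d) \<odot>\<^bsub>Ind\<^esub> t = c \<odot>\<^bsub>Ind\<^esub> t \<oplus>\<^bsub>Ind\<^esub> d \<odot>\<^bsub>Ind\<^esub> t"
      by (simp only: smult_Ind ring_of_type_algebra_simps scalar_simps(1) lmul_add[OF sc t])
    show "(c \<otimes>\<^bsub>ring_of_type_algebra\<^esub> d) \<odot>\<^bsub>Ind\<^esub> t = c \<odot>\<^bsub>Ind\<^esub> (d \<odot>\<^bsub>Ind\<^esub> t)"
      by (simp only: smult_Ind ring_of_type_algebra_simps scalar_simps(2) lmul_mult[OF sc t])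
    show "\<one>\<^bsub>ring_of_type_algebra\<^esub> \<odot>\<^bsub>Ind\<^esub> t = t"
      by (simp only: smult_Ind ring_of_type_algebra_simps scalar_simps(3) lmul_one[OF t])
    show "c \<odot>\<^bsub>Ind\<^esub> (t \<oplus>\<^bsub>Ind\<^esub> t') = c \<odot>\<^bsub>Ind\<^esub> t \<oplus>\<^bsub>Ind\<^esub> c \<odot>\<^bsub>Ind\<^esub> t'" if "t' \<in> carrier Ind" for t'
      unfolding smult_Ind by (rule lmul_props(2)[OF sc(1) t that])
  qed (rule cring_from_type_algebra abelian_group_Ind)+
  moreover have "lie_module_axioms L Ind"
  proof (rule lie_module_axioms.intro)
    fix x y c m m' assume x: "x \<in> carrier L" and m: "m \<in> carrier Ind"
    have gx: "gen x \<in> FA" and sc: "scalar c \<in> FA"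
      by (rule free_algebra_gen[OF x], rule free_algebra_scalar)
    show "act Ind x m \<in> carrier Ind" unfolding act_Ind by (rule lmul_props(1)[OF gx m])
    show "act Ind (c \<odot>\<^bsub>L\<^esub> x) m = c \<odot>\<^bsub>Ind\<^esub> act Ind x m"
      unfolding act_Ind smult_Ind lmul_cong[OF env_class_relations(2)[OF x x]]
        by (rule lmul_mult[OF sc gx m])
    show "act Ind x (c \<odot>\<^bsub>Ind\<^esub> m) = c \<odot>\<^bsub>Ind\<^esub> act Ind x m"
      unfolding act_Ind smult_Ind lmul_mult[OF gx sc m, symmetric] lmul_mult[OF sc gx m, symmetric]
        scalar_simps(4)[of "gen x"] ..
    show "act Ind x (m \<oplus>\<^bsub>Ind\<^esub> m') = act Ind x m \<oplus>\<^bsub>Ind\<^esub> act Ind x m'" if "m' \<in> carrier Ind"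
      unfolding act_Ind by (rule lmul_props(2)[OF gx m that])
    assume y: "y \<in> carrier L"
    then have gy: "gen y \<in> FA" by (rule free_algebra_gen)
    show "act Ind (x \<oplus>\<^bsub>L\<^esub> y) m = act Ind x m \<oplus>\<^bsub>Ind\<^esub> act Ind y m"
      unfolding act_Ind lmul_cong[OF env_class_relations(1)[OF x y]] by (rule lmul_add[OF gx gy m])
    show "act Ind (bracket L x y) m = act Ind x (act Ind y m) \<ominus>\<^bsub>Ind\<^esub> act Ind y (act Ind x m)"
      unfolding act_Ind lmul_cong[OF env_class_relations(3)[OF x y]]
      using gx gy m by (simp add: lmul_diff lmul_mult free_algebra_mult)
  qed
  ultimately show ?thesis using lie_algebra_axioms by (simp add: lie_module_def)
qed

sublocale I: lie_module L Ind by (rule lie_module_Ind)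

text \<open>The unit of the adjunction between induction and restriction.\<close>

definition \<eta> :: "'n \<Rightarrow> ('k, 'g, 'n) ind" where "\<eta> n = pt 1 n"

lemma eta_closed: "n \<in> carrier N \<Longrightarrow> \<eta> n \<in> carrier Ind"
  unfolding \<eta>_def by (rule pt_closed[OF free_algebra_one])

lemma eta_add: "n \<in> carrier N \<Longrightarrow> n' \<in> carrier N \<Longrightarrow> \<eta> (n \<oplus>\<^bsub>N\<^esub> n') = \<eta> n \<oplus>\<^bsub>Ind\<^esub> \<eta> n'"
  unfolding \<eta>_def by (rule pt_add_right[OF free_algebra_one])

lemma lmul_eta: "p \<in> FC \<Longrightarrow> n \<in> carrier N \<Longrightarrow> lmul p (\<eta> n) = \<eta> (free_act N p n)"
  using pt_balanced[OF free_algebra_one, of p n] FC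
  by (simp add: \<eta>_def lmul_props free_algebra_one)

lemma eta_smult: "n \<in> carrier N \<Longrightarrow> \<eta> (c \<odot>\<^bsub>N\<^esub> n) = c \<odot>\<^bsub>Ind\<^esub> \<eta> n"
  using lmul_eta[OF free_algebra_scalar, of n c] by (simp add: smult_Ind N.free_act_scalar)

lemma eta_act: "x \<in> C \<Longrightarrow> n \<in> carrier N \<Longrightarrow> act Ind x (\<eta> n) = \<eta> (act N x n)"
  using lmul_eta[OF free_algebra_gen, of x n] N.free_act_gen[of x n] by (simp add: act_Ind)

text \<open>A word tensored with \<open>n\<close> arises from \<open>\<eta> n\<close> by letting its
  letters act one after the other; scalars and sums then reach every tensor.\<close>

theorem generated:
  assumes Y: "I.lin_subset Y" "\<And>x t. x \<in> carrier L \<Longrightarrow> t \<in> Y \<Longrightarrow> act Ind x t \<in> Y"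
    "\<And>n. n \<in> carrier N \<Longrightarrow> \<eta> n \<in> Y"
  shows "carrier Ind \<subseteq> Y"
proof
  fix t assume "t \<in> carrier Ind"
  then show "t \<in> Y"
  proof (induction t rule: Ind_induct)
    case (pt p n)
    note n = pt(2)
    from pt(1) show ?case
    proof (induction p rule: free_alg_induct)
      case zero
      have "pt 0 n \<oplus>\<^bsub>Ind\<^esub> pt 0 n = pt 0 n" using pt_add_left[OF free_algebra_zero free_algebra_zero n]
        by simp
      then have "pt 0 n = \<zero>\<^bsub>Ind\<^esub>" using pt_closed[OF free_algebra_zero n] by simp
      then show ?case using I.lin_subsetD[OF Y(1)] by simp
    next
      case (single w c)
      obtain xs where w: "w = Word xs" by (cases w)
      have "pt (Poly_Mapping.single (Word xs) 1) n \<in> Y" if "set xs \<subseteq> carrier L"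
        using that
      proof (induction xs)
        case Nil
        have "Poly_Mapping.single (Word []) 1 = (1 :: ('k, 'g) free_alg)"
          by (simp add: zero_free_monoid_def flip: single_one)
        then show ?case using Y(3)[OF n] by (simp add: \<eta>_def)
      next
        case (Cons x xs)
        have "Poly_Mapping.single (Word (x # xs)) 1
          = gen x * (Poly_Mapping.single (Word xs) 1 :: ('k, 'g) free_alg)"
          by (simp add: gen_def mult_single plus_free_monoid_def)
        moreover have "gen x \<in> FA" "Poly_Mapping.single (Word xs) 1 \<in> FA"
          using Cons.prems by (simp_all add: free_algebra_gen free_algebra_single)
        ultimately show ?case
          using Cons Y(2)[of x "pt (Poly_Mapping.single (Word xs) 1) n"]
          by (simp add: act_Ind lmul_props)
      qed
      then have "c \<odot>\<^bsub>Ind\<^esub> pt (Poly_Mapping.single w 1) n \<in> Y" using single I.lin_subsetD(5)[OF Y(1)] w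
        by simp
      moreover have "scalar c \<in> FA" "Poly_Mapping.single w 1 \<in> FA"
        by (rule free_algebra_scalar, rule free_algebra_single[OF single])
      ultimately show ?case by (simp add: smult_Ind lmul_props scalar_simps)
    next
      case (add p q)
      then show ?case using n I.lin_subsetD(4)[OF Y(1)] by (simp add: pt_add_left)
    qed
  qed (use I.lin_subsetD[OF Y(1)] in \<open>auto simp: a_minus_def\<close>)
qed

text \<open>The uniqueness half of the universal property: the elements on which \<open>f\<close>
  and \<open>g\<close> agree form a submodule that contains all \<open>\<eta> n\<close>.\<close>

theorem hom_eqI:
  assumes M: "lie_module L M" and f: "lin_hom L Ind M f" and g: "lin_hom L Ind M g"
    and eq: "\<And>n. n \<in> carrier N \<Longrightarrow> f (\<eta> n) = g (\<eta> n)" and t: "t \<in> carrier Ind"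
  shows "f t = g t"
proof -
  interpret M: lie_module L M by fact
  have "carrier Ind \<subseteq> {t \<in> carrier Ind. f t = g t}"
    by (rule generated)
       (use eq in \<open>auto intro!: I.lin_subsetI
         simp: eta_closed lin_homD[OF f] lin_homD[OF g] I.act_closed
         additive_minus(1)[OF abelian_group_Ind M.M.abelian_group_axioms]\<close>)
  then show ?thesis using t by auto
qed

text \<open>The existence half (Frobenius reciprocity): the pairing sending \<open>(u, n)\<close> to
  \<open>u\<close> applied to \<open>\<phi> n\<close> is biadditive, and it is balanced because
  \<open>\<phi>\<close> commutes with the enveloping algebra of the subalgebra.\<close>

theorem universal:
  assumes M: "lie_module L M" and \<phi>: "lin_hom P N M \<phi>"
  shows "\<exists>f. lin_hom L Ind M f \<and> (\<forall>n\<in>carrier N. f (\<eta> n) = \<phi> n)"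
proof -
  interpret M: lie_module L M by fact
  note \<phi>D = lin_homD[OF \<phi>]
  have "M.lin_subset (carrier M)" by (rule M.lin_subsetI) auto
  then have M_P: "lie_module P M"
    using M.lie_module_restrict[OF N.L.lie_algebra_axioms C, of "carrier M"] C
      by (auto simp: M.act_closed subset_iff)
  have \<phi>_free: "\<phi> (free_act N q n) = free_act M q (\<phi> n)" if "q \<in> FC" "n \<in> carrier N" for q n
    using lin_hom_free_act[OF N.lie_module_axioms M_P \<phi>, of q n] that by simp
  define f where "f u n = env_act M u (\<phi> n)" for u n
  have f: "f (env_class L p) n = free_act M p (\<phi> n)" if "p \<in> FA" "n \<in> carrier N" for p n
    using that \<phi>D by (simp add: f_def M.env_act_class)
  have "\<exists>F. (\<forall>t\<in>carrier B.TP. F t \<in> carrier M) \<and>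
     (\<forall>t\<in>carrier B.TP. \<forall>t'\<in>carrier B.TP. F (t \<otimes>\<^bsub>B.TP\<^esub> t') = F t \<oplus>\<^bsub>M\<^esub> F t') \<and>
     (\<forall>a\<in>carrier U. \<forall>b\<in>carrier N. F (B.pure a b) = f a b)"
  proof (rule B.TP_universal[OF M.M.abelian_group_axioms])
    fix a b assume a: "a \<in> carrier U" and b: "b \<in> carrier N"
    obtain p where p: "p \<in> FA" "a = env_class L p" using env_class_surj[OF a] by blast
    show "f a b \<in> carrier M" using p b \<phi>D by (simp add: f M.free_act_closed)
    show "f (a \<oplus>\<^bsub>U\<^esub> a') b = f a b \<oplus>\<^bsub>M\<^esub> f a' b" if a': "a' \<in> carrier U" for a'
    proof -
      obtain p' where p': "p' \<in> FA" "a' = env_class L p'" using env_class_surj[OF a'] by blast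
      have "a \<oplus>\<^bsub>U\<^esub> a' = env_class L (p + p')" using p p' by (simp add: env_class_add)
      then show ?thesis using p p' b \<phi>D by (simp add: f M.free_act_add free_algebra_closed)
    qed
    show "f a (b \<oplus>\<^bsub>N\<^esub> b') = f a b \<oplus>\<^bsub>M\<^esub> f a b'" if b': "b' \<in> carrier N" for b'
      using p b b' \<phi>D by (simp add: f M.endoD[OF M.endo_free_act])
    show "f (a \<otimes>\<^bsub>U\<^esub> env_inclusion L r) b = f a (env_act N r b)"
      if r: "r \<in> carrier (enveloping_algebra P)" for r
    proof -
      obtain q where q: "q \<in> FC" "r = env_class P q" using P_surj[OF r] by blast
      have "a \<otimes>\<^bsub>U\<^esub> env_inclusion L r = env_class L (p * q)"
        using p q FC by (simp add: env_inclusion env_class_mult)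
      then show ?thesis using p q b \<phi>D FC N.free_act_closed[of q b]
        by (simp add: f P_act \<phi>_free M.free_act_mult free_algebra_closed)
    qed
  qed
  then obtain F where F0: "\<forall>t\<in>carrier B.TP. F t \<in> carrier M"
     "\<forall>t\<in>carrier B.TP. \<forall>t'\<in>carrier B.TP. F (t \<otimes>\<^bsub>B.TP\<^esub> t') = F t \<oplus>\<^bsub>M\<^esub> F t'"
     "\<forall>a\<in>carrier U. \<forall>b\<in>carrier N. F (B.pure a b) = f a b" by blast
  have F: "\<And>t. t \<in> carrier Ind \<Longrightarrow> F t \<in> carrier M"
     "\<And>t t'. t \<in> carrier Ind \<Longrightarrow> t' \<in> carrier Ind \<Longrightarrow> F (t \<oplus>\<^bsub>Ind\<^esub> t') = F t \<oplus>\<^bsub>M\<^esub> F t'"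
     "\<And>p n. p \<in> FA \<Longrightarrow> n \<in> carrier N \<Longrightarrow> F (pt p n) = free_act M p (\<phi> n)"
    using F0 by (simp_all add: Ind_simps pt_def f env_class_closed)
  have F_lmul: "F (lmul p t) = free_act M p (F t)" if p: "p \<in> FA" and t: "t \<in> carrier Ind" for p t
    by (rule additive_eqI[OF t M.M.abelian_group_axioms])
       (use p F \<phi>D in \<open>auto
         simp: lmul_props M.free_act_closed M.endoD[OF M.endo_free_act] M.free_act_mult
          free_algebra_closed\<close>)
  show ?thesis
  proof (intro exI[of _ F] conjI ballI)
    show "lin_hom L Ind M F"
      unfolding lin_hom_def
      by (auto simp: F act_Ind smult_Ind F_lmul free_algebra_closed M.free_act_gen M.free_act_scalar)
    fix n assume "n \<in> carrier N"
    then show "F (\<eta> n) = \<phi> n" using \<phi>D by (simp add: \<eta>_def F(3)[OF free_algebra_one] M.free_act_one)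
  qed
qed

end

locale induced_map = S: induced L C N + T: induced L C N'
  for L :: "('k::field, 'g) lie_alg" and C and N :: "('k, 'g, 'n) lie_mod"
    and N' :: "('k, 'g, 'n1) lie_mod" +
  fixes f
  assumes f: "lin_hom (L\<lparr>carrier := C\<rparr>) N N' f"
begin

abbreviation "Imap \<equiv> tensor_map (induced_subgroup L (L\<lparr>carrier := C\<rparr>) N') (\<lambda>a. a) f"

text \<open>Balancing holds because \<open>f\<close> is linear over the subalgebra. Left
  multiplication touches only the first tensor factor and the map only the second, so the two
  commute.\<close>

lemma Imap_props: "lin_hom L S.Ind T.Ind Imap" "n \<in> carrier N \<Longrightarrow> Imap (S.\<eta> n) = T.\<eta> (f n)"
proof -
  note fD = lin_homD[OF f]
  have f_free: "f (free_act N q n) = free_act N' q (f n)" if "q \<in> S.FC" "n \<in> carrier N" for q n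
    using lin_hom_free_act[OF S.N.lie_module_axioms T.N.lie_module_axioms f, of q n] that by simp
  interpret BM: balanced_map "carrier (enveloping_algebra S.P)" S.U "\<lambda>a r. a \<otimes>\<^bsub>S.U\<^esub> env_inclusion L r"
    N "env_act N"
    "carrier (enveloping_algebra S.P)" S.U "\<lambda>a r. a \<otimes>\<^bsub>S.U\<^esub> env_inclusion L r" N' "env_act N'" "\<lambda>a. a" f
  proof unfold_locales
    fix a r b assume a: "a \<in> carrier S.U" and r: "r \<in> carrier (enveloping_algebra S.P)"
      and b: "b \<in> carrier N"
    obtain q where q: "q \<in> S.FC" "r = env_class S.P q" using S.P_surj[OF r] by blast
    show "T.B.pure (a \<otimes>\<^bsub>S.U\<^esub> env_inclusion L r) (f b) = T.B.pure a (f (env_act N r b))"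
      using T.B.pure_balanced[OF a r fD(1)[OF b]] q b fD(1)[OF b] by (simp add: S.P_act T.P_act f_free)
  qed (use fD in auto)
  have eq: "Imap = tensor_map T.B.relsub (\<lambda>a. a) f" by (simp add: induced_subgroup_def)
  have cl: "t \<in> carrier S.Ind \<Longrightarrow> Imap t \<in> carrier T.Ind"
    and add: "s \<in> carrier S.Ind \<Longrightarrow> t \<in> carrier S.Ind \<Longrightarrow> Imap (s \<oplus>\<^bsub>S.Ind\<^esub> t) = Imap s \<oplus>\<^bsub>T.Ind\<^esub> Imap t"
    and pt: "Imap (S.pt p n) = T.pt p (f n)" for s t p n
    using BM.tensor_map_closed BM.tensor_map_mult BM.tensor_map_pure
    by (simp_all add: eq S.Ind_simps T.Ind_simps S.pt_def T.pt_def)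
  have lm: "Imap (S.lmul p t) = T.lmul p (Imap t)" if p: "p \<in> S.FA" and t: "t \<in> carrier S.Ind" for p t
    by (rule S.additive_eqI[OF t T.abelian_group_Ind])
       (use p in \<open>auto simp: cl add pt S.lmul_props T.lmul_props\<close>)
  show "lin_hom L S.Ind T.Ind Imap"
    unfolding lin_hom_def
    by (auto simp: cl add lm S.act_Ind S.smult_Ind T.act_Ind T.smult_Ind free_algebra_closed)
  show "n \<in> carrier N \<Longrightarrow> Imap (S.\<eta> n) = T.\<eta> (f n)" by (simp add: S.\<eta>_def T.\<eta>_def pt)
qed

end

section \<open>Modules over the Heisenberg algebra\<close>

context lin_space
begin

lemma endo_finsum:
  assumes "endo T" "finite A" "\<And>a. a \<in> A \<Longrightarrow> f a \<in> carrier M"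
  shows "T (\<Oplus>a\<in>A. f a) = (\<Oplus>a\<in>A. T (f a))"
  using assms(2,3) by (induction A rule: finite_induct) (auto simp: endoD[OF assms(1)] Pi_def)

lemma finsum_scal:
  assumes "finite A" "m \<in> carrier M"
  shows "(\<Oplus>a\<in>A. c a \<cdot> m) = (\<Sum>a\<in>A. c a) \<cdot> m"
  using assms by (induction A rule: finite_induct) (auto simp: scal_add_left Pi_def)

lemma endo_finsumI:
  assumes "\<And>a. a \<in> A \<Longrightarrow> endo (f a)" "finite A"
  shows "endo (\<lambda>m. \<Oplus>a\<in>A. f a m)"
  using assms(2,1)
proof (induction A rule: finite_induct)
  case (insert x F)
  then have "\<And>m. m \<in> carrier M \<Longrightarrow> (\<Oplus>a\<in>insert x F. f a m) = f x m \<oplus> (\<Oplus>a\<in>F. f a m)"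
    by (subst M.finsum_insert) (auto simp: endoD)
  with insert show ?case unfolding endo_def by (auto simp: scal_add_right M.a_ac)
qed (auto simp: endo_def)

end

locale darboux = symplectic_space scale \<omega>
  for scale :: "'k::field_char_0 \<Rightarrow> 'w::ab_group_add \<Rightarrow> 'w" and \<omega> +
  fixes l :: "'w set" and B :: "'w set" and q :: "'w \<Rightarrow> 'w"
  assumes lagr: "lagrangian scale \<omega> l" and fin_B: "finite B" and B_l: "B \<subseteq> l"
    and bq: "b \<in> B \<Longrightarrow> b' \<in> B \<Longrightarrow> \<omega> b (q b') = (if b = b' then 1 else 0)"
    and qq: "b \<in> B \<Longrightarrow> b' \<in> B \<Longrightarrow> \<omega> (q b) (q b') = 0"
    and expand: "w = (\<Sum>b\<in>B. scale (\<omega> w (q b)) b + scale (\<omega> b w) (q b))"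
begin

abbreviation "H \<equiv> heisenberg scale \<omega>"

lemma H_simps [simp]:
  "carrier H = UNIV" "(v, c) \<oplus>\<^bsub>H\<^esub> (w, d) = (v + w, c + d)" "a \<odot>\<^bsub>H\<^esub> (v, c) = (scale a v, a * c)"
  "bracket H (v, c) (w, d) = (0, \<omega> v w)" "\<zero>\<^bsub>H\<^esub> = (0, 0)"
  by (simp_all add: heisenberg_def)

sublocale HL: lie_algebra H by (rule lie_algebra_heis(1)) unfold_locales

lemma l_props: "subspace l" "v \<in> l \<Longrightarrow> w \<in> l \<Longrightarrow> \<omega> v w = 0"
  using lagr by (auto simp: lagrangian_def isotropic_def)

lemma form_B_B: "b \<in> B \<Longrightarrow> b' \<in> B \<Longrightarrow> \<omega> b b' = 0"
  using l_props B_l by auto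

text \<open>The formula for the action is forced by the Darboux expansion of \<open>w\<close>. The
  substance is the bracket rule, obtained by commuting first one basis operator and then a whole sum
  past \<open>S w\<close>.\<close>

theorem lie_module_of_ops:
  fixes M :: "('k, 'w \<times> 'k, 'm) lie_mod"
  assumes ops: "heis_ops M B P Q Z"
    and act: "\<And>w c m. act M (w, c) m =
      (\<Oplus>\<^bsub>M\<^esub>b\<in>B. \<omega> w (q b) \<odot>\<^bsub>M\<^esub> P b m \<oplus>\<^bsub>M\<^esub> \<omega> b w \<odot>\<^bsub>M\<^esub> Q b m) \<oplus>\<^bsub>M\<^esub> c \<odot>\<^bsub>M\<^esub> Z m"
  shows "lie_module H M"
proof -
  interpret heis_ops M B P Q Z by (rule ops)
  let ?s = "\<lambda>w b m. \<omega> w (q b) \<odot>\<^bsub>M\<^esub> P b m \<oplus>\<^bsub>M\<^esub> \<omega> b w \<odot>\<^bsub>M\<^esub> Q b m"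
  define S where "S w m = (\<Oplus>\<^bsub>M\<^esub>b\<in>B. ?s w b m)" for w m
  note Pe = endoD[OF endo_P] and Qe = endoD[OF endo_Q] and Ze = endoD[OF endo_Z]
  have s_endo: "endo (?s w b)" if "b \<in> B" for w b
    unfolding endo_def using that Pe[OF that] Qe[OF that]
    by (auto simp: scal_add_right M.a_ac mult.commute simp flip: scal_mult)
  have S_endo: "endo (S w)" for w
    unfolding S_def by (rule endo_finsumI[OF s_endo fin_B])
  note Se = endoD[OF S_endo]
  have s_closed: "?s w b m \<in> carrier M" if "b \<in> B" "m \<in> carrier M" for w b m
    using that Pe Qe by auto
  have S_add: "S (v + w) m = S v m \<oplus>\<^bsub>M\<^esub> S w m" if m: "m \<in> carrier M" for v w m
  proof -
    have "S (v + w) m = (\<Oplus>\<^bsub>M\<^esub>b\<in>B. ?s v b m \<oplus>\<^bsub>M\<^esub> ?s w b m)"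
      unfolding S_def by (rule M.finsum_cong') (use m Pe Qe in \<open>auto simp: scal_add_left M.a_ac\<close>)
    also have "\<dots> = S v m \<oplus>\<^bsub>M\<^esub> S w m"
      unfolding S_def by (rule M.finsum_addf) (use m Pe Qe in auto)
    finally show ?thesis .
  qed
  have S_scale: "S (scale c w) m = c \<odot>\<^bsub>M\<^esub> S w m" if m: "m \<in> carrier M" for c w m
  proof -
    have "endo (\<lambda>m. c \<odot>\<^bsub>M\<^esub> m)" by (auto simp: endo_def scal_add_right mult.commute simp flip: scal_mult)
    then have "c \<odot>\<^bsub>M\<^esub> S w m = (\<Oplus>\<^bsub>M\<^esub>b\<in>B. c \<odot>\<^bsub>M\<^esub> ?s w b m)"
      unfolding S_def by (rule endo_finsum[OF _ fin_B]) (use m s_closed in auto)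
    also have "\<dots> = S (scale c w) m"
      unfolding S_def by (rule M.finsum_cong') (use m Pe Qe in \<open>auto simp: scal_add_right scal_mult\<close>)
    finally show ?thesis by simp
  qed
  have delta: "(\<Oplus>\<^bsub>M\<^esub>b'\<in>B. if b = b' then c b' \<odot>\<^bsub>M\<^esub> m else \<zero>\<^bsub>M\<^esub>) = c b \<odot>\<^bsub>M\<^esub> m" if "b \<in> B"
    "m \<in> carrier M" for b c m
    using that fin_B M.finsum_singleton[of b B "\<lambda>b. c b \<odot>\<^bsub>M\<^esub> m"] by simp
  have PS: "P b (S w m) = S w (P b m) \<oplus>\<^bsub>M\<^esub> \<omega> b w \<odot>\<^bsub>M\<^esub> Z m"
    if b: "b \<in> B" and m: "m \<in> carrier M" for b w m
  proof -
    have "P b (S w m) = (\<Oplus>\<^bsub>M\<^esub>b'\<in>B. P b (?s w b' m))"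
      unfolding S_def by (rule endo_finsum[OF endo_P[OF b] fin_B]) (use m s_closed in auto)
    also have "\<dots> = (\<Oplus>\<^bsub>M\<^esub>b'\<in>B. ?s w b' (P b m) \<oplus>\<^bsub>M\<^esub> (if b = b' then \<omega> b' w \<odot>\<^bsub>M\<^esub> Z m else \<zero>\<^bsub>M\<^esub>))"
      by (rule M.finsum_cong') (use b m in \<open>auto simp: Pe Qe Ze PQ PP[of b] scal_add_right M.a_ac\<close>)
    also have "\<dots> = S w (P b m) \<oplus>\<^bsub>M\<^esub> (\<Oplus>\<^bsub>M\<^esub>b'\<in>B. if b = b' then \<omega> b' w \<odot>\<^bsub>M\<^esub> Z m else \<zero>\<^bsub>M\<^esub>)"
      unfolding S_def by (rule M.finsum_addf) (use b m Pe Qe Ze in auto)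
    finally show ?thesis using delta[OF b, of "Z m" "\<lambda>b. \<omega> b w"] Ze m by simp
  qed
  have SQ: "S w (Q b m) = Q b (S w m) \<oplus>\<^bsub>M\<^esub> \<omega> w (q b) \<odot>\<^bsub>M\<^esub> Z m"
    if b: "b \<in> B" and m: "m \<in> carrier M" for b w m
  proof -
    have "S w (Q b m) = (\<Oplus>\<^bsub>M\<^esub>b'\<in>B. Q b (?s w b' m) \<oplus>\<^bsub>M\<^esub> (if b = b' then \<omega> w (q b') \<odot>\<^bsub>M\<^esub> Z m else \<zero>\<^bsub>M\<^esub>))"
      unfolding S_def by (rule M.finsum_cong') (use b m in \<open>auto
        simp: Pe Qe Ze PQ QQ[of b] scal_add_right M.a_ac\<close>)
    also have "\<dots> = (\<Oplus>\<^bsub>M\<^esub>b'\<in>B. Q b (?s w b' m)) \<oplus>\<^bsub>M\<^esub> (\<Oplus>\<^bsub>M\<^esub>b'\<in>B.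
      if b = b' then \<omega> w (q b') \<odot>\<^bsub>M\<^esub> Z m else \<zero>\<^bsub>M\<^esub>)"
      by (rule M.finsum_addf) (use b m Pe Qe Ze in auto)
    also have "(\<Oplus>\<^bsub>M\<^esub>b'\<in>B. Q b (?s w b' m)) = Q b (S w m)"
      unfolding S_def by (rule endo_finsum[OF endo_Q[OF b] fin_B, symmetric]) (use m s_closed in auto)
    finally show ?thesis using delta[OF b, of "Z m" "\<lambda>b. \<omega> w (q b)"] Ze m by simp
  qed
  have QS: "Q b (S w m) = S w (Q b m) \<oplus>\<^bsub>M\<^esub> \<omega> (q b) w \<odot>\<^bsub>M\<^esub> Z m"
    if b: "b \<in> B" and m: "m \<in> carrier M" for b w m
    using SQ[OF that, of w] that Se Qe Ze form_swap[of "q b" w] scal_add_left[of "Z m" "\<omega> w (q b)"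
      "\<omega> (q b) w"]
    by (simp add: M.a_assoc)
  have SS: "S v (S w m) = S w (S v m) \<oplus>\<^bsub>M\<^esub> \<omega> v w \<odot>\<^bsub>M\<^esub> Z m" if m: "m \<in> carrier M" for v w m
  proof -
    have "S v (S w m) = (\<Oplus>\<^bsub>M\<^esub>b\<in>B. S w (?s v b m) \<oplus>\<^bsub>M\<^esub> (\<omega> v (q b) * \<omega> b w + \<omega> b v * \<omega> (q b) w) \<odot>\<^bsub>M\<^esub> Z m)"
      unfolding S_def[of v]
      by (rule M.finsum_cong') (use m in \<open>auto
        simp: Se Pe Qe Ze PS QS scal_add_right scal_add_left scal_mult M.a_ac\<close>)
    also have "\<dots> = (\<Oplus>\<^bsub>M\<^esub>b\<in>B. S w (?s v b m)) \<oplus>\<^bsub>M\<^esub> (\<Oplus>\<^bsub>M\<^esub>b\<in>B. (\<omega> v (q b) * \<omega> b w + \<omega> b v * \<omega> (q b) w) \<odot>\<^bsub>M\<^esub> Z m)"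
      by (rule M.finsum_addf) (use m Se Pe Qe Ze in auto)
    also have "(\<Oplus>\<^bsub>M\<^esub>b\<in>B. S w (?s v b m)) = S w (S v m)"
      unfolding S_def[of v] by (rule endo_finsum[OF S_endo fin_B, symmetric]) (use m s_closed in auto)
    also have "(\<Oplus>\<^bsub>M\<^esub>b\<in>B. (\<omega> v (q b) * \<omega> b w + \<omega> b v * \<omega> (q b) w) \<odot>\<^bsub>M\<^esub> Z m) = 
      (\<Sum>b\<in>B. \<omega> v (q b) * \<omega> b w + \<omega> b v * \<omega> (q b) w) \<odot>\<^bsub>M\<^esub> Z m"
      by (rule finsum_scal[OF fin_B]) (use m Ze in auto)
    \<comment> \<open>This is the Darboux expansion of \<open>v\<close>, paired with
      \<open>w\<close>.\<close>
    also have "(\<Sum>b\<in>B. \<omega> v (q b) * \<omega> b w + \<omega> b v * \<omega> (q b) w) = \<omega> v w"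
      by (subst (3) expand[of v]) simp
    finally show ?thesis .
  qed
  have SZ: "S w (Z m) = Z (S w m)" if m: "m \<in> carrier M" for w m
  proof -
    have "Z (S w m) = (\<Oplus>\<^bsub>M\<^esub>b\<in>B. Z (?s w b m))"
      unfolding S_def by (rule endo_finsum[OF endo_Z fin_B]) (use m s_closed in auto)
    also have "\<dots> = S w (Z m)"
      unfolding S_def by (rule M.finsum_cong') (use m in \<open>auto simp: Pe Qe Ze PZ QZ\<close>)
    finally show ?thesis by simp
  qed
  have act': "act M (w, c) m = S w m \<oplus>\<^bsub>M\<^esub> c \<odot>\<^bsub>M\<^esub> Z m" for w c m by (simp add: act S_def)
  have S0: "S 0 m = \<zero>\<^bsub>M\<^esub>" if "m \<in> carrier M" for m using S_scale[OF that, of 0 0] Se that by simp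
  have "lie_module_axioms H M"
  proof (rule lie_module_axioms.intro)
    fix x y :: "'w \<times> 'k" and c m n
    assume m: "m \<in> carrier M"
    obtain v a where x: "x = (v, a)" by (cases x)
    obtain w b where y: "y = (w, b)" by (cases y)
    show "act M x m \<in> carrier M" unfolding x act' using m Se Ze by simp
    show "act M (x \<oplus>\<^bsub>H\<^esub> y) m = act M x m \<oplus>\<^bsub>M\<^esub> act M y m"
      unfolding x y H_simps act' using m Se Ze by (simp add: S_add scal_add_left M.a_ac)
    show "act M (c \<odot>\<^bsub>H\<^esub> x) m = c \<odot>\<^bsub>M\<^esub> act M x m"
      unfolding x y H_simps act' using m Se Ze by (simp add: S_scale scal_add_right scal_mult)
    show "act M x (m \<oplus>\<^bsub>M\<^esub> n) = act M x m \<oplus>\<^bsub>M\<^esub> act M x n" if "n \<in> carrier M"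
      unfolding x y H_simps act' using m that Se Ze by (simp add: scal_add_right M.a_ac)
    show "act M x (c \<odot>\<^bsub>M\<^esub> m) = c \<odot>\<^bsub>M\<^esub> act M x m"
      unfolding x y H_simps act' using m Se Ze
        by (simp add: scal_add_right mult.commute flip: scal_mult)
    have cl: "S u k \<in> carrier M" "Z k \<in> carrier M" if "k \<in> carrier M" for u k using that Se Ze by auto
    have "act M x (act M y m) = act M (bracket H x y) m \<oplus>\<^bsub>M\<^esub> act M y (act M x m)"
      unfolding x y H_simps act'
      using m by (simp add: Se Ze S0 SZ SS[of _ v w] scal_add_right M.a_ac mult.commute flip: scal_mult)
    moreover have "act M (bracket H x y) m \<in> carrier M" "act M y (act M x m) \<in> carrier M"
      unfolding x y H_simps act' using m Se Ze by simp_all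
    ultimately show "act M (bracket H x y) m = act M x (act M y m) \<ominus>\<^bsub>M\<^esub> act M y (act M x m)"
      by (simp add: M.minus_eq M.a_assoc M.r_neg)
  qed
  then show ?thesis using HL.lie_algebra_axioms lin_space_axioms
    by (simp add: lie_module_def lin_space_def)
qed

end

section \<open>Invariants and generation in a Heisenberg module\<close>

locale heis_module = darboux scale \<omega> l B q + V: lie_module "heisenberg scale \<omega>" M
  for scale :: "'k::field_char_0 \<Rightarrow> 'w::ab_group_add \<Rightarrow> 'w"
    and \<omega> l B q and M :: "('k, 'w \<times> 'k, 'm) lie_mod"
begin

abbreviation "Pop b \<equiv> act M (b, 0)"
abbreviation "Qop b \<equiv> act M (q b, 0)"
abbreviation "Zop \<equiv> act M z_elem"
abbreviation "Inv \<equiv> invariants (l \<times> {0}) M"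

lemma endo: "V.endo (act M x)"
  by (rule V.endo_act) simp

lemmas act_simps = V.endoD[OF endo]

lemma act_add_arg: "m \<in> carrier M \<Longrightarrow> act M (v + w, c + d) m = act M (v, c) m \<oplus>\<^bsub>M\<^esub> act M (w, d) m"
  using V.act_add_left[of "(v, c)" "(w, d)" m] by simp

lemma act_scale_arg: "m \<in> carrier M \<Longrightarrow> act M (scale a v, a * c) m = a \<odot>\<^bsub>M\<^esub> act M (v, c) m"
  using V.act_smult_left[of "(v, c)" m a] by simp

lemma act_zero_arg: "m \<in> carrier M \<Longrightarrow> act M (0, 0) m = \<zero>\<^bsub>M\<^esub>"
  using act_scale_arg[of m 0 0 0] act_simps(1) by simp

lemma act_center: "m \<in> carrier M \<Longrightarrow> act M (0, c) m = c \<odot>\<^bsub>M\<^esub> Zop m"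
  using act_scale_arg[of m c 0 1] by (simp add: z_elem_def)

lemma act_comm:
  assumes "m \<in> carrier M"
  shows "act M (v, c) (act M (w, d) m) = act M (w, d) (act M (v, c) m) \<oplus>\<^bsub>M\<^esub> \<omega> v w \<odot>\<^bsub>M\<^esub> Zop m"
proof -
  let ?a = "act M (v, c) (act M (w, d) m)" and ?b = "act M (w, d) (act M (v, c) m)"
  have cl: "?a \<in> carrier M" "?b \<in> carrier M" using assms by (simp_all add: act_simps)
  have s: "\<omega> v w \<odot>\<^bsub>M\<^esub> Zop m = ?a \<ominus>\<^bsub>M\<^esub> ?b"
    using V.act_bracket[of "(v, c)" "(w, d)" m] assms by (simp add: act_center)
  have "?b \<oplus>\<^bsub>M\<^esub> (?a \<oplus>\<^bsub>M\<^esub> \<ominus>\<^bsub>M\<^esub> ?b) = ?a \<oplus>\<^bsub>M\<^esub> (?b \<oplus>\<^bsub>M\<^esub> \<ominus>\<^bsub>M\<^esub> ?b)"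
    by (rule V.M.a_lcomm) (use cl in simp_all)
  then show ?thesis unfolding s V.M.minus_eq using cl by (simp add: V.M.r_neg)
qed

lemma act_zcomm: "m \<in> carrier M \<Longrightarrow> act M x (Zop m) = Zop (act M x m)"
  using act_comm[of m "fst x" "snd x" 0 1] by (simp add: z_elem_def act_simps)

text \<open>By the Darboux expansion every element of the Lie algebra is a linear combination of the
  \<open>b\<close>, the \<open>q b\<close> and \<open>z\<close>. Finitely many operators thus
  control stability, which the cardinality estimate also relies on.\<close>

lemma closed_under_gens:
  assumes A: "V.lin_subset A" "\<And>b m. b \<in> B \<Longrightarrow> m \<in> A \<Longrightarrow> Pop b m \<in> A" "\<And>b m. b \<in> B \<Longrightarrow> m \<in> A \<Longrightarrow> Qop b m \<in> A"
    "\<And>m. m \<in> A \<Longrightarrow> Zop m \<in> A" and m: "m \<in> A"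
  shows "act M x m \<in> A"
proof -
  note AD = V.lin_subsetD[OF A(1)]
  have sc: "act M (scale c v, 0) m \<in> A" if "act M (v, 0) m \<in> A" for c v
    using act_scale_arg[of m c v 0] AD(2)[OF m] AD(5)[OF that] by simp
  have ad: "act M (v + w, 0) m \<in> A" if "act M (v, 0) m \<in> A" "act M (w, 0) m \<in> A" for v w
    using act_add_arg[of m v w 0 0] AD(2)[OF m] AD(4)[OF that] by simp
  have "act M ((\<Sum>b\<in>S. scale (\<omega> w (q b)) b + scale (\<omega> b w) (q b)), 0) m \<in> A" if "finite S"
    "S \<subseteq> B" for w S
    using that
  proof (induction S rule: finite_induct)
    case empty
    then show ?case using AD(2)[OF m] AD(3) by (simp add: act_zero_arg)
  next
    case (insert b S)
    then show ?case using A m by (simp add: ad sc)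
  qed
  from this[OF fin_B subset_refl] have "act M (w, 0) m \<in> A" for w using expand[of w] by metis
  moreover have "act M (0, c) m \<in> A" for c using act_center[of m c] A(4)[OF m] AD(2)[OF m] AD(5) by simp
  ultimately show ?thesis using act_add_arg[of m "fst x" 0 0 "snd x"] AD(2)[OF m] AD(4) by simp
qed

lemma lin_subset_Inv: "V.lin_subset Inv"
  by (rule V.lin_subsetI) (auto simp: invariants_def act_simps)

text \<open>Identifies the invariants with the vacuum of the abstract operators. For
  \<open>v\<close> in \<open>l\<close> the \<open>q\<close> part of the expansion vanishes, as
  \<open>\<omega> b v = 0\<close>, so the operators of \<open>B\<close> determine that of
  \<open>v\<close>.\<close>

lemma Inv_eq: "Inv = {m \<in> carrier M. \<forall>b\<in>B. Pop b m = \<zero>\<^bsub>M\<^esub>}"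
proof (intro equalityI subsetI)
  fix m assume m: "m \<in> {m \<in> carrier M. \<forall>b\<in>B. Pop b m = \<zero>\<^bsub>M\<^esub>}"
  have "act M (v, 0) m = \<zero>\<^bsub>M\<^esub>" if v: "v \<in> l" for v
  proof -
    have "act M ((\<Sum>b\<in>S. scale (\<omega> v (q b)) b), 0) m = \<zero>\<^bsub>M\<^esub>" if "finite S" "S \<subseteq> B" for S
      using that
    proof (induction S rule: finite_induct)
      case (insert b S)
      have "act M (scale c b, 0) m = \<zero>\<^bsub>M\<^esub>" for c using act_scale_arg[of m c b 0] m insert.prems by simp
      moreover have "act M (scale c b + w, 0) m = act M (scale c b, 0) m \<oplus>\<^bsub>M\<^esub> act M (w, 0) m" for c w
        using act_add_arg[of m "scale c b" w 0 0] m by simp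
      ultimately show ?case using insert by simp
    qed (use m act_zero_arg in auto)
    moreover have "v = (\<Sum>b\<in>B. scale (\<omega> v (q b)) b)"
      using expand[of v] l_props(2)[OF subsetD[OF B_l] v] by simp
    ultimately show ?thesis using fin_B by (metis order_refl)
  qed
  then show "m \<in> Inv" using m by (auto simp: invariants_def)
qed (use B_l in \<open>auto simp: invariants_def\<close>)

lemma heis_ops:
  assumes "acts_invertibly z_elem M"
  shows "heis_ops M B Pop Qop Zop"
proof unfold_locales
  show "finite B" by (rule fin_B)
  show "V.endo (act M x)" for x by (rule endo)
  show "V.endo (act M x)" for x by (rule endo)
  show "V.endo (act M x)" for x by (rule endo)
  fix i j m assume i: "i \<in> B" and m: "m \<in> carrier M"
  show "Pop i (Zop m) = Zop (Pop i m)" "Qop i (Zop m) = Zop (Qop i m)" using m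
    by (simp_all add: act_zcomm)
  assume j: "j \<in> B"
  show "Pop i (Qop j m) = (if i = j then Qop j (Pop i m) \<oplus>\<^bsub>M\<^esub> Zop m else Qop j (Pop i m))"
    using act_comm[OF m, of i 0 "q j" 0] i j m by (simp add: bq act_simps)
  show "Pop i (Pop j m) = Pop j (Pop i m)" using act_comm[OF m, of i 0 j 0] i j m
    by (simp add: form_B_B act_simps)
  show "Qop i (Qop j m) = Qop j (Qop i m)" using act_comm[OF m, of "q i" 0 "q j" 0] i j m
    by (simp add: qq act_simps)
qed (use assms in \<open>simp add: acts_invertibly_def\<close>)

lemma generated_by_Inv:
  assumes "acts_invertibly z_elem M" "locally_nilpotent (l \<times> {0}) M"
    and Y: "V.lin_subset Y" "\<And>x m. m \<in> Y \<Longrightarrow> act M x m \<in> Y" "Inv \<subseteq> Y"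
  shows "carrier M \<subseteq> Y"
proof -
  interpret O: heis_ops M B Pop Qop Zop by (rule heis_ops) fact
  show ?thesis
  proof (rule O.generated_by_vacuum[OF Y(1)])
    show "O.vacuum B \<subseteq> Y" using Y(3) by (simp add: O.vacuum_def Inv_eq)
    fix b m assume b: "b \<in> B" and "m \<in> carrier M"
    then obtain i where i: "\<And>xs. length xs = i \<Longrightarrow> set xs \<subseteq> l \<times> {0} \<Longrightarrow> foldr (act M) xs m = \<zero>\<^bsub>M\<^esub>"
      using assms(2) unfolding locally_nilpotent_def by blast
    \<comment> \<open>Only words all of whose letters equal \<open>b\<close> are needed from local
      nilpotency.\<close>
    have "foldr (act M) (replicate i (b, 0)) m = (Pop b ^^ i) m" by (induction i) auto
    moreover have "foldr (act M) (replicate i (b, 0)) m = \<zero>\<^bsub>M\<^esub>"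
      by (rule i) (use b B_l in auto)
    ultimately show "\<exists>n. (Pop b ^^ n) m = \<zero>\<^bsub>M\<^esub>" by metis
  qed (use Y(2) in auto)
qed

lemma Inv_of_generated:
  assumes "acts_invertibly z_elem M"
    and N: "V.lin_subset N" "N \<subseteq> Inv" "\<And>m. m \<in> N \<Longrightarrow> Zop m \<in> N"
    and gen: "\<And>Y. V.lin_subset Y \<Longrightarrow> (\<And>x m. m \<in> Y \<Longrightarrow> act M x m \<in> Y) \<Longrightarrow> N \<subseteq> Y \<Longrightarrow> carrier M \<subseteq> Y"
  shows "Inv = N"
proof -
  interpret O: heis_ops M B Pop Qop Zop by (rule heis_ops) fact
  have "O.vacuum B = N"
  proof (rule O.vacuum_of_generated)
    fix Y assume Y: "V.lin_subset Y" "N \<subseteq> Y" "\<And>m. m \<in> Y \<Longrightarrow> Zop m \<in> Y" "\<And>i m. i \<in> B \<Longrightarrow> m \<in> Y \<Longrightarrow> Pop i m \<in> Y"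
      "\<And>i m. i \<in> B \<Longrightarrow> m \<in> Y \<Longrightarrow> Qop i m \<in> Y"
    show "carrier M \<subseteq> Y" by (rule gen[OF Y(1) closed_under_gens Y(2)]) (use Y in auto)
  qed (use N in \<open>auto simp: O.vacuum_def Inv_eq\<close>)
  then show ?thesis by (simp add: O.vacuum_def Inv_eq)
qed

text \<open>Among the products from \<open>l\<close> that do not kill \<open>m\<close>, one of
  maximal length is taken: every further factor kills its value, which is therefore a nonzero
  invariant in \<open>Y\<close>.\<close>

lemma Inv_nonzero:
  assumes "locally_nilpotent (l \<times> {0}) M" "V.lin_subset Y" "\<And>x m. x \<in> l \<times> {0} \<Longrightarrow> m \<in> Y \<Longrightarrow> act M x m \<in> Y"
    and m: "m \<in> Y" "m \<noteq> \<zero>\<^bsub>M\<^esub>"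
  shows "\<exists>m\<in>Y. m \<in> Inv \<and> m \<noteq> \<zero>\<^bsub>M\<^esub>"
proof -
  let ?kill = "\<lambda>i. \<forall>xs. length xs = i \<and> set xs \<subseteq> l \<times> {0} \<longrightarrow> foldr (act M) xs m = \<zero>\<^bsub>M\<^esub>"
  have Yc: "n \<in> Y \<Longrightarrow> n \<in> carrier M" for n using V.lin_subsetD[OF assms(2)] by auto
  have "\<exists>i. ?kill i" using assms(1) Yc[OF m(1)] by (auto simp: locally_nilpotent_def)
  then obtain i where i: "?kill i" "\<And>j. j < i \<Longrightarrow> \<not> ?kill j" using exists_least_iff[of ?kill] by auto
  have "i \<noteq> 0" using i(1) m by auto
  then obtain j where j: "i = Suc j" by (cases i) auto
  then obtain xs where xs: "length xs = j" "set xs \<subseteq> l \<times> {0}" "foldr (act M) xs m \<noteq> \<zero>\<^bsub>M\<^esub>"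
    using i(2)[of j] by auto
  have "foldr (act M) xs m \<in> Y" using xs(2) by (induction xs) (use m assms(3) in auto)
  moreover have "act M x (foldr (act M) xs m) = \<zero>\<^bsub>M\<^esub>" if "x \<in> l \<times> {0}" for x
    using i(1)[rule_format, of "x # xs"] xs that by (auto simp: j)
  ultimately show ?thesis using xs(3) Yc by (auto simp: invariants_def)
qed

text \<open>The vectors killed by all products from \<open>l\<close> of some fixed length form a
  submodule: commutators with \<open>l\<close> are central, so acting by any \<open>y\<close> raises
  the required length by at most one.\<close>

lemma locally_nilpotent_of_generated:
  assumes gen: "\<And>Y. V.lin_subset Y \<Longrightarrow> (\<And>x m. m \<in> Y \<Longrightarrow> act M x m \<in> Y) \<Longrightarrow> Inv \<subseteq> Y \<Longrightarrow> carrier M \<subseteq> Y"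
  shows "locally_nilpotent (l \<times> {0}) M"
proof -
  define kill where "kill i m \<longleftrightarrow> (\<forall>xs. length xs = i \<and> set xs \<subseteq> l \<times> {0} \<longrightarrow> V.word_act xs m
    = \<zero>\<^bsub>M\<^esub>)" for i m
  have we: "V.endo (V.word_act xs)" for xs by (rule V.endo_word_act) simp
  note wD = V.endoD[OF we]
  have mono: "kill (i + k) m" if "kill i m" "m \<in> carrier M" for i k m
    unfolding kill_def
  proof (intro allI impI)
    fix xs :: "('w \<times> 'k) list" assume xs: "length xs = i + k \<and> set xs \<subseteq> l \<times> {0}"
    \<comment> \<open>The end of a word acts first, so the last \<open>i\<close> letters already
      annihilate \<open>m\<close>.\<close>
    have "V.word_act xs m = V.word_act (take k xs) (V.word_act (drop k xs) m)"
      by (metis append_take_drop_id foldr_append comp_apply)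
    also have "V.word_act (drop k xs) m = \<zero>\<^bsub>M\<^esub>"
      using that(1)[unfolded kill_def, rule_format, of "drop k xs"] xs set_drop_subset[of k xs] by auto
    finally show "V.word_act xs m = \<zero>\<^bsub>M\<^esub>" by (simp add: wD)
  qed
  \<comment> \<open>The letter \<open>x\<close> that acts first is moved past \<open>y\<close>. Then
    \<open>x m\<close> needs one letter less and falls under the induction hypothesis, while the
    commutator is a multiple of \<open>z m\<close>, killed by the remaining \<open>Suc i\<close>
    letters since \<open>z\<close> commutes with them.\<close>
  have step: "kill (Suc i) (act M y m)" if "m \<in> carrier M" "kill i m" for i m y
    using that
  proof (induction i arbitrary: m)
    case 0
    then have "m = \<zero>\<^bsub>M\<^esub>" by (auto simp: kill_def)
    then show ?case by (simp add: kill_def act_simps wD)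
  next
    case (Suc i)
    show ?case unfolding kill_def
    proof (intro allI impI)
      fix xs :: "('w \<times> 'k) list" assume xs: "length xs = Suc (Suc i) \<and> set xs \<subseteq> l \<times> {0}"
      then obtain ys x where x: "xs = ys @ [x]" by (metis length_Suc_conv_rev)
      obtain v c where v: "x = (v, c)" by (cases x)
      obtain w d where y: "y = (w, d)" by (cases y)
      have ys: "length ys = Suc i" "set ys \<subseteq> l \<times> {0}" "x \<in> l \<times> {0}" using xs x by auto
      have "kill i (act M x m)" unfolding kill_def
      proof (intro allI impI)
        fix zs :: "('w \<times> 'k) list" assume "length zs = i \<and> set zs \<subseteq> l \<times> {0}"
        then show "V.word_act zs (act M x m) = \<zero>\<^bsub>M\<^esub>"
          using Suc.prems(2)[unfolded kill_def, rule_format, of "zs @ [x]"] ys by simp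
      qed
      then have "kill (Suc i) (act M y (act M x m))" using Suc.IH[of "act M x m"] Suc.prems act_simps
        by simp
      then have 1: "V.word_act ys (act M y (act M x m)) = \<zero>\<^bsub>M\<^esub>" using ys by (simp add: kill_def)
      have "V.word_act zs (Zop m) = Zop (V.word_act zs m)" for zs
        using Suc.prems by (induction zs) (auto simp: act_zcomm wD)
      then have 2: "V.word_act ys (Zop m) = \<zero>\<^bsub>M\<^esub>" using Suc.prems(2) ys
        by (simp add: kill_def act_simps)
      have "V.word_act xs (act M y m) = V.word_act ys (act M y (act M x m) \<oplus>\<^bsub>M\<^esub> \<omega> v w \<odot>\<^bsub>M\<^esub> Zop m)"
        using Suc.prems by (simp add: x v y act_comm[of m v c w d])
      also have "\<dots> = \<zero>\<^bsub>M\<^esub>" using Suc.prems 1 2 by (simp add: wD act_simps)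
      finally show "V.word_act xs (act M y m) = \<zero>\<^bsub>M\<^esub>" .
    qed
  qed
  let ?Y = "{m \<in> carrier M. \<exists>i. kill i m}"
  have "carrier M \<subseteq> ?Y"
  proof (rule gen)
    show "V.lin_subset ?Y"
    proof (rule V.lin_subsetI)
      fix m n assume "m \<in> ?Y" "n \<in> ?Y"
      then obtain i j where "kill i m" "kill j n" "m \<in> carrier M" "n \<in> carrier M" by auto
      then have "kill (i + j) m" "kill (i + j) n" using mono[of i m j] mono[of j n i]
        by (simp_all add: add.commute)
      then have "kill (i + j) (m \<oplus>\<^bsub>M\<^esub> n)" using \<open>m \<in> carrier M\<close> \<open>n \<in> carrier M\<close>
        by (simp add: kill_def wD)
      then show "m \<oplus>\<^bsub>M\<^esub> n \<in> ?Y" using \<open>m \<in> carrier M\<close> \<open>n \<in> carrier M\<close> by auto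
    next
      fix c m assume "m \<in> ?Y"
      then obtain i where "kill i m" "m \<in> carrier M" by auto
      then have "kill i (c \<odot>\<^bsub>M\<^esub> m)" by (simp add: kill_def wD)
      then show "c \<odot>\<^bsub>M\<^esub> m \<in> ?Y" using \<open>m \<in> carrier M\<close> by auto
    qed (auto simp: kill_def wD)
    show "act M x m \<in> ?Y" if "m \<in> ?Y" for x m
      using step[of m] that act_simps by blast
    show "Inv \<subseteq> ?Y"
    proof
      fix m assume m: "m \<in> Inv"
      have "kill 1 m" unfolding kill_def
      proof (intro allI impI)
        fix xs :: "('w \<times> 'k) list" assume "length xs = 1 \<and> set xs \<subseteq> l \<times> {0}"
        then show "V.word_act xs m = \<zero>\<^bsub>M\<^esub>" using m by (cases xs) (auto simp: invariants_def)
      qed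
      then show "m \<in> ?Y" using m by (auto simp: invariants_def)
    qed
  qed
  then show ?thesis by (auto simp: locally_nilpotent_def kill_def)
qed

end

section \<open>The module induced from a module over the center\<close>

locale center_module = darboux scale \<omega> l B q + CN: lie_module "heis_center scale \<omega>" N
  for scale :: "'k::field_char_0 \<Rightarrow> 'w::ab_group_add \<Rightarrow> 'w"
    and \<omega> l B q and N :: "('k, 'w \<times> 'k, 'n) lie_mod" +
  assumes zinv: "acts_invertibly z_elem N"
begin

abbreviation "E \<equiv> extension N"
abbreviation "ZN \<equiv> act N z_elem"
abbreviation "Pol \<equiv> H\<lparr>carrier := l \<times> UNIV\<rparr>"

lemma center_simps [simp]:
  "carrier (heis_center scale \<omega>) = {0} \<times> UNIV" "(v, c) \<oplus>\<^bsub>heis_center scale \<omega>\<^esub> (w, d) = (v + w, c + d)"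
  "a \<odot>\<^bsub>heis_center scale \<omega>\<^esub> (v, c) = (scale a v, a * c)"
  "bracket (heis_center scale \<omega>) (v, c) (w, d) = (0, \<omega> v w)"
  by (simp_all add: heis_center_def heisenberg_def)

lemma E_simps [simp]:
  "carrier E = carrier N" "add E = add N" "\<zero>\<^bsub>E\<^esub> = \<zero>\<^bsub>N\<^esub>" "module.smult E = module.smult N"
  "act E (w, c) n = act N (0, c) n"
  by (simp_all add: extension_def)

lemma endo_N: "CN.endo (act N (0, c))"
  by (rule CN.endo_act) simp

lemmas N_simps = CN.endoD[OF endo_N]

lemma endo_ZN: "CN.endo ZN" unfolding z_elem_def by (rule endo_N)

lemmas ZN_simps = CN.endoD[OF endo_ZN]

lemma act_N: "n \<in> carrier N \<Longrightarrow> act N (0, c) n = c \<odot>\<^bsub>N\<^esub> ZN n"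
  using CN.act_smult_left[of "(0, 1)" n c] by (simp add: z_elem_def)

lemma act_N_zero: "n \<in> carrier N \<Longrightarrow> act N (0, 0) n = \<zero>\<^bsub>N\<^esub>"
  using act_N[of n 0] ZN_simps(1) by simp

text \<open>Letting \<open>l\<close> act by zero is consistent because the polarization is
  commutative: brackets inside it vanish by isotropy of \<open>l\<close>, and central elements
  commute on \<open>N\<close>.\<close>

lemma lie_module_E: "lie_module Pol E"
proof -
  have "lie_algebra Pol"
    using lie_algebra_heis(3)[OF symplectic_space_axioms, of l] lagr
      by (simp add: heis_polarization_def lagrangian_def)
  moreover have "lin_space E"
    by (rule lin_space_cong[OF CN.lin_space_axioms]) simp_all
  moreover have "lie_module_axioms Pol E"
  proof (rule lie_module_axioms.intro)
    fix x y :: "'w \<times> 'k" and c m n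
    assume x: "x \<in> carrier Pol" and "m \<in> carrier E"
    then have m: "m \<in> carrier N" by simp
    obtain v a where v: "x = (v, a)" by (cases x)
    obtain w b where w: "y = (w, b)" by (cases y)
    show "act E x m \<in> carrier E" using m by (simp add: v N_simps)
    show "act E (c \<odot>\<^bsub>Pol\<^esub> x) m = c \<odot>\<^bsub>E\<^esub> act E x m"
      using m CN.act_smult_left[of "(0, a)" m c] by (simp add: v heisenberg_def)
    show "act E x (c \<odot>\<^bsub>E\<^esub> m) = c \<odot>\<^bsub>E\<^esub> act E x m" using m by (simp add: v N_simps)
    show "act E x (m \<oplus>\<^bsub>E\<^esub> n) = act E x m \<oplus>\<^bsub>E\<^esub> act E x n" if "n \<in> carrier E"
      using m that by (simp add: v N_simps)
    assume y: "y \<in> carrier Pol"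
    show "act E (x \<oplus>\<^bsub>Pol\<^esub> y) m = act E x m \<oplus>\<^bsub>E\<^esub> act E y m"
      using m CN.act_add_left[of "(0, a)" "(0, b)" m] by (simp add: v w heisenberg_def)
    have "bracket Pol x y = (0, 0)" using x y by (simp add: v w heisenberg_def l_props(2))
    moreover have "act N (0, a) (act N (0, b) m) \<ominus>\<^bsub>N\<^esub> act N (0, b) (act N (0, a) m) = \<zero>\<^bsub>N\<^esub>"
      using CN.act_bracket[of "(0, a)" "(0, b)" m] m by (simp add: act_N_zero)
    \<comment> \<open>Subtraction is unfolded down to carrier, zero and addition, where
      \<open>E\<close> and \<open>N\<close> agree.\<close>
    ultimately show "act E (bracket Pol x y) m = act E x (act E y m) \<ominus>\<^bsub>E\<^esub> act E y (act E x m)"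
      using m by (simp add: v w act_N_zero a_minus_def a_inv_def m_inv_def)
  qed
  ultimately show ?thesis by (simp add: lie_module_def lin_space_def)
qed

sublocale IN: induced H "l \<times> UNIV" E
  using HL.lie_algebra_axioms lie_module_E by (simp add: induced_def induced_axioms_def)

lemma heis_induced: "heis_induced scale \<omega> l N = IN.Ind"
  by (simp add: heis_induced_def heis_polarization_def)

sublocale HM: heis_module scale \<omega> l B q IN.Ind
  using darboux_axioms IN.lie_module_Ind by (simp add: heis_module_def)

lemma eta_simps:
  "n \<in> carrier N \<Longrightarrow> IN.\<eta> n \<in> carrier IN.Ind"
  "n \<in> carrier N \<Longrightarrow> n' \<in> carrier N \<Longrightarrow> IN.\<eta> (n \<oplus>\<^bsub>N\<^esub> n') = IN.\<eta> n \<oplus>\<^bsub>IN.Ind\<^esub> IN.\<eta> n'"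
  "n \<in> carrier N \<Longrightarrow> IN.\<eta> (c \<odot>\<^bsub>N\<^esub> n) = c \<odot>\<^bsub>IN.Ind\<^esub> IN.\<eta> n"
  "n \<in> carrier N \<Longrightarrow> HM.Zop (IN.\<eta> n) = IN.\<eta> (ZN n)"
  "n \<in> carrier N \<Longrightarrow> v \<in> l \<Longrightarrow> act IN.Ind (v, c) (IN.\<eta> n) = c \<odot>\<^bsub>IN.Ind\<^esub> IN.\<eta> (ZN n)"
  "IN.\<eta> \<zero>\<^bsub>N\<^esub> = \<zero>\<^bsub>IN.Ind\<^esub>"
proof -
  show 1: "n \<in> carrier N \<Longrightarrow> IN.\<eta> n \<in> carrier IN.Ind" 
    "n \<in> carrier N \<Longrightarrow> n' \<in> carrier N \<Longrightarrow> IN.\<eta> (n \<oplus>\<^bsub>N\<^esub> n') = IN.\<eta> n \<oplus>\<^bsub>IN.Ind\<^esub> IN.\<eta> n'"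
    "n \<in> carrier N \<Longrightarrow> IN.\<eta> (c \<odot>\<^bsub>N\<^esub> n) = c \<odot>\<^bsub>IN.Ind\<^esub> IN.\<eta> n" for n n' c
    using IN.eta_closed IN.eta_add IN.eta_smult by simp_all
  show "n \<in> carrier N \<Longrightarrow> HM.Zop (IN.\<eta> n) = IN.\<eta> (ZN n)"
    using IN.eta_act[of z_elem n] subspace_0[OF l_props(1)] by (simp add: z_elem_def)
  show "n \<in> carrier N \<Longrightarrow> v \<in> l \<Longrightarrow> act IN.Ind (v, c) (IN.\<eta> n) = c \<odot>\<^bsub>IN.Ind\<^esub> IN.\<eta> (ZN n)"
    using IN.eta_act[of "(v, c)" n] by (simp add: act_N 1 ZN_simps)
  show "IN.\<eta> \<zero>\<^bsub>N\<^esub> = \<zero>\<^bsub>IN.Ind\<^esub>" using 1(3)[of "\<zero>\<^bsub>N\<^esub>" 0] 1(1)[of "\<zero>\<^bsub>N\<^esub>"] by simp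
qed

lemma generated_by_eta:
  assumes "IN.I.lin_subset Y" "\<And>x m. m \<in> Y \<Longrightarrow> act IN.Ind x m \<in> Y" "IN.\<eta> ` carrier N \<subseteq> Y"
  shows "carrier IN.Ind \<subseteq> Y"
  by (rule IN.generated) (use assms in auto)

lemma eta_Inv: "IN.\<eta> ` carrier N \<subseteq> HM.Inv"
  using eta_simps ZN_simps by (auto simp: invariants_def)

lemma locally_nilpotent_Ind: "locally_nilpotent (l \<times> {0}) IN.Ind"
proof (rule HM.locally_nilpotent_of_generated)
  fix Y assume Y: "IN.I.lin_subset Y" "\<And>x m. m \<in> Y \<Longrightarrow> act IN.Ind x m \<in> Y" "HM.Inv \<subseteq> Y"
  show "carrier IN.Ind \<subseteq> Y" by (rule generated_by_eta) (use Y eta_Inv in auto)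
qed

lemma ZN_bij: "bij_betw ZN (carrier N) (carrier N)"
  using zinv by (simp add: acts_invertibly_def)

text \<open>The inverse of \<open>z\<close> is the endomorphism induced by the inverse of \<open>z\<close> on \<open>N\<close>.\<close>

lemma acts_invertibly_Ind: "acts_invertibly z_elem IN.Ind"
proof -
  define Zi where "Zi = inv_into (carrier N) ZN"
  have Zi: "Zi n \<in> carrier N" "ZN (Zi n) = n" "Zi (ZN n) = n" if "n \<in> carrier N" for n
    using that ZN_bij unfolding Zi_def bij_betw_def by (auto simp: inv_into_into f_inv_into_f)
  have ZiI: "Zi n = m" if "m \<in> carrier N" "ZN m = n" for m n using Zi(3)[OF that(1)] that by simp
  have Zi_endo: "CN.endo Zi"
    unfolding CN.endo_def by (auto intro!: ZiI simp: Zi ZN_simps)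
  note Zi_simps = CN.endoD[OF Zi_endo]
  have "lin_hom Pol E IN.Ind (\<lambda>n. IN.\<eta> (Zi n))"
    unfolding lin_hom_def by (auto simp: Zi_simps eta_simps Zi act_N ZN_simps)
  from IN.universal[OF IN.lie_module_Ind this] obtain f where
    f: "lin_hom H IN.Ind IN.Ind f" "\<And>n. n \<in> carrier N \<Longrightarrow> f (IN.\<eta> n) = IN.\<eta> (Zi n)" by auto
  note fD = lin_homD[OF f(1), simplified]
  have id: "lin_hom H IN.Ind IN.Ind (\<lambda>t. t)" by (auto simp: lin_hom_def)
  \<comment> \<open>Since \<open>z\<close> is central, both composites of \<open>f\<close> with it
    are module homomorphisms; they are the identity as soon as they are so on
    \<open>\<eta>\<close>.\<close>
  have lin: "lin_hom H IN.Ind IN.Ind (\<lambda>t. f (HM.Zop t))" "lin_hom H IN.Ind IN.Ind (\<lambda>t. HM.Zop (f t))"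
    unfolding lin_hom_def by (auto simp: HM.act_simps fD HM.act_zcomm[symmetric])
  have "f (HM.Zop t) = t" "HM.Zop (f t) = t" if "t \<in> carrier IN.Ind" for t
    by (rule IN.hom_eqI[OF IN.lie_module_Ind lin(1) id _ that], simp add: eta_simps f(2) Zi ZN_simps,
        rule IN.hom_eqI[OF IN.lie_module_Ind lin(2) id _ that], simp add: eta_simps f(2) Zi ZN_simps)
  then show ?thesis unfolding acts_invertibly_def
    by (intro bij_betw_byWitness[where f' = f]) (auto simp: HM.act_simps fD)
qed

lemma Inv_Ind: "HM.Inv = IN.\<eta> ` carrier N"
proof (rule HM.Inv_of_generated[OF acts_invertibly_Ind])
  show "IN.I.lin_subset (IN.\<eta> ` carrier N)"
    by (rule IN.I.lin_subsetI)
       (auto simp: eta_simps simp flip: eta_simps(2,3,6))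
  show "HM.Zop m \<in> IN.\<eta> ` carrier N" if "m \<in> IN.\<eta> ` carrier N" for m
    using that by (auto simp: eta_simps ZN_simps)
qed (use eta_Inv generated_by_eta in blast)+

text \<open>The Fock space consists of all functions on multi-indices (no finiteness is needed), with \<open>b\<close> acting
  as the shift and \<open>q b\<close> as \<open>a b \<cdot> z\<close> times the backward shift. The finite sum that
  defines the action is taken in a copy whose action is still unspecified.\<close>

definition Fock0 :: "('k, 'w \<times> 'k, ('w \<Rightarrow> nat) \<Rightarrow> 'n) lie_mod" where
  "Fock0 = \<lparr>carrier = {f. \<forall>a. f a \<in> carrier N}, monoid.mult = undefined, one = undefined,
      ring.zero = (\<lambda>a. \<zero>\<^bsub>N\<^esub>), add = (\<lambda>f g a. f a \<oplus>\<^bsub>N\<^esub> g a), module.smult = (\<lambda>c f a. c \<odot>\<^bsub>N\<^esub> f a), act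
        = undefined\<rparr>"

definition "PF b f = (\<lambda>a :: 'w \<Rightarrow> nat. f (a(b := Suc (a b))))"
definition "QF b f = (\<lambda>a :: 'w \<Rightarrow> nat. of_nat (a b) \<odot>\<^bsub>N\<^esub> ZN (f (a(b := a b - 1))))"
definition "ZF f = (\<lambda>a :: 'w \<Rightarrow> nat. ZN (f a))"

definition Fock :: "('k, 'w \<times> 'k, ('w \<Rightarrow> nat) \<Rightarrow> 'n) lie_mod" where
  "Fock = Fock0\<lparr>act := (\<lambda>(w, c) f. (\<Oplus>\<^bsub>Fock0\<^esub>b\<in>B. \<omega> w (q b) \<odot>\<^bsub>Fock0\<^esub> PF b f \<oplus>\<^bsub>Fock0\<^esub> \<omega> b w \<odot>\<^bsub>Fock0\<^esub> QF b f)
     \<oplus>\<^bsub>Fock0\<^esub> c \<odot>\<^bsub>Fock0\<^esub> ZF f)\<rparr>"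

lemma Fock_simps [simp]:
  "carrier Fock = {f. \<forall>a. f a \<in> carrier N}" "\<zero>\<^bsub>Fock\<^esub> = (\<lambda>a. \<zero>\<^bsub>N\<^esub>)" "f \<oplus>\<^bsub>Fock\<^esub> g = (\<lambda>a. f a \<oplus>\<^bsub>N\<^esub> g a)"
  "c \<odot>\<^bsub>Fock\<^esub> f = (\<lambda>a. c \<odot>\<^bsub>N\<^esub> f a)"
  by (simp_all add: Fock_def Fock0_def)

text \<open>Finite sums do not look at the action field, so the sum taken in \<open>Fock0\<close>
  may be read as a sum in \<open>Fock\<close>.\<close>

lemma finsum_act_upd: "finsum (M\<lparr>act := x\<rparr>) g S = finsum M g S" for M :: "('k, 'a, 'b) lie_mod"
  by (simp add: finsum_def finprod_def)

lemma act_Fock: "act Fock (w, c) f = (\<Oplus>\<^bsub>Fock\<^esub>b\<in>B. \<omega> w (q b) \<odot>\<^bsub>Fock\<^esub> PF b f \<oplus>\<^bsub>Fock\<^esub> \<omega> b w \<odot>\<^bsub>Fock\<^esub> QF b f)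
    \<oplus>\<^bsub>Fock\<^esub> c \<odot>\<^bsub>Fock\<^esub> ZF f"
  unfolding Fock_def by (simp add: finsum_act_upd)

lemma lin_space_Fock: "lin_space Fock"
proof -
  have "abelian_group Fock"
  proof (rule abelian_groupI)
    fix x assume "x \<in> carrier Fock"
    then show "\<exists>y\<in>carrier Fock. y \<oplus>\<^bsub>Fock\<^esub> x = \<zero>\<^bsub>Fock\<^esub>"
      by (intro bexI[of _ "\<lambda>a. \<ominus>\<^bsub>N\<^esub> x a"]) (auto simp: CN.M.l_neg)
  qed (auto simp: CN.M.a_ac fun_eq_iff)
  then show ?thesis unfolding lin_space_def
    by (intro moduleI) (auto simp: CN.scal_add_left CN.scal_add_right CN.scal_mult
      intro: cring_from_type_algebra)
qed

text \<open>At a multi-index \<open>a\<close>, the shift after the weighted backward shift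
  multiplies by \<open>a b + 1\<close>, the opposite order by \<open>a b\<close>, both times
  \<open>z\<close>; the difference is \<open>z\<close>.\<close>

lemma heis_ops_Fock: "heis_ops Fock B PF QF ZF"
proof -
  interpret F: lin_space Fock by (rule lin_space_Fock)
  show ?thesis
  proof unfold_locales
    show "F.endo (PF i)" "F.endo (QF i)" "F.endo ZF" for i
      by (auto simp: F.endo_def PF_def QF_def ZF_def ZN_simps CN.scal_add_right mult.commute simp
        flip: CN.scal_mult)
    fix i j m assume m: "m \<in> carrier Fock"
    show "PF i (QF j m) = (if i = j then QF j (PF i m) \<oplus>\<^bsub>Fock\<^esub> ZF m else QF j (PF i m))"
    proof
      fix a
      \<comment> \<open>The predecessor of \<open>a i\<close> is truncated at zero. At
        \<open>a i = 0\<close> this fails to invert the shift, but there the coefficient of the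
        backward shift is zero.\<close>
      have "m (a(i := Suc (a i - Suc 0))) = m a" if "a i \<noteq> 0" using that by simp
      then show "PF i (QF j m) a = (if i = j then QF j (PF i m) \<oplus>\<^bsub>Fock\<^esub> ZF m else QF j (PF i m)) a"
        using m by (cases "a i = 0") (auto
          simp: PF_def QF_def ZF_def ZN_simps CN.scal_add_left CN.M.a_ac fun_upd_twist)
    qed
    show "PF i (PF j m) = PF j (PF i m)"
      by (cases "i = j") (auto simp: PF_def fun_upd_twist)
    show "QF i (QF j m) = QF j (QF i m)"
      using m by (cases "i = j") (auto simp: QF_def fun_upd_twist ZN_simps mult.commute simp
        flip: CN.scal_mult)
    show "PF i (ZF m) = ZF (PF i m)" "QF i (ZF m) = ZF (QF i m)"
      using m by (auto simp: PF_def QF_def ZF_def ZN_simps)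
  next
    show "bij_betw ZF (carrier Fock) (carrier Fock)"
      by (rule bij_betw_byWitness[where f' = "\<lambda>f a. inv_into (carrier N) ZN (f a)"])
         (use ZN_bij in \<open>auto simp: ZF_def ZN_simps bij_betw_def f_inv_into_f inv_into_into\<close>)
  qed (rule fin_B)
qed

lemma lie_module_Fock: "lie_module H Fock"
  by (rule lie_module_of_ops[OF heis_ops_Fock act_Fock])

text \<open>A homomorphism out of the induced module that recovers \<open>n\<close> from
  \<open>\<eta> n\<close> is enough. It comes from the universal property applied to the vacuum of
  the Fock space.\<close>

lemma eta_inj: "inj_on IN.\<eta> (carrier N)"
proof -
  interpret F: heis_ops Fock B PF QF ZF by (rule heis_ops_Fock)
  \<comment> \<open>\<open>n\<close> placed at the zero multi-index. A shift only reads nonzero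
    multi-indices, so every \<open>PF b\<close> kills it; evaluation at zero recovers
    \<open>n\<close>.\<close>
  define \<iota> where "\<iota> n = (\<lambda>a :: 'w \<Rightarrow> nat. if a = (\<lambda>_. 0) then n else \<zero>\<^bsub>N\<^esub>)" for n
  have P0: "PF b (\<iota> n) = \<zero>\<^bsub>Fock\<^esub>" for b n
  proof -
    have "a(b := Suc (a b)) \<noteq> (\<lambda>_. 0)" for a by (metis fun_upd_same nat.distinct(2))
    then show ?thesis by (auto simp: PF_def \<iota>_def)
  qed
  have i: "\<iota> n \<in> carrier Fock" if "n \<in> carrier N" for n using that by (auto simp: \<iota>_def)
  \<comment> \<open>For \<open>w\<close> in \<open>l\<close> the coefficients
    \<open>\<omega> b w\<close> vanish by isotropy and the remaining terms by \<open>P0\<close>, so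
    only the central part acts.\<close>
  have act_i: "act Fock (w, c) (\<iota> n) = \<iota> (c \<odot>\<^bsub>N\<^esub> ZN n)" if "n \<in> carrier N" "w \<in> l" for w c n
  proof -
    have "(\<Oplus>\<^bsub>Fock\<^esub>b\<in>B. \<omega> w (q b) \<odot>\<^bsub>Fock\<^esub> PF b (\<iota> n) \<oplus>\<^bsub>Fock\<^esub> \<omega> b w \<odot>\<^bsub>Fock\<^esub> QF b (\<iota> n))
      = (\<Oplus>\<^bsub>Fock\<^esub>b\<in>B. \<zero>\<^bsub>Fock\<^esub>)"
      using l_props(2) B_l that i[OF that(1)] F.endoD(1)[OF F.endo_Q]
      by (intro F.M.finsum_cong') (auto simp: P0 subset_iff)
    also have "\<dots> = \<zero>\<^bsub>Fock\<^esub>" by (rule F.M.finsum_zero)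
    finally have S0: "(\<Oplus>\<^bsub>Fock\<^esub>b\<in>B. \<omega> w (q b) \<odot>\<^bsub>Fock\<^esub> PF b (\<iota> n) \<oplus>\<^bsub>Fock\<^esub> \<omega> b w \<odot>\<^bsub>Fock\<^esub> QF b (\<iota> n))
      = \<zero>\<^bsub>Fock\<^esub>" .
    show ?thesis unfolding act_Fock S0 using that by (auto simp: ZF_def \<iota>_def ZN_simps)
  qed
  have "lin_hom Pol E Fock \<iota>"
    unfolding lin_hom_def using act_i by (auto simp: act_N \<iota>_def fun_eq_iff)
  from IN.universal[OF lie_module_Fock this] obtain f where "\<And>n. n \<in> carrier N \<Longrightarrow> f (IN.\<eta> n) = \<iota> n"
    by auto
  note f = this
  have i_inj: "n = n'" if "\<iota> n = \<iota> n'" for n n' using fun_cong[OF that, of "\<lambda>_. 0"] by (simp add: \<iota>_def)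
  show ?thesis
  proof (rule inj_onI)
    fix n n' assume "n \<in> carrier N" "n' \<in> carrier N" "IN.\<eta> n = IN.\<eta> n'"
    then have "\<iota> n = \<iota> n'" using f[of n] f[of n'] by simp
    then show "n = n'" by (rule i_inj)
  qed
qed

lemma eta_bij: "bij_betw IN.\<eta> (carrier N) HM.Inv"
  using eta_inj Inv_Ind by (simp add: bij_betw_def)

text \<open>Justifies the choice in \<open>chosen_embedding\<close>. A nonzero \<open>N\<close>
  contains a line over a field of characteristic zero and is infinite; finite lists of pairs from a
  countable set of words and \<open>N\<close> are then no more numerous than \<open>N\<close>, and
  they map onto the induced module.\<close>

lemma Ind_embeds: "\<exists>e :: _ \<Rightarrow> 'n. inj_on e (carrier IN.Ind)"
proof (cases "carrier N = {\<zero>\<^bsub>N\<^esub>}")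
  case True
  have "carrier IN.Ind \<subseteq> {\<zero>\<^bsub>IN.Ind\<^esub>}"
    by (rule generated_by_eta) (auto intro!: IN.I.lin_subsetI simp: True eta_simps HM.act_simps)
  then have "inj_on (\<lambda>t. undefined) (carrier IN.Ind)" by (auto simp: inj_on_def)
  then show ?thesis by blast
next
  case False
  then obtain n0 where n0: "n0 \<in> carrier N" "n0 \<noteq> \<zero>\<^bsub>N\<^esub>" using CN.M.zero_closed by blast
  have "inj (\<lambda>c. c \<odot>\<^bsub>N\<^esub> n0)"
  proof (rule injI)
    fix c d assume "c \<odot>\<^bsub>N\<^esub> n0 = d \<odot>\<^bsub>N\<^esub> n0"
    then have "(c - d) \<odot>\<^bsub>N\<^esub> n0 = \<zero>\<^bsub>N\<^esub>"
      using n0 CN.scal_add_left[of n0 d "- d"] CN.scal_add_left[of n0 c "- d"] by simp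
    then show "c = d" using CN.scal_eq_zero_iff[OF n0(1)] n0(2) by simp
  qed
  moreover have "infinite (UNIV :: 'k set)" by (rule infinite_UNIV_char_0)
  ultimately have "infinite (range (\<lambda>c. c \<odot>\<^bsub>N\<^esub> n0))" by (simp add: range_inj_infinite finite_image_iff)
  moreover have "range (\<lambda>c. c \<odot>\<^bsub>N\<^esub> n0) \<subseteq> carrier N" using n0 by auto
  ultimately have inf: "infinite (carrier N)" by (meson finite_subset)
  \<comment> \<open>Every element is a sum of words in the finite set \<open>G\<close> applied to elements of \<open>\<eta> N\<close>.\<close>
  define G where "G = (\<lambda>b. (b, 0)) ` B \<union> (\<lambda>b. (q b, 0)) ` B \<union> {z_elem :: 'w \<times> 'k}"
  define g where "g = (\<lambda>ps. foldr (\<lambda>p t. IN.I.word_act (fst p)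
    (IN.\<eta> (snd p)) \<oplus>\<^bsub>IN.Ind\<^esub> t) ps \<zero>\<^bsub>IN.Ind\<^esub>)"
  define S where "S = lists (lists G \<times> carrier N)"
  have we: "IN.I.endo (IN.I.word_act xs)" for xs by (rule IN.I.endo_word_act) simp
  note wD = IN.I.endoD[OF we]
  have g_nil: "g [] = \<zero>\<^bsub>IN.Ind\<^esub>" and g_cons: "g (p # ps)
    = IN.I.word_act (fst p) (IN.\<eta> (snd p)) \<oplus>\<^bsub>IN.Ind\<^esub> g ps" for p ps
    by (simp_all add: g_def)
  have g_closed: "ps \<in> S \<Longrightarrow> g ps \<in> carrier IN.Ind" for ps
    unfolding S_def by (induction ps) (auto simp: g_nil g_cons wD eta_simps)
  have g_append: "ps \<in> S \<Longrightarrow> qs \<in> S \<Longrightarrow> g (ps @ qs) = g ps \<oplus>\<^bsub>IN.Ind\<^esub> g qs" for ps qs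
  proof (induction ps)
    case (Cons p ps)
    then show ?case using g_closed[of ps] g_closed[of qs]
      by (auto simp: g_cons wD eta_simps IN.G.a_assoc S_def)
  qed (use g_closed in \<open>auto simp: g_nil\<close>)
  have g_scal: "ps \<in> S \<Longrightarrow> c \<odot>\<^bsub>IN.Ind\<^esub> g ps = g (map (\<lambda>p. (fst p, c \<odot>\<^bsub>N\<^esub> snd p)) ps)" for c ps
  proof (induction ps)
    case (Cons p ps)
    then show ?case using g_closed[of ps]
      by (auto simp: g_cons wD eta_simps IN.I.scal_add_right S_def)
  qed (auto simp: g_nil)
  have g_act: "ps \<in> S \<Longrightarrow> act IN.Ind x (g ps) = g (map (\<lambda>p. (x # fst p, snd p)) ps)" for x ps
  proof (induction ps)
    case (Cons p ps)
    then show ?case using g_closed[of ps]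
      by (auto simp: g_cons wD eta_simps HM.act_simps S_def)
  qed (auto simp: g_nil HM.act_simps)
  have map_S: "map h ps \<in> S" if "ps \<in> S"
    "\<And>p. p \<in> lists G \<times> carrier N \<Longrightarrow> h p \<in> lists G \<times> carrier N" for h ps
    using that(1) unfolding S_def by (induction ps) (simp_all add: that(2))
  have lin: "IN.I.lin_subset (g ` S)"
  proof (rule IN.I.lin_subsetI)
    show "\<zero>\<^bsub>IN.Ind\<^esub> \<in> g ` S" using g_nil by (force simp: S_def)
    show "m \<oplus>\<^bsub>IN.Ind\<^esub> n \<in> g ` S" if mn: "m \<in> g ` S" "n \<in> g ` S" for m n
    proof -
      obtain ps qs where "ps \<in> S" "qs \<in> S" "m = g ps" "n = g qs" using mn by blast
      then have "m \<oplus>\<^bsub>IN.Ind\<^esub> n = g (ps @ qs)" "ps @ qs \<in> S" using g_append by (auto simp: S_def)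
      then show ?thesis by blast
    qed
    show "c \<odot>\<^bsub>IN.Ind\<^esub> m \<in> g ` S" if mn: "m \<in> g ` S" for c m
    proof -
      obtain ps where "ps \<in> S" "m = g ps" using mn by blast
      then have "c \<odot>\<^bsub>IN.Ind\<^esub> m = g (map (\<lambda>p. (fst p, c \<odot>\<^bsub>N\<^esub> snd p)) ps)"
        "map (\<lambda>p. (fst p, c \<odot>\<^bsub>N\<^esub> snd p)) ps \<in> S"
        by (simp_all add: g_scal) (rule map_S, auto)
      then show ?thesis by blast
    qed
  qed (use g_closed in auto)
  have act_G: "act IN.Ind x m \<in> g ` S" if mn: "m \<in> g ` S" "x \<in> G" for x m
  proof -
    obtain ps where "ps \<in> S" "m = g ps" using mn by blast
    then have "act IN.Ind x m = g (map (\<lambda>p. (x # fst p, snd p)) ps)"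
      "map (\<lambda>p. (x # fst p, snd p)) ps \<in> S"
      using mn(2) by (simp_all add: g_act) (rule map_S, auto)
    then show ?thesis by blast
  qed
  have sub: "carrier IN.Ind \<subseteq> g ` S"
  proof (rule generated_by_eta[OF lin])
    show "act IN.Ind x m \<in> g ` S" if "m \<in> g ` S" for x m
      by (rule HM.closed_under_gens[OF lin _ _ _ that]) (auto intro!: act_G simp: G_def)
    show "IN.\<eta> ` carrier N \<subseteq> g ` S"
    proof
      fix t assume "t \<in> IN.\<eta> ` carrier N"
      then obtain n where "n \<in> carrier N" "t = IN.\<eta> n" by auto
      then have "t = g [([], n)]" "[([], n)] \<in> S" by (auto simp: g_nil g_cons S_def eta_simps)
      then show "t \<in> g ` S" by blast
    qed
  qed
  \<comment> \<open>Countably infinite sets are the ones compared with infinite sets here, so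
    \<open>lists G\<close> must also be infinite. \<open>z_elem\<close> keeps the alphabet nonempty
    even if \<open>B\<close> is empty.\<close>
  have "z_elem \<in> G" by (simp add: G_def)
  then have "range (\<lambda>i. replicate i z_elem) \<subseteq> lists G" by auto
  moreover have "infinite (range (\<lambda>i. replicate i (z_elem :: 'w \<times> 'k)))"
    by (rule range_inj_infinite) (auto simp: inj_def)
  ultimately have "infinite (lists G)" by (meson finite_subset)
  moreover have "countable (lists G)" unfolding G_def using fin_B
    by (intro countable_lists countable_finite) auto
  ultimately have "|lists G| \<le>o |carrier N|" using inf infinite_iff_card_of_countable by blast
  then have "|lists G \<times> carrier N| =o |carrier N|"
    using inf by (intro card_of_Times_infinite[THEN conjunct2]) auto
  moreover from this have "infinite (lists G \<times> carrier N)" using inf card_of_ordIso_finite by blast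
  then have "|S| =o |lists G \<times> carrier N|" unfolding S_def by (rule card_of_lists_infinite)
  ultimately have "|S| =o |carrier N|" using ordIso_transitive by blast
  moreover have "|carrier IN.Ind| \<le>o |S|" by (rule surj_imp_ordLeq[OF sub])
  ultimately have "|carrier IN.Ind| \<le>o |carrier N|" using ordLeq_ordIso_trans by blast
  then obtain e where "inj_on e (carrier IN.Ind)" "e ` carrier IN.Ind \<subseteq> carrier N"
    by (auto simp flip: card_of_ordLeq)
  then show ?thesis by blast
qed

end

section \<open>Transport and categories of modules\<close>

lemma lin_hom_comp: "lin_hom L M N f \<Longrightarrow> lin_hom L N K g \<Longrightarrow> lin_hom L M K (\<lambda>m. g (f m))"
  by (auto simp: lin_hom_def)

context lie_module
begin

lemma lin_hom_cong:
  assumes "lin_hom L M N f" "\<And>m. m \<in> carrier M \<Longrightarrow> g m = f m"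
  shows "lin_hom L M N g"
  using assms by (simp add: lin_hom_def act_closed)

lemma lin_hom_restrict: "lin_hom L M N f \<Longrightarrow> restrict f (carrier M) \<in> lie_mod_hom L M N"
  unfolding lie_mod_hom_iff by (auto intro: lin_hom_cong)

lemma lin_hom_inv:
  assumes f: "lin_hom L M N f" and bij: "bij_betw f (carrier M) (carrier N)"
  shows "lin_hom L N M (inv_into (carrier M) f)"
proof -
  have *: "\<exists>m\<in>carrier M. n = f m" if "n \<in> carrier N" for n using bij that by (auto simp: bij_betw_def)
  have [simp]: "inv_into (carrier M) f (f m) = m" if "m \<in> carrier M" for m
    using bij that by (auto simp: bij_betw_def)
  show ?thesis unfolding lin_hom_def
    by (auto dest!: * simp: act_closed simp flip: lin_homD(2,3,4)[OF f])
qed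

end

lemma is_isomorphism_lie_mod:
  assumes M: "lie_module L M" and N: "lie_module L N"
    and f: "f \<in> lie_mod_hom L M N" and bij: "bij_betw f (carrier M) (carrier N)"
  shows "is_isomorphism (lie_mod_category L Q) M N f"
proof -
  interpret M: lie_module L M by fact
  interpret N: lie_module L N by fact
  let ?g = "restrict (inv_into (carrier M) f) (carrier N)"
  have "?g \<in> lie_mod_hom L N M"
    by (rule N.lin_hom_restrict[OF M.lin_hom_inv]) (use f bij in \<open>auto simp: lie_mod_hom_iff\<close>)
  moreover have "compose (carrier M) ?g f = (\<lambda>m\<in>carrier M. m)"
    "compose (carrier N) f ?g = (\<lambda>m\<in>carrier N. m)"
    using bij by (auto simp: compose_def bij_betw_def fun_eq_iff f_inv_into_f)
  ultimately show ?thesis using f by (auto simp: is_isomorphism_def lie_mod_category_def)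
qed

lemma is_category_lie_mod: "is_category (lie_mod_category L Q)"
proof -
  have id: "lin_hom L M M (\<lambda>m\<in>carrier M. m)" if "lie_module L M" for M
    by (rule lie_module.lin_hom_cong[OF that, of M "\<lambda>m. m"]) (auto simp: lin_hom_def)
  have comp: "lin_hom L M K (\<lambda>m\<in>carrier M. g (f m))" if "lie_module L M" "lin_hom L M N f"
    "lin_hom L N K g" for M N K f g
    by (rule lie_module.lin_hom_cong[OF that(1) lin_hom_comp[OF that(2,3)]]) simp
  show ?thesis
    unfolding is_category_def lie_mod_category_def
    by (auto intro: id comp simp: compose_def fun_eq_iff lie_mod_hom_iff extensional_def lin_homD)
qed

locale transported = lie_module L M for L :: "('k::field, 'g) lie_alg" and M :: "('k, 'g, 'm) lie_mod" +
  fixes e :: "'m \<Rightarrow> 'u"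
  assumes inj_e: "inj_on e (carrier M)"
begin

abbreviation "T \<equiv> transport e M"

lemma carrier_T: "carrier T = e ` carrier M"
  by (simp add: transport_def Let_def)

lemma T_simps:
  "m \<in> carrier M \<Longrightarrow> n \<in> carrier M \<Longrightarrow> e m \<oplus>\<^bsub>T\<^esub> e n = e (m \<oplus>\<^bsub>M\<^esub> n)"
  "m \<in> carrier M \<Longrightarrow> c \<odot>\<^bsub>T\<^esub> e m = e (c \<odot>\<^bsub>M\<^esub> m)"
  "m \<in> carrier M \<Longrightarrow> act T x (e m) = e (act M x m)"
  "\<zero>\<^bsub>T\<^esub> = e \<zero>\<^bsub>M\<^esub>"
  using inj_e by (simp_all add: transport_def Let_def)

lemma lin_space_T: "lin_space T"
proof -
  have "abelian_group T"
  proof (rule abelian_groupI)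
    fix x assume "x \<in> carrier T"
    then obtain m where "m \<in> carrier M" "x = e m" by (auto simp: carrier_T)
    then show "\<exists>y\<in>carrier T. y \<oplus>\<^bsub>T\<^esub> x = \<zero>\<^bsub>T\<^esub>"
      by (intro bexI[of _ "e (\<ominus>\<^bsub>M\<^esub> m)"]) (auto simp: T_simps carrier_T M.l_neg)
  qed (auto simp: carrier_T T_simps M.a_ac)
  then show ?thesis unfolding lin_space_def
    by (intro moduleI) (auto simp: carrier_T T_simps scal_add_left scal_add_right scal_mult
      intro: cring_from_type_algebra)
qed

sublocale T: lin_space T by (rule lin_space_T)

lemma minus_T: "m \<in> carrier M \<Longrightarrow> n \<in> carrier M \<Longrightarrow> e m \<ominus>\<^bsub>T\<^esub> e n = e (m \<ominus>\<^bsub>M\<^esub> n)"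
  by (rule additive_minus(3)[OF M.abelian_group_axioms T.M.abelian_group_axioms, symmetric]) (auto
    simp: carrier_T T_simps)

lemma lie_module_T: "lie_module L T"
proof -
  have "lie_module_axioms L T"
  proof (rule lie_module_axioms.intro)
    fix x y c m n
    assume x: "x \<in> carrier L" and "m \<in> carrier T"
    then obtain m' where m': "m' \<in> carrier M" "m = e m'" by (auto simp: carrier_T)
    show "act T x m \<in> carrier T" "act T (c \<odot>\<^bsub>L\<^esub> x) m = c \<odot>\<^bsub>T\<^esub> act T x m"
      "act T x (c \<odot>\<^bsub>T\<^esub> m) = c \<odot>\<^bsub>T\<^esub> act T x m"
      using x m' by (simp_all add: T_simps carrier_T act_closed act_smult_left act_smult_right)
    show "act T x (m \<oplus>\<^bsub>T\<^esub> n) = act T x m \<oplus>\<^bsub>T\<^esub> act T x n" if "n \<in> carrier T"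
      using that x m' by (auto simp: T_simps carrier_T act_closed act_add_right)
    assume y: "y \<in> carrier L"
    then show "act T (x \<oplus>\<^bsub>L\<^esub> y) m = act T x m \<oplus>\<^bsub>T\<^esub> act T y m"
      "act T (bracket L x y) m = act T x (act T y m) \<ominus>\<^bsub>T\<^esub> act T y (act T x m)"
      using x m' by (simp_all add: T_simps act_closed act_add_left act_bracket minus_T)
  qed
  then show ?thesis using L.lie_algebra_axioms lin_space_T by (simp add: lie_module_def lin_space_def)
qed

lemma lin_hom_e: "lin_hom L M T e"
  by (auto simp: lin_hom_def carrier_T T_simps)

lemma bij_e: "bij_betw e (carrier M) (carrier T)"
  using inj_e by (simp add: bij_betw_def carrier_T)

lemma lin_hom_r: "lin_hom L T M (inv_into (carrier M) e)"
  by (rule lin_hom_inv[OF lin_hom_e bij_e])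

lemma acts_invertibly_T:
  assumes "x \<in> carrier L" "acts_invertibly x M" shows "acts_invertibly x T"
proof -
  have "bij_betw (act T x \<circ> e) (carrier M) (carrier T) \<longleftrightarrow> bij_betw (e \<circ> act M x) (carrier M) (carrier T)"
    by (rule bij_betw_cong) (simp add: T_simps)
  moreover have "bij_betw (e \<circ> act M x) (carrier M) (carrier T)"
    using bij_betw_trans[OF _ bij_e] assms by (simp add: acts_invertibly_def)
  ultimately show ?thesis unfolding acts_invertibly_def using bij_betw_comp_iff[OF bij_e] by blast
qed

lemma locally_nilpotent_T:
  assumes "S \<subseteq> carrier L" "locally_nilpotent S M" shows "locally_nilpotent S T"
proof -
  have *: "foldr (act T) xs (e m) = e (word_act xs m)" if "m \<in> carrier M" "set xs \<subseteq> S" for xs m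
    using that(2)
  proof (induction xs)
    case (Cons x xs)
    then show ?case using endoD(1)[OF endo_word_act[of xs] that(1)] assms(1) by (auto simp: T_simps)
  qed simp
  show ?thesis unfolding locally_nilpotent_def carrier_T
  proof
    fix t assume "t \<in> e ` carrier M"
    then obtain m where m: "m \<in> carrier M" "t = e m" by auto
    then obtain i where "\<And>xs. length xs = i \<Longrightarrow> set xs \<subseteq> S \<Longrightarrow> word_act xs m = \<zero>\<^bsub>M\<^esub>"
      using assms(2) unfolding locally_nilpotent_def by blast
    then show "\<exists>i. \<forall>xs. length xs = i \<and> set xs \<subseteq> S \<longrightarrow> foldr (act T) xs t = \<zero>\<^bsub>T\<^esub>"
      using m by (intro exI[of _ i]) (simp add: * T_simps)
  qed
qed

lemma invariants_T: "S \<subseteq> carrier L \<Longrightarrow> invariants S T = e ` invariants S M"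
  using inj_e by (auto simp: invariants_def carrier_T T_simps act_closed inj_on_eq_iff subset_iff)

end

section \<open>Unit and counit as functions of the module\<close>

context darboux
begin

abbreviation "Z0 \<equiv> heis_center scale \<omega>"
abbreviation "FO M \<equiv> M\<lparr>carrier := invariants (l \<times> {0}) M\<rparr>"
abbreviation "IO \<equiv> heis_induced scale \<omega> l"
abbreviation "IH \<equiv> heis_induced_map scale \<omega> l"
abbreviation "inv0 \<equiv> invariants (l \<times> {0})"

text \<open>The unit with the object as an argument, so that statements can involve several modules
  at once, whereas \<open>center_module\<close> fixes a single one.\<close>

definition \<eta> :: "('k, 'w \<times> 'k, 'n) lie_mod \<Rightarrow> 'n \<Rightarrow> ('k, 'w \<times> 'k, 'n) ind" where
  "\<eta> N = induced.\<eta> H (l \<times> UNIV) (extension N)"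

definition hobj :: "('k, 'w \<times> 'k, 'm) lie_mod \<Rightarrow> bool" where
  "hobj M \<longleftrightarrow> lie_module H M \<and> locally_nilpotent (l \<times> {0}) M \<and> acts_invertibly z_elem M"

definition cobj :: "('k, 'w \<times> 'k, 'm) lie_mod \<Rightarrow> bool" where
  "cobj N \<longleftrightarrow> lie_module Z0 N \<and> acts_invertibly z_elem N"

lemma center_moduleI: "cobj N \<Longrightarrow> center_module scale \<omega> l B q N"
  using darboux_axioms by (simp add: cobj_def center_module_def center_module_axioms_def)

lemma heis_moduleI: "lie_module H M \<Longrightarrow> heis_module scale \<omega> l B q M"
  using darboux_axioms by (simp add: heis_module_def)

lemma carrier_Z0 [simp]: "carrier Z0 = {0} \<times> UNIV"
  by (simp add: heis_center_def)

lemma hobj_induced: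
  assumes "cobj N" shows "hobj (IO N)"
proof -
  interpret N: center_module scale \<omega> l B q N by (rule center_moduleI[OF assms])
  show ?thesis
    using N.IN.lie_module_Ind N.locally_nilpotent_Ind N.acts_invertibly_Ind
      by (simp add: hobj_def N.heis_induced)
qed

lemma eta_props:
  assumes "cobj N"
  shows "bij_betw (\<eta> N) (carrier N) (inv0 (IO N))" "lin_hom Z0 N (IO N) (\<eta> N)"
proof -
  interpret N: center_module scale \<omega> l B q N by (rule center_moduleI[OF assms])
  show "bij_betw (\<eta> N) (carrier N) (inv0 (IO N))"
    using N.eta_bij by (simp add: \<eta>_def N.heis_induced)
  show "lin_hom Z0 N (IO N) (\<eta> N)"
    unfolding lin_hom_def \<eta>_def N.heis_induced
    using subspace_0[OF l_props(1)] by (auto simp: N.eta_simps N.act_N N.ZN_simps)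
qed

lemma induced_hom_eqI:
  assumes "cobj N" "lie_module H M" "lin_hom H (IO N) M f" "lin_hom H (IO N) M g"
    "\<And>n. n \<in> carrier N \<Longrightarrow> f (\<eta> N n) = g (\<eta> N n)" "t \<in> carrier (IO N)"
  shows "f t = g t"
proof -
  interpret N: center_module scale \<omega> l B q N by (rule center_moduleI[OF assms(1)])
  show ?thesis using N.IN.hom_eqI[of M f g t] assms(2-) by (simp add: \<eta>_def N.heis_induced)
qed

text \<open>A map of center modules into the invariants is automatically linear over the
  polarization, because \<open>l\<close> acts by zero on both sides. This is the adjunction between
  \<open>G\<close> and \<open>F\<close>.\<close>

lemma induced_universal:
  assumes "cobj N" "lie_module H M" "lin_hom Z0 N M \<phi>" "\<And>n. n \<in> carrier N \<Longrightarrow> \<phi> n \<in> inv0 M"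
  shows "\<exists>f. lin_hom H (IO N) M f \<and> (\<forall>n\<in>carrier N. f (\<eta> N n) = \<phi> n)"
proof -
  interpret N: center_module scale \<omega> l B q N by (rule center_moduleI[OF assms(1)])
  interpret M: heis_module scale \<omega> l B q M by (rule heis_moduleI[OF assms(2)])
  note \<phi> = lin_homD[OF assms(3)]
  have "\<phi> (act N (0, c) n) = act M (w, c) (\<phi> n)" if "w \<in> l" "n \<in> carrier N" for w c n
  proof -
    have "act M (w, c) (\<phi> n) = act M (w, 0) (\<phi> n) \<oplus>\<^bsub>M\<^esub> act M (0, c) (\<phi> n)"
      using M.act_add_arg[of "\<phi> n" w 0 0 c] \<phi>(1)[OF that(2)] by simp
    also have "act M (w, 0) (\<phi> n) = \<zero>\<^bsub>M\<^esub>" using assms(4)[OF that(2)] that(1)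
      by (simp add: invariants_def)
    finally show ?thesis using \<phi>(4)[of "(0, c)" n] \<phi>(1)[of n] that M.act_simps by simp
  qed
  then have "lin_hom N.Pol N.E M \<phi>" unfolding lin_hom_def using \<phi> by auto
  then show ?thesis using N.IN.universal[OF assms(2)] by (simp add: \<eta>_def N.heis_induced)
qed

lemma heis_induced_map_props:
  assumes "cobj N" "cobj N'" "lin_hom Z0 N N' f"
  shows "lin_hom H (IO N) (IO N') (IH N' f)"
    "n \<in> carrier N \<Longrightarrow> IH N' f (\<eta> N n) = \<eta> N' (f n)"
proof -
  interpret N: center_module scale \<omega> l B q N by (rule center_moduleI[OF assms(1)])
  interpret N': center_module scale \<omega> l B q N' by (rule center_moduleI[OF assms(2)])
  have "lin_hom N.Pol N.E N'.E f"
    unfolding lin_hom_def using lin_homD[OF assms(3)] by auto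
  then interpret IM: induced_map H "l \<times> UNIV" N.E N'.E f
    by (simp add: induced_map_def induced_map_axioms_def N.IN.induced_axioms N'.IN.induced_axioms)
  have eq: "IH N' f = tensor_map (induced_subgroup H N.Pol N'.E) (\<lambda>a. a) f"
    by (simp add: heis_induced_map_def heis_polarization_def)
  show "lin_hom H (IO N) (IO N') (IH N' f)"
    "n \<in> carrier N \<Longrightarrow> IH N' f (\<eta> N n) = \<eta> N' (f n)"
    using IM.Imap_props by (simp_all add: eq \<eta>_def N.heis_induced N'.heis_induced)
qed

lemma chosen_embedding_inj:
  fixes N :: "('k, 'w \<times> 'k, 'u) lie_mod"
  assumes "cobj N" shows "inj_on (chosen_embedding (IO N) :: _ \<Rightarrow> 'u) (carrier (IO N))"
proof -
  interpret N: center_module scale \<omega> l B q N by (rule center_moduleI[OF assms])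
  show ?thesis unfolding chosen_embedding_def N.heis_induced by (rule someI_ex[OF N.Ind_embeds])
qed

text \<open>As \<open>z\<close> is central and injective, \<open>x (z m) = z (x m)\<close> vanishes
  exactly when \<open>x m\<close> does; so \<open>z\<close> preserves invariance in both directions
  and its bijectivity restricts.\<close>

lemma cobj_invariants:
  assumes "hobj M" shows "cobj (FO M)"
proof -
  interpret M: heis_module scale \<omega> l B q M by (rule heis_moduleI) (use assms in \<open>simp add: hobj_def\<close>)
  have Zb: "bij_betw M.Zop (carrier M) (carrier M)" using assms
    by (simp add: hobj_def acts_invertibly_def)
  have Zz: "m = \<zero>\<^bsub>M\<^esub>" if "M.Zop m = \<zero>\<^bsub>M\<^esub>" "m \<in> carrier M" for m
    using Zb that M.act_simps(4)[of z_elem] unfolding bij_betw_def inj_on_def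
      by (metis M.V.M.zero_closed)
  have Z_Inv: "M.Zop m \<in> M.Inv \<longleftrightarrow> m \<in> M.Inv" if "m \<in> carrier M" for m
  proof -
    have "act M x (M.Zop m) = \<zero>\<^bsub>M\<^esub> \<longleftrightarrow> act M x m = \<zero>\<^bsub>M\<^esub>" for x
      using Zz[of "act M x m"] M.act_zcomm[OF that, of x] M.act_simps(1)[OF that]
        M.act_simps(4)[of z_elem] by auto
    then show ?thesis using that M.act_simps(1) by (simp add: invariants_def)
  qed
  have c_Inv: "act M (0, c) m \<in> M.Inv" if "m \<in> M.Inv" for c m
    using that Z_Inv[of m] M.V.lin_subsetD[OF M.lin_subset_Inv] by (auto simp: M.act_center)
  have "lie_module Z0 (FO M)"
    using M.V.lie_module_restrict[of "{0} \<times> UNIV", OF _ _ M.lin_subset_Inv] c_Inv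
      lie_algebra_heis(2)[OF symplectic_space_axioms] by (auto simp: heis_center_def)
  moreover have "bij_betw M.Zop M.Inv M.Inv"
    unfolding bij_betw_def
  proof
    show "inj_on M.Zop M.Inv" using Zb by (auto simp: bij_betw_def inj_on_def invariants_def)
    have "m \<in> M.Zop ` M.Inv" if m: "m \<in> M.Inv" for m
    proof -
      obtain m' where "m' \<in> carrier M" "m = M.Zop m'" using m Zb
        by (auto simp: bij_betw_def invariants_def)
      then show ?thesis using Z_Inv[of m'] m by blast
    qed
    then show "M.Zop ` M.Inv = M.Inv" using Z_Inv by (auto simp: invariants_def)
  qed
  ultimately show ?thesis by (simp add: cobj_def acts_invertibly_def)
qed

lemma counit_bij:
  assumes M: "hobj M" and \<epsilon>: "lin_hom H (IO (FO M)) M \<epsilon>" "\<And>m. m \<in> inv0 M \<Longrightarrow> \<epsilon> (\<eta> (FO M) m) = m"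
  shows "bij_betw \<epsilon> (carrier (IO (FO M))) (carrier M)"
proof -
  let ?I = "IO (FO M)"
  interpret M: heis_module scale \<omega> l B q M by (rule heis_moduleI) (use M in \<open>simp add: hobj_def\<close>)
  have N: "cobj (FO M)" by (rule cobj_invariants[OF M])
  have I: "hobj ?I" by (rule hobj_induced[OF N])
  interpret I: heis_module scale \<omega> l B q ?I by (rule heis_moduleI) (use I in \<open>simp add: hobj_def\<close>)
  note eD = lin_homD[OF \<epsilon>(1)]
  have e0: "\<epsilon> \<zero>\<^bsub>?I\<^esub> = \<zero>\<^bsub>M\<^esub>"
    by (rule additive_minus(1)[OF I.V.M.abelian_group_axioms M.V.M.abelian_group_axioms])
      (use eD in auto)
  have em: "\<epsilon> (s \<ominus>\<^bsub>?I\<^esub> t) = \<epsilon> s \<ominus>\<^bsub>M\<^esub> \<epsilon> t" if "s \<in> carrier ?I" "t \<in> carrier ?I" for s t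
    by (rule additive_minus(3)[OF I.V.M.abelian_group_axioms M.V.M.abelian_group_axioms])
      (use eD that in auto)
  let ?K = "{t \<in> carrier ?I. \<epsilon> t = \<zero>\<^bsub>M\<^esub>}"
  have K: "t = \<zero>\<^bsub>?I\<^esub>" if t: "t \<in> ?K" for t
  proof (rule ccontr)
    assume "t \<noteq> \<zero>\<^bsub>?I\<^esub>"
    have "\<exists>m\<in>?K. m \<in> I.Inv \<and> m \<noteq> \<zero>\<^bsub>?I\<^esub>"
    proof (rule I.Inv_nonzero[OF _ _ _ t \<open>t \<noteq> _\<close>])
      show "locally_nilpotent (l \<times> {0}) ?I" using I by (simp add: hobj_def)
      show "I.V.lin_subset ?K" by (rule I.V.lin_subsetI) (auto simp: eD e0)
      show "act ?I x m \<in> ?K" if "m \<in> ?K" for x m using that by (auto simp: eD I.act_simps M.act_simps)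
    qed
    then obtain m where m: "m \<in> ?K" "m \<in> I.Inv" "m \<noteq> \<zero>\<^bsub>?I\<^esub>" by blast
    \<comment> \<open>Every invariant of the induced module is some \<open>\<eta> n\<close>, and
      there the counit returns \<open>n\<close>. Lying in the kernel thus forces
      \<open>n = 0\<close>, hence \<open>m = 0\<close>.\<close>
    then obtain n where n: "n \<in> carrier (FO M)" "m = \<eta> (FO M) n"
      using eta_props(1)[OF N] by (auto simp: bij_betw_def)
    then have "n = \<zero>\<^bsub>M\<^esub>" using m(1) \<epsilon>(2)[of n] by simp
    moreover have "\<eta> (FO M) \<zero>\<^bsub>M\<^esub> = \<zero>\<^bsub>?I\<^esub>"
      using lin_homD(3)[OF eta_props(2)[OF N], of n 0] lin_homD(1)[OF eta_props(2)[OF N], of n]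
        n calculation by simp
    ultimately show False using n m(3) by simp
  qed
  have "inj_on \<epsilon> (carrier ?I)"
  proof (rule inj_onI)
    fix s t assume st: "s \<in> carrier ?I" "t \<in> carrier ?I" "\<epsilon> s = \<epsilon> t"
    then have "\<epsilon> (s \<ominus>\<^bsub>?I\<^esub> t) = \<zero>\<^bsub>M\<^esub>" using em[OF st(1,2)] eD(1) by (simp add: M.V.M.minus_eq_zero_iff)
    then have "s \<ominus>\<^bsub>?I\<^esub> t = \<zero>\<^bsub>?I\<^esub>" using K st by simp
    then show "s = t" using st by (simp add: I.V.M.minus_eq_zero_iff)
  qed
  moreover have "carrier M \<subseteq> \<epsilon> ` carrier ?I"
  proof (rule M.generated_by_Inv)
    show "acts_invertibly z_elem M" "locally_nilpotent (l \<times> {0}) M" using M by (simp_all add: hobj_def)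
    show "M.V.lin_subset (\<epsilon> ` carrier ?I)"
      by (rule M.V.lin_subsetI) (auto simp: eD simp flip: e0 eD(2,3))
    show "act M x m \<in> \<epsilon> ` carrier ?I" if "m \<in> \<epsilon> ` carrier ?I" for x m
      using that by (auto simp: I.act_simps simp flip: eD(4))
    show "M.Inv \<subseteq> \<epsilon> ` carrier ?I"
    proof
      fix m assume m: "m \<in> M.Inv"
      then have "m = \<epsilon> (\<eta> (FO M) m)" "\<eta> (FO M) m \<in> carrier ?I"
        using \<epsilon>(2) lin_homD(1)[OF eta_props(2)[OF N], of m] by auto
      then show "m \<in> \<epsilon> ` carrier ?I" by blast
    qed
  qed
  ultimately show ?thesis using eD(1) by (auto simp: bij_betw_def)
qed

end

section \<open>The equivalence\<close>

context darboux
begin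

abbreviation emb :: "('k, 'w \<times> 'k, 'u) lie_mod \<Rightarrow> ('k, 'w \<times> 'k, 'u) ind \<Rightarrow> 'u" where
  "emb N \<equiv> chosen_embedding (IO N)"

abbreviation GO :: "('k, 'w \<times> 'k, 'u) lie_mod \<Rightarrow> ('k, 'w \<times> 'k, 'u) lie_mod" where
  "GO N \<equiv> transport (emb N) (IO N)"

abbreviation ret :: "('k, 'w \<times> 'k, 'u) lie_mod \<Rightarrow> 'u \<Rightarrow> ('k, 'w \<times> 'k, 'u) ind" where
  "ret N \<equiv> inv_into (carrier (IO N)) (emb N)"

abbreviation GH :: "('k, 'w \<times> 'k, 'u) lie_mod \<Rightarrow> ('k, 'w \<times> 'k, 'u) lie_mod \<Rightarrow> ('u \<Rightarrow> 'u) \<Rightarrow> 'u \<Rightarrow> 'u" where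
  "GH N N' f \<equiv> \<lambda>t\<in>carrier (GO N). emb N' (IH N' f (ret N t))"

abbreviation CC :: "(('k, 'w \<times> 'k, 'u) lie_mod, 'u \<Rightarrow> 'u) category" where "CC \<equiv> heis_category scale \<omega> l"
abbreviation DD :: "(('k, 'w \<times> 'k, 'u) lie_mod, 'u \<Rightarrow> 'u) category" where "DD \<equiv> center_category scale \<omega>"

lemma category_simps [simp]:
  "Obj CC = Collect hobj" "Hom CC = lie_mod_hom H" "Ident CC M = (\<lambda>m\<in>carrier M. m)"
    "Comp CC M N K g f = compose (carrier M) g f"
  "Obj DD = Collect cobj" "Hom DD = lie_mod_hom Z0" "Ident DD M = (\<lambda>m\<in>carrier M. m)"
    "Comp DD M N K g f = compose (carrier M) g f"
  by (auto simp: heis_category_def center_category_def lie_mod_category_def hobj_def cobj_def)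

lemma functor_simps [simp]:
  "on_obj (invariants_functor l) M = FO M"
  "on_hom (invariants_functor l) M M' f = restrict f (inv0 M)"
  "on_obj (induction_functor scale \<omega> l) N = GO N"
  "on_hom (induction_functor scale \<omega> l) N N' f = GH N N' f"
  by (simp_all add: invariants_functor_def induction_functor_def Let_def transport_def)

lemma transported_induced: "cobj N \<Longrightarrow> transported H (IO N) (emb N)"
  using hobj_induced[of N] chosen_embedding_inj[of N]
  by (simp add: transported_def transported_axioms_def hobj_def)

lemma hobj_GO:
  assumes "cobj N" shows "hobj (GO N)"
proof -
  interpret N: transported H "IO N" "emb N" by (rule transported_induced[OF assms])
  show ?thesis using hobj_induced[OF assms] N.lie_module_T N.acts_invertibly_T[of z_elem]
    N.locally_nilpotent_T[of "l \<times> {0}"]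
    by (simp add: hobj_def)
qed

lemma lin_hom_zero: "hobj M \<Longrightarrow> hobj M' \<Longrightarrow> lin_hom H M M' f \<Longrightarrow> f \<zero>\<^bsub>M\<^esub> = \<zero>\<^bsub>M'\<^esub>"
  unfolding hobj_def lie_module_def Module.module_def
  by (rule additive_minus(1)) (auto dest: lin_homD)

lemma lin_hom_invariants:
  assumes "hobj M" "hobj M'" "lin_hom H M M' f" "m \<in> inv0 M"
  shows "f m \<in> inv0 M'"
  using assms(4) lin_hom_zero[OF assms(1-3)] lin_homD(1)[OF assms(3)]
  by (auto simp: invariants_def simp flip: lin_homD(4)[OF assms(3), simplified])

lemma lin_hom_FO: "hobj M \<Longrightarrow> hobj M' \<Longrightarrow> lin_hom H M M' f \<Longrightarrow> lin_hom Z0 (FO M) (FO M') f"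
  using lin_hom_invariants[of M M' f] unfolding lin_hom_def by (auto simp: invariants_def)

lemma FO_hom:
  assumes "hobj M" "hobj M'" "f \<in> lie_mod_hom H M M'"
  shows "restrict f (inv0 M) \<in> lie_mod_hom Z0 (FO M) (FO M')"
  using lie_module.lin_hom_restrict[of Z0 "FO M"
    "FO M'" f] cobj_invariants[OF assms(1)] lin_hom_FO[OF assms(1,2)] assms(3)
  by (simp add: lie_mod_hom_iff cobj_def)

lemma functor_F: "is_functor (CC :: (('k, 'w \<times> 'k, 'u) lie_mod, 'u \<Rightarrow> 'u) category) DD (invariants_functor l)"
proof -
  have inv: "m \<in> inv0 M \<Longrightarrow> m \<in> carrier M" for m and M :: "('k, 'w \<times> 'k, 'u) lie_mod"
    by (simp add: invariants_def)
  have id: "carrier M \<inter> inv0 M = inv0 M" for M :: "('k, 'w \<times> 'k, 'u) lie_mod"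
    by (auto simp: inv)
  have comp: "restrict (compose (carrier M) g f) (inv0 M) =
     compose (inv0 M) (restrict g (inv0 M')) (restrict f (inv0 M))"
    if "hobj M" "hobj M'" "f \<in> lie_mod_hom H M M'" for M M' :: "('k, 'w \<times> 'k, 'u) lie_mod" and f g
    using lin_hom_invariants[OF that(1,2)] that(3)
      by (auto simp: fun_eq_iff compose_def lie_mod_hom_iff inv)
  have "is_category (CC :: (('k, 'w \<times> 'k, 'u) lie_mod, 'u \<Rightarrow> 'u) category)"
    "is_category (DD :: (('k, 'w \<times> 'k, 'u) lie_mod, 'u \<Rightarrow> 'u) category)"
    unfolding heis_category_def center_category_def by (rule is_category_lie_mod)+
  then show ?thesis
    unfolding is_functor_def functor_simps category_simps mem_Collect_eq
    by (intro conjI ballI) (simp_all add: cobj_invariants FO_hom id comp)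
qed

lemma ret_emb: "cobj N \<Longrightarrow> u \<in> carrier (IO N) \<Longrightarrow> ret N (emb N u) = u"
  by (simp add: chosen_embedding_inj)

lemma carrier_GO: "carrier (GO N) = emb N ` carrier (IO N)"
  by (simp add: transport_def Let_def)

lemma id_hom: "lin_hom L M M (\<lambda>m. m)"
  by (auto simp: lin_hom_def)

lemma GH_hom:
  assumes "cobj N" "cobj N'" "f \<in> lie_mod_hom Z0 N N'"
  shows "GH N N' f \<in> lie_mod_hom H (GO N) (GO N')"
proof -
  interpret N: transported H "IO N" "emb N" by (rule transported_induced[OF assms(1)])
  interpret N': transported H "IO N'" "emb N'" by (rule transported_induced[OF assms(2)])
  show ?thesis
    by (rule lie_module.lin_hom_restrict[OF N.lie_module_T]
        lin_hom_comp[OF lin_hom_comp[OF N.lin_hom_r heis_induced_map_props(1)[OF assms(1,2)]]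
          N'.lin_hom_e])+
       (use assms(3) in \<open>simp add: lie_mod_hom_iff\<close>)
qed

lemma GH_emb: "cobj N \<Longrightarrow> u \<in> carrier (IO N) \<Longrightarrow> GH N N' f (emb N u) = emb N' (IH N' f u)"
  by (simp add: carrier_GO ret_emb)

text \<open>Functoriality is tested on the elements \<open>\<eta> N n\<close> only, by uniqueness of
  homomorphisms out of an induced module.\<close>

lemma induced_map_id:
  assumes N: "cobj N" and u: "u \<in> carrier (IO N)"
  shows "IH N (\<lambda>n\<in>carrier N. n) u = u"
proof (rule induced_hom_eqI[OF N _ _ id_hom _ u])
  show M: "lie_module H (IO N)" using hobj_induced[OF N] by (simp add: hobj_def)
  have f: "lin_hom Z0 N N (\<lambda>n\<in>carrier N. n)"
    using N by (intro lie_module.lin_hom_cong[OF _ id_hom]) (auto simp: cobj_def)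
  show "lin_hom H (IO N) (IO N) (IH N (\<lambda>n\<in>carrier N. n))"
    by (rule heis_induced_map_props(1)[OF N N f])
  show "IH N (\<lambda>n\<in>carrier N. n) (\<eta> N n) = \<eta> N n" if "n \<in> carrier N" for n
    using heis_induced_map_props(2)[OF N N f that] that by simp
qed

lemma induced_map_comp:
  assumes N: "cobj N" "cobj N'"
    "cobj N''" and f: "f \<in> lie_mod_hom Z0 N N'" and g: "g \<in> lie_mod_hom Z0 N' N''"
      and u: "u \<in> carrier (IO N)"
  shows "IH N'' (compose (carrier N) g f) u = IH N'' g (IH N' f u)"
proof (rule induced_hom_eqI[OF N(1) _ _ _ _ u])
  show "lie_module H (IO N'')" using hobj_induced[OF N(3)] by (simp add: hobj_def)
  have f': "lin_hom Z0 N N' f" and g': "lin_hom Z0 N' N'' g" using f g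
    by (simp_all add: lie_mod_hom_iff)
  have gf: "lin_hom Z0 N N'' (compose (carrier N) g f)"
    using N by (intro lie_module.lin_hom_cong[OF _ lin_hom_comp[OF f' g']]) (auto
      simp: cobj_def compose_def)
  show "lin_hom H (IO N) (IO N'') (IH N'' (compose (carrier N) g f))"
    by (rule heis_induced_map_props(1)[OF N(1,3) gf])
  show "lin_hom H (IO N) (IO N'') (\<lambda>u. IH N'' g (IH N' f u))"
    by (rule lin_hom_comp[OF heis_induced_map_props(1)[OF N(1,2) f']
      heis_induced_map_props(1)[OF N(2,3) g']])
  fix n assume n: "n \<in> carrier N"
  then show "IH N'' (compose (carrier N) g f) (\<eta> N n) =
      IH N'' g (IH N' f (\<eta> N n))"
    using heis_induced_map_props(2)[OF N(1,3) gf n] heis_induced_map_props(2)[OF N(1,2) f' n]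
      heis_induced_map_props(2)[OF N(2,3) g' lin_homD(1)[OF f' n]] by (simp add: compose_def)
qed

lemma induced_map_closed:
  "cobj N \<Longrightarrow> cobj N' \<Longrightarrow> f \<in> lie_mod_hom Z0 N N' \<Longrightarrow> u \<in> carrier (IO N) \<Longrightarrow> IH N' f u \<in> carrier (IO N')"
  using lin_homD(1)[OF heis_induced_map_props(1)] unfolding lie_mod_hom_iff by blast

lemma functor_G: "is_functor (DD :: (('k, 'w \<times> 'k, 'u) lie_mod, 'u \<Rightarrow> 'u) category) CC (induction_functor scale \<omega> l)"
proof -
  have id: "GH N N (\<lambda>n\<in>carrier N. n) = (\<lambda>t\<in>carrier (GO N). t)"
    if "cobj N" for N :: "('k, 'w \<times> 'k, 'u) lie_mod"
    by (rule restrict_ext) (auto simp: carrier_GO ret_emb induced_map_id that)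
  have comp: "GH N N'' (compose (carrier N) g f) = compose (carrier (GO N)) (GH N' N'' g) (GH N N' f)"
    if "cobj N" "cobj N'" "cobj N''" "f \<in> lie_mod_hom Z0 N N'"
      "g \<in> lie_mod_hom Z0 N' N''" for N N' N'' :: "('k, 'w \<times> 'k, 'u) lie_mod" and f g
    unfolding compose_def[of "carrier (GO N)"]
  proof (rule restrict_ext)
    fix t assume "t \<in> carrier (GO N)"
    then obtain u where u: "u \<in> carrier (IO N)" "t = emb N u" by (auto simp: carrier_GO)
    then have "GH N N' f t = emb N' (IH N' f u)" using GH_emb[OF that(1)] by blast
    then have "GH N' N'' g (GH N N' f t) = emb N'' (IH N'' g (IH N' f u))"
      using GH_emb[OF that(2) induced_map_closed[OF that(1,2,4) u(1)]] by metis
    then show "emb N'' (IH N'' (compose (carrier N) g f) (ret N t)) = GH N' N'' g (GH N N' f t)"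
      using induced_map_comp[OF that u(1)] u ret_emb[OF that(1)] by simp
  qed
  have "is_category (CC :: (('k, 'w \<times> 'k, 'u) lie_mod, 'u \<Rightarrow> 'u) category)"
    "is_category (DD :: (('k, 'w \<times> 'k, 'u) lie_mod, 'u \<Rightarrow> 'u) category)"
    unfolding heis_category_def center_category_def by (rule is_category_lie_mod)+
  then show ?thesis
    unfolding is_functor_def functor_simps category_simps Ball_def mem_Collect_eq
    by (blast intro: hobj_GO id comp GH_hom)
qed

text \<open>The counit, an extension of the inclusion of the invariants. Its values on the carrier
  are unique since the invariants generate the induced module, so the arbitrary choice does not
  disturb naturality.\<close>

definition \<epsilon> :: "('k, 'w \<times> 'k, 'u) lie_mod \<Rightarrow> ('k, 'w \<times> 'k, 'u) ind \<Rightarrow> 'u" where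
  "\<epsilon> M = (SOME f. lin_hom H (IO (FO M)) M f \<and> (\<forall>n\<in>carrier (FO M). f (\<eta> (FO M) n) = n))"

lemma counit:
  assumes M: "hobj M"
  shows "lin_hom H (IO (FO M)) M (\<epsilon> M)" "m \<in> inv0 M \<Longrightarrow> \<epsilon> M (\<eta> (FO M) m) = m"
    "bij_betw (\<epsilon> M) (carrier (IO (FO M))) (carrier M)"
proof -
  have "lin_hom Z0 (FO M) M (\<lambda>m. m)" by (auto simp: lin_hom_def invariants_def)
  then have "\<exists>f. lin_hom H (IO (FO M)) M f \<and> (\<forall>n\<in>carrier (FO M). f (\<eta> (FO M) n) = n)"
    using M by (intro induced_universal[OF cobj_invariants[OF M]]) (auto simp: hobj_def)
  then have e: "lin_hom H (IO (FO M)) M (\<epsilon> M) \<and> (\<forall>n\<in>carrier (FO M). \<epsilon> M (\<eta> (FO M) n) = n)"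
    unfolding \<epsilon>_def by (rule someI_ex)
  then show "lin_hom H (IO (FO M)) M (\<epsilon> M)" "m \<in> inv0 M \<Longrightarrow> \<epsilon> M (\<eta> (FO M) m) = m"
    by simp_all
  show "bij_betw (\<epsilon> M) (carrier (IO (FO M))) (carrier M)"
    by (rule counit_bij[OF M]) (use e in simp_all)
qed

text \<open>Both sides are homomorphisms out of an induced module, so they are compared on
  \<open>\<eta> (FO M) m\<close>, where each gives \<open>f m\<close>.\<close>

lemma counit_natural:
  assumes M: "hobj M" "hobj M'" and f: "f \<in> lie_mod_hom H M M'" and u: "u \<in> carrier (IO (FO M))"
  shows "\<epsilon> M' (IH (FO M') (restrict f (inv0 M)) u) = f (\<epsilon> M u)"
proof (rule induced_hom_eqI[OF cobj_invariants[OF M(1)] _ _ _ _ u])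
  let ?f = "restrict f (inv0 M)"
  note c = cobj_invariants[OF M(1)] cobj_invariants[OF M(2)]
  show "lie_module H M'" using M by (simp add: hobj_def)
  have f': "lin_hom H M M' f" using f by (simp add: lie_mod_hom_iff)
  have "lin_hom Z0 (FO M) (FO M') f" by (rule lin_hom_FO[OF M f'])
  then have Ff: "lin_hom Z0 (FO M) (FO M') ?f"
    using c by (intro lie_module.lin_hom_cong[of Z0 "FO M" "FO M'" f ?f]) (auto simp: cobj_def)
  show "lin_hom H (IO (FO M)) M' (\<lambda>u. \<epsilon> M' (IH (FO M') ?f u))"
    by (rule lin_hom_comp[OF heis_induced_map_props(1)[OF c Ff] counit(1)[OF M(2)]])
  show "lin_hom H (IO (FO M)) M' (\<lambda>u. f (\<epsilon> M u))"
    by (rule lin_hom_comp[OF counit(1)[OF M(1)] f'])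
  fix m assume m: "m \<in> carrier (FO M)"
  then show "\<epsilon> M' (IH (FO M') ?f (\<eta> (FO M) m)) = f (\<epsilon> M (\<eta> (FO M) m))"
    using heis_induced_map_props(2)[OF c Ff m] counit(2)[OF M(1)] counit(2)[OF M(2)]
      lin_hom_invariants[OF M f'] by simp
qed

lemma natural_GF: "naturally_isomorphic (CC :: (('k, 'w \<times> 'k, 'u) lie_mod, 'u \<Rightarrow> 'u) category) CC (comp_functor (induction_functor scale \<omega> l) (invariants_functor l)) id_functor"
proof -
  define \<theta> where "\<theta> M
    = (\<lambda>t\<in>carrier (GO (FO M)). \<epsilon> M (ret (FO M) t))" for M :: "('k, 'w \<times> 'k, 'u) lie_mod"
  have iso: "is_isomorphism CC (GO (FO M)) M (\<theta> M)" if M: "hobj M" for M :: "('k, 'w \<times> 'k, 'u) lie_mod"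
  proof -
    interpret N: transported H "IO (FO M)" "emb (FO M)"
      by (rule transported_induced[OF cobj_invariants[OF M]])
    have b: "bij_betw (\<epsilon> M \<circ> ret (FO M)) (carrier (GO (FO M))) (carrier M)"
      by (rule bij_betw_trans[OF bij_betw_inv_into[OF N.bij_e] counit(3)[OF M]])
    show ?thesis unfolding heis_category_def
    proof (rule is_isomorphism_lie_mod[OF N.lie_module_T])
      show "lie_module H M" using M by (simp add: hobj_def)
      show "\<theta> M \<in> lie_mod_hom H (GO (FO M)) M"
        unfolding \<theta>_def by (rule lie_module.lin_hom_restrict[OF N.lie_module_T lin_hom_comp[OF N.lin_hom_r counit(1)[OF M]]])
      show "bij_betw (\<theta> M) (carrier (GO (FO M))) (carrier M)"
        using b by (rule bij_betw_cong[THEN iffD1, rotated]) (simp add: \<theta>_def)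
    qed
  qed
  have nat: "compose (carrier (GO (FO M))) (\<theta> M') (GH (FO M) (FO M') (restrict f (inv0 M)))
    = compose (carrier (GO (FO M))) f (\<theta> M)"
    if "hobj M" "hobj M'" "f \<in> lie_mod_hom H M M'" for M M' :: "('k, 'w \<times> 'k, 'u) lie_mod" and f
  proof -
    note cl = induced_map_closed[OF cobj_invariants[OF that(1)] cobj_invariants[OF that(2)]
      FO_hom[OF that]]
    have \<theta>_emb: "\<theta> K (emb (FO K) u) = \<epsilon> K u" if "hobj K" "u \<in> carrier (IO (FO K))" for K u
      using that by (simp add: \<theta>_def carrier_GO ret_emb cobj_invariants)
    show ?thesis unfolding compose_def
    proof (rule restrict_ext)
      fix t assume "t \<in> carrier (GO (FO M))"
      then obtain u where u: "u \<in> carrier (IO (FO M))" "t = emb (FO M) u" by (auto simp: carrier_GO)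
      have "GH (FO M) (FO M') (restrict f (inv0 M)) t =
          emb (FO M') (IH (FO M') (restrict f (inv0 M)) u)"
        unfolding u(2) by (rule GH_emb[OF cobj_invariants[OF that(1)] u(1)])
      then show "\<theta> M' (GH (FO M) (FO M') (restrict f (inv0 M)) t) = f (\<theta> M t)"
        using \<theta>_emb[OF that(2) cl[OF u(1)]] \<theta>_emb[OF that(1) u(1)] counit_natural[OF that u(1)] u(2)
          by metis
    qed
  qed
  show ?thesis
    unfolding naturally_isomorphic_def
    by (intro exI[of _ \<theta>]) (simp add: comp_functor_def id_functor_def iso nat)
qed

text \<open>Transport carries invariants to invariants, so the description of the invariants of the
  tensor product by \<open>\<eta>\<close> passes to its copy.\<close>

lemma unit_transported:
  assumes N: "cobj N"
  shows "bij_betw (\<lambda>n. emb N (\<eta> N n)) (carrier N) (carrier (FO (GO N)))"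
    "lin_hom Z0 N (FO (GO N)) (\<lambda>n. emb N (\<eta> N n))"
proof -
  interpret N: transported H "IO N" "emb N" by (rule transported_induced[OF N])
  have inv: "carrier (FO (GO N)) = emb N ` inv0 (IO N)" by (simp add: N.invariants_T)
  have "bij_betw (emb N) (inv0 (IO N)) (carrier (FO (GO N)))"
    unfolding inv by (rule bij_betw_subset[OF N.bij_e]) (auto simp: invariants_def)
  from bij_betw_trans[OF eta_props(1)[OF N] this]
  show b: "bij_betw (\<lambda>n. emb N (\<eta> N n)) (carrier N) (carrier (FO (GO N)))" by (simp add: comp_def)
  have "lin_hom Z0 (IO N) (GO N) (emb N)" using N.lin_hom_e by (simp add: lin_hom_def)
  from lin_hom_comp[OF eta_props(2)[OF N] this] b
  show "lin_hom Z0 N (FO (GO N)) (\<lambda>n. emb N (\<eta> N n))" by (auto simp: lin_hom_def bij_betw_def)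
qed

lemma natural_FG: "naturally_isomorphic (DD :: (('k, 'w \<times> 'k, 'u) lie_mod, 'u \<Rightarrow> 'u) category) DD (comp_functor (invariants_functor l) (induction_functor scale \<omega> l)) id_functor"
proof -
  define j where "j N n = emb N (\<eta> N n)" for N :: "('k, 'w \<times> 'k, 'u) lie_mod" and n
  \<comment> \<open>The required isomorphism points from the composite to the identity, so the
    inverse of the unit is used.\<close>
  define \<theta> where "\<theta> N
    = restrict (inv_into (carrier N) (j N)) (carrier (FO (GO N)))" for N :: "('k, 'w \<times> 'k, 'u) lie_mod"
  have j: "bij_betw (j N) (carrier N) (carrier (FO (GO N)))" "lin_hom Z0 N (FO (GO N)) (j N)"
    if "cobj N" for N :: "('k, 'w \<times> 'k, 'u) lie_mod"
    using unit_transported[OF that] unfolding j_def[abs_def] by auto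
  have c: "cobj (FO (GO N))" if "cobj N" for N :: "('k, 'w \<times> 'k, 'u) lie_mod"
    by (rule cobj_invariants[OF hobj_GO[OF that]])
  have iso: "is_isomorphism DD (FO (GO N)) N (\<theta> N)" if N: "cobj N" for N :: "('k, 'w \<times> 'k, 'u) lie_mod"
    unfolding center_category_def
  proof (rule is_isomorphism_lie_mod)
    show l: "lie_module Z0 (FO (GO N))" "lie_module Z0 N" using c N by (simp_all add: cobj_def)
    show "\<theta> N \<in> lie_mod_hom Z0 (FO (GO N)) N"
      unfolding \<theta>_def by (rule lie_module.lin_hom_restrict[OF l(1) lie_module.lin_hom_inv[OF l(2) j(2,1)[OF N]]])
    show "bij_betw (\<theta> N) (carrier (FO (GO N))) (carrier N)"
      using bij_betw_inv_into[OF j(1)[OF N]]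
        by (rule bij_betw_cong[THEN iffD1, rotated]) (simp add: \<theta>_def)
  qed
  have nat: "compose (carrier (FO (GO N))) (\<theta> N') (restrict (GH N N' f) (carrier (FO (GO N))))
    = compose (carrier (FO (GO N))) f (\<theta> N)"
    if N: "cobj N" "cobj N'" and f: "f \<in> lie_mod_hom Z0 N N'" for N N' :: "('k, 'w \<times> 'k, 'u) lie_mod"
      and f
  proof -
    have f': "lin_hom Z0 N N' f" using f by (simp add: lie_mod_hom_iff)
    have \<theta>j: "\<theta> K (j K n) = n" "j K n \<in> carrier (FO (GO K))" if "cobj K" "n \<in> carrier K" for K n
      using j(1)[OF that(1)] that(2) by (auto simp: \<theta>_def bij_betw_def)
    have "\<theta> N' (GH N N' f t) = f (\<theta> N t)" if t: "t \<in> carrier (FO (GO N))" for t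
    proof -
      obtain n where n: "n \<in> carrier N" "t = j N n" using j(1)[OF N(1)] t by (auto simp: bij_betw_def)
      have "GH N N' f (j N n) = j N' (f n)"
        unfolding j_def using lin_homD(1)[OF eta_props(2)[OF N(1)] n(1)]
          heis_induced_map_props(2)[OF N f' n(1)]
        by (subst GH_emb[OF N(1)]) simp_all
      then show ?thesis using n \<theta>j N lin_homD(1)[OF f' n(1)] by simp
    qed
    then show ?thesis unfolding compose_def by (intro restrict_ext) simp
  qed
  show ?thesis
    unfolding naturally_isomorphic_def
    by (intro exI[of _ \<theta>]) (use nat in \<open>simp add: comp_functor_def id_functor_def iso\<close>)
qed

end

text \<open>The middle conjunct certifies that the object part of \<open>induction_functor\<close>,
  a copy along an arbitrarily chosen embedding, is isomorphic to the tensor product itself.\<close>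

theorem theoremA:
  fixes scale :: "'k::field_char_0 \<Rightarrow> 'w::ab_group_add \<Rightarrow> 'w"
    and \<omega> :: "'w \<Rightarrow> 'w \<Rightarrow> 'k"
    and l :: "'w set"
  assumes "symplectic_space scale \<omega>"
    and "lagrangian scale \<omega> l"
  shows "quasi_inverse
      (heis_category scale \<omega> l :: (('k, 'w \<times> 'k, 'u) lie_mod, 'u \<Rightarrow> 'u) category)
      (center_category scale \<omega>)
      (invariants_functor l)
      (induction_functor scale \<omega> l) \<and>
    (\<forall>N \<in> Obj (center_category scale \<omega> :: (('k, 'w \<times> 'k, 'u) lie_mod, 'u \<Rightarrow> 'u) category).
      \<exists>e \<in> lie_mod_hom (heisenberg scale \<omega>) (heis_induced scale \<omega> l N)
              (on_obj (induction_functor scale \<omega> l) N).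
        bij_betw e (carrier (heis_induced scale \<omega> l N))
          (carrier (on_obj (induction_functor scale \<omega> l) N))) \<and>
    equivalent_categories
      (heis_category scale \<omega> l :: (('k, 'w \<times> 'k, 'u) lie_mod, 'u \<Rightarrow> 'u) category)
      (center_category scale \<omega> :: (('k, 'w \<times> 'k, 'u) lie_mod, 'u \<Rightarrow> 'u) category)"
proof -
  \<comment> \<open>The Darboux basis is auxiliary: categories and functors are defined without it,
    so any choice will do.\<close>
  obtain B q where Bq: "finite B" "B \<subseteq> l"
    "\<And>b b'. b \<in> B \<Longrightarrow> b' \<in> B \<Longrightarrow> \<omega> b (q b') = (if b = b' then 1 else 0)"
    "\<And>b b'. b \<in> B \<Longrightarrow> b' \<in> B \<Longrightarrow> \<omega> (q b) (q b') = 0"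
    "\<And>w. w = (\<Sum>b\<in>B. scale (\<omega> w (q b)) b + scale (\<omega> b w) (q b))"
    using darboux_basis[OF assms] by blast
  interpret symplectic_space scale \<omega> by fact
  interpret darboux scale \<omega> l B q
    by unfold_locales (fact assms(2) Bq)+
  have "quasi_inverse CC DD (invariants_functor l) (induction_functor scale \<omega> l)"
    unfolding quasi_inverse_def using functor_F functor_G natural_GF natural_FG by blast
  moreover have "\<exists>e\<in>lie_mod_hom H (IO N) (on_obj (induction_functor scale \<omega> l) N).
      bij_betw e (carrier (IO N)) (carrier (on_obj (induction_functor scale \<omega> l) N))"
    if "N \<in> Obj DD" for N :: "('k, 'w \<times> 'k, 'u) lie_mod"
  proof -
    interpret N: transported H "IO N" "emb N" by (rule transported_induced) (use that in simp)
    \<comment> \<open>Morphisms are extensional functions, so the embedding is cut down to the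
      carrier before it can serve as the isomorphism.\<close>
    have "bij_betw (restrict (emb N) (carrier (IO N))) (carrier (IO N)) (carrier (GO N))"
      using N.bij_e by (rule bij_betw_cong[THEN iffD1, rotated]) simp
    then show ?thesis unfolding functor_simps using N.lin_hom_restrict[OF N.lin_hom_e] by blast
  qed
  ultimately show ?thesis unfolding equivalent_categories_def by blast
qed

end
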